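(* Let $\alpha,\beta$ be integers different from $1$ with $v_2(\alpha-1)=v_2(\beta-1)=m\ge 3$, and suppose $v_2(\alpha-\beta)=2m-2$. Then $|G_2|=2^{7m-3}$, the nilpotency class of $G_2$ is $5$, $o(a)=o(b)=2^{3m-1}$ and $o(c)=2^{2m-1}$.
   Context: $G(\alpha,\beta)=\langle A,B\mid A^{[A,B]}=A^{\alpha},\ B^{[B,A]}=B^{\beta}\rangle$ with $[x,y]=x^{-1}y^{-1}xy$, $y^x=x^{-1}yx$, and $C=[A,B]$. The group $G(\alpha,\beta)$ is finite and nilpotent, hence the direct product of its Sylow subgroups; $G_2$ denotes its Sylow $2$-subgroup and $a,b,c$ denote the images of $A,B,C$ under the canonical projection $G(\alpha,\beta)\to G_2$. $v_2$ is the $2$-adic valuation and $o(x)$ the order of $x$. *)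

theory Defs
  imports "HOL-Algebra.Algebra" "HOL-Computational_Algebra.Factorial_Ring"
begin

text \<open>Words in the free group on A, B. A letter is (inverted?, generator),
  generator False = A, True = B.\<close>
type_synonym letter = "bool \<times> bool"
type_synonym word = "letter list"

definition winv :: "word \<Rightarrow> word" where
  "winv w = rev (map (\<lambda>(e, g). (\<not> e, g)) w)"

definition wpow :: "word \<Rightarrow> int \<Rightarrow> word" where
  "wpow w k = (if 0 \<le> k then concat (replicate (nat k) w)
               else concat (replicate (nat (- k)) (winv w)))"

definition wcomm :: "word \<Rightarrow> word \<Rightarrow> word" where
  "wcomm x y = winv x @ winv y @ x @ y"

definition wconj :: "word \<Rightarrow> word \<Rightarrow> word" where
  "wconj y x = winv x @ y @ x"

definition wA :: word where "wA = [(False, False)]"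
definition wB :: word where "wB = [(False, True)]"
definition wC :: word where "wC = wcomm wA wB"

inductive weq :: "int \<Rightarrow> int \<Rightarrow> word \<Rightarrow> word \<Rightarrow> bool" for \<alpha> \<beta> where
  refl: "weq \<alpha> \<beta> u u"
| sym: "weq \<alpha> \<beta> u v \<Longrightarrow> weq \<alpha> \<beta> v u"
| trans: "weq \<alpha> \<beta> u v \<Longrightarrow> weq \<alpha> \<beta> v w \<Longrightarrow> weq \<alpha> \<beta> u w"
| cancel: "weq \<alpha> \<beta> (u @ [(e, g), (\<not> e, g)] @ v) (u @ v)"
| rel1: "weq \<alpha> \<beta> (u @ wconj wA (wcomm wA wB) @ v) (u @ wpow wA \<alpha> @ v)"
| rel2: "weq \<alpha> \<beta> (u @ wconj wB (wcomm wB wA) @ v) (u @ wpow wB \<beta> @ v)"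

definition weq_rel :: "int \<Rightarrow> int \<Rightarrow> (word \<times> word) set" where
  "weq_rel \<alpha> \<beta> = {(u, v). weq \<alpha> \<beta> u v}"

definition Gpres :: "int \<Rightarrow> int \<Rightarrow> word set monoid" where
  "Gpres \<alpha> \<beta> = \<lparr> carrier = UNIV // weq_rel \<alpha> \<beta>,
      monoid.mult = (\<lambda>S T. \<Union>((\<lambda>(x, y). weq_rel \<alpha> \<beta> `` {x @ y}) ` (S \<times> T))),
      monoid.one = weq_rel \<alpha> \<beta> `` {[]} \<rparr>"

definition gA :: "int \<Rightarrow> int \<Rightarrow> word set" where "gA \<alpha> \<beta> = weq_rel \<alpha> \<beta> `` {wA}"
definition gB :: "int \<Rightarrow> int \<Rightarrow> word set" where "gB \<alpha> \<beta> = weq_rel \<alpha> \<beta> `` {wB}"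
definition gC :: "int \<Rightarrow> int \<Rightarrow> word set" where "gC \<alpha> \<beta> = weq_rel \<alpha> \<beta> `` {wC}"

text \<open>In a finite nilpotent group the Sylow 2-subgroup is the set of 2-elements.\<close>
definition two_elements :: "('a, 'b) monoid_scheme \<Rightarrow> 'a set" where
  "two_elements G = {x \<in> carrier G. \<exists>k::nat. group.ord G x = 2 ^ k}"

definition Sylow2 :: "('a, 'b) monoid_scheme \<Rightarrow> ('a, 'b) monoid_scheme" where
  "Sylow2 G = G\<lparr>carrier := two_elements G\<rparr>"

text \<open>The canonical projection onto the Sylow 2-factor: the 2-component x of g,
  i.e. g = x y with x, y commuting, x a 2-element and y of odd order.\<close>
definition two_part :: "('a, 'b) monoid_scheme \<Rightarrow> 'a \<Rightarrow> 'a" where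
  "two_part G g = (THE x. x \<in> two_elements G \<and>
      (\<exists>y\<in>carrier G. odd (group.ord G y) \<and> x \<otimes>\<^bsub>G\<^esub> y = g \<and> x \<otimes>\<^bsub>G\<^esub> y = y \<otimes>\<^bsub>G\<^esub> x))"

definition gcomm :: "('a, 'b) monoid_scheme \<Rightarrow> 'a \<Rightarrow> 'a \<Rightarrow> 'a" where
  "gcomm G x y = inv\<^bsub>G\<^esub> x \<otimes>\<^bsub>G\<^esub> inv\<^bsub>G\<^esub> y \<otimes>\<^bsub>G\<^esub> x \<otimes>\<^bsub>G\<^esub> y"

text \<open>Lower central series, indexed from 0: lcs 0 = G = gamma_1, lcs (n+1) = [lcs n, G].\<close>
fun lcs :: "('a, 'b) monoid_scheme \<Rightarrow> nat \<Rightarrow> 'a set" where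
  "lcs G 0 = carrier G"
| "lcs G (Suc n) = generate G {gcomm G x y | x y. x \<in> lcs G n \<and> y \<in> carrier G}"

definition nilpotent_group :: "('a, 'b) monoid_scheme \<Rightarrow> bool" where
  "nilpotent_group G \<longleftrightarrow> group G \<and> (\<exists>n. lcs G n = {\<one>\<^bsub>G\<^esub>})"

definition nilpotency_class :: "('a, 'b) monoid_scheme \<Rightarrow> nat" where
  "nilpotency_class G = (LEAST n. lcs G n = {\<one>\<^bsub>G\<^esub>})"

end

theory Submission
  imports Defs "HOL-Number_Theory.Residues"
begin

text \<open>
  Comparing two expressions for \<open>A\<^sup>x\<close>, \<open>x = B\<^sup>\<beta>\<close>, shows that powers of \<open>C\<close> lie
  in \<open>\<langle>A\<rangle>\<close> and in \<open>\<langle>B\<rangle>\<close>, so \<open>A\<close>, \<open>B\<close>, \<open>C\<close> have finite order, and every prime dividing the order of \<open>A\<close>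
  divides \<open>\<alpha> - 1\<close>. Adjoining powers of \<open>C\<close>, \<open>A\<close>, \<open>B\<close> one prime at a time to normal subgroups splits the group
  into a 2-part and an odd part.

  In the 2-part, conjugating by suitable powers of the generators yields
  \<open>o(a), o(b) | 2\<^sup>3\<^sup>m\<^sup>-\<^sup>1\<close> and \<open>o(c) | 2\<^sup>2\<^sup>m\<^sup>-\<^sup>1\<close>, and that some power \<open>b\<^sup>k\<close> equals \<open>a\<^sup>n\<close>, \<open>n = 2\<^sup>2\<^sup>m\<close>;
  every element has the form \<open>a\<^sup>i b\<^sup>j c\<^sup>k\<close>. That nothing collapses
  further is seen on an explicit model: words act on pairs \<open>(x, j)\<close> modulo \<open>2\<^sup>3\<^sup>m\<^sup>-\<^sup>1\<close>, up to an equivalence, as the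
  group acts on the cosets of \<open>\<langle>c\<rangle>\<close>, and \<open>a\<^sup>i b\<^sup>j c\<^sup>k\<close> sends \<open>(0, 0)\<close> to \<open>(i, j)\<close>. The class is at most 5 because of
  memberships of powers of \<open>a\<close>, \<open>b\<close>, \<open>c\<close> in the upper central series, and at least 5 because the
  fifth term of the lower central series contains a nontrivial power of \<open>a\<close>.
\<close>

section \<open>The presented group\<close>

text \<open>Nothing is known to be finite at the start, and C^-1 need not normalise <A>; powers of C
  are therefore reached through exponent sums of C rather than through a normal form. In the 2-part
  the same comparison is repeated with exact 2-adic valuations. Every bound comes from conjugating
  the resulting relation between A, B and C^(\<alpha>-\<beta>). The last factor 2, from 2^(3m) to
  2^(3m-1), depends on \<eta> = (\<alpha>-\<beta>)/2^(2m-2) being odd: exactly one of \<eta>+1 and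
  \<eta>-1 is divisible by 4. The model is computed modulo 2^(3m-1) because expansions in powers of
  2^m then stop after the quadratic term, so all iterates of b^-1 are polynomials. On bare pairs the
  second relation fails by a multiple of one fixed shift, and the equivalence divides out exactly
  this shift. Since c fixes the base coset, the model bounds only a and b; the order of c is
  recovered from its action on <a>.\<close>

lemma weq_context: "weq \<alpha> \<beta> u v \<Longrightarrow> weq \<alpha> \<beta> (p @ u @ q) (p @ v @ q)"
proof (induction rule: weq.induct)
  case (cancel u e g v)
  show ?case using weq.cancel[of \<alpha> \<beta> "p @ u" e g "v @ q"] by simp
next
  case (rel1 u v)
  show ?case using weq.rel1[of \<alpha> \<beta> "p @ u" "v @ q"] by simp
next
  case (rel2 u v)
  show ?case using weq.rel2[of \<alpha> \<beta> "p @ u" "v @ q"] by simp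
qed (rule weq.refl, erule weq.sym, erule (1) weq.trans)

lemma weq_append: "weq \<alpha> \<beta> u u' \<Longrightarrow> weq \<alpha> \<beta> v v' \<Longrightarrow> weq \<alpha> \<beta> (u @ v) (u' @ v')"
  using weq_context[of \<alpha> \<beta> u u' "[]" v] weq_context[of \<alpha> \<beta> v v' u' "[]"]
  by (auto intro: weq.trans)

lemma winv_Cons: "winv (x # w) = winv w @ [(\<not> fst x, snd x)]"
  by (simp add: winv_def case_prod_beta)

lemma winv_append: "winv (u @ v) = winv v @ winv u"
  by (simp add: winv_def)

lemma winv_winv [simp]: "winv (winv w) = w"
  by (simp add: winv_def rev_map comp_def case_prod_beta)

lemma weq_winv_right: "weq \<alpha> \<beta> (w @ winv w) []"
proof (induction w)
  case Nil
  then show ?case by (simp add: winv_def weq.refl)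
next
  case (Cons x w)
  obtain e g where x: "x = (e, g)" by (cases x)
  have "weq \<alpha> \<beta> ([x] @ (w @ winv w) @ [(\<not> e, g)]) ([x] @ [] @ [(\<not> e, g)])"
    by (rule weq_context[OF Cons])
  moreover have "weq \<alpha> \<beta> ([x] @ [] @ [(\<not> e, g)]) []"
    using weq.cancel[of \<alpha> \<beta> "[]" e g "[]"] x by simp
  ultimately show ?case
    by (simp add: winv_Cons x) (blast intro: weq.trans)
qed

lemma weq_winv_left: "weq \<alpha> \<beta> (winv w @ w) []"
  using weq_winv_right[of \<alpha> \<beta> "winv w"] by simp

definition wcls :: "int \<Rightarrow> int \<Rightarrow> word \<Rightarrow> word set" where
  "wcls \<alpha> \<beta> w = weq_rel \<alpha> \<beta> `` {w}"

lemma equiv_weq_rel: "equiv UNIV (weq_rel \<alpha> \<beta>)"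
proof (rule equivI)
  show "refl (weq_rel \<alpha> \<beta>)" by (simp add: weq_rel_def refl_on_def weq.refl)
  show "sym (weq_rel \<alpha> \<beta>)" by (simp add: weq_rel_def sym_def weq.sym)
  show "trans (weq_rel \<alpha> \<beta>)" unfolding weq_rel_def trans_def by (blast intro: weq.trans)
qed simp

lemma wcls_eq_iff: "wcls \<alpha> \<beta> u = wcls \<alpha> \<beta> v \<longleftrightarrow> weq \<alpha> \<beta> u v"
  using eq_equiv_class_iff[OF equiv_weq_rel, of u v \<alpha> \<beta>] by (simp add: wcls_def weq_rel_def)

lemma wcls_mult: "wcls \<alpha> \<beta> u \<otimes>\<^bsub>Gpres \<alpha> \<beta>\<^esub> wcls \<alpha> \<beta> v = wcls \<alpha> \<beta> (u @ v)"
proof -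
  let ?S = "wcls \<alpha> \<beta> u \<times> wcls \<alpha> \<beta> v"
  have "weq_rel \<alpha> \<beta> `` {fst p @ snd p} = wcls \<alpha> \<beta> (u @ v)" if "p \<in> ?S" for p
  proof -
    have "weq \<alpha> \<beta> u (fst p)" "weq \<alpha> \<beta> v (snd p)"
      using that by (auto simp: wcls_def weq_rel_def)
    then have "weq \<alpha> \<beta> (fst p @ snd p) (u @ v)"
      by (intro weq.sym[OF weq_append])
    then show ?thesis by (simp add: wcls_eq_iff[symmetric] wcls_def)
  qed
  then have "(\<Union>p\<in>?S. weq_rel \<alpha> \<beta> `` {fst p @ snd p}) = (\<Union>p\<in>?S. wcls \<alpha> \<beta> (u @ v))"
    by (rule SUP_cong[OF HOL.refl])
  \<comment> \<open>A union of a constant family equals the constant only over a nonempty index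
    set.\<close>
  moreover have "(u, v) \<in> ?S" by (simp add: wcls_def weq_rel_def weq.refl)
  then have "?S \<noteq> {}" by blast
  ultimately show ?thesis
    by (simp add: Gpres_def case_prod_beta)
qed

lemma wcls_one: "\<one>\<^bsub>Gpres \<alpha> \<beta>\<^esub> = wcls \<alpha> \<beta> []"
  by (simp add: Gpres_def wcls_def)

lemma carrier_Gpres: "carrier (Gpres \<alpha> \<beta>) = range (wcls \<alpha> \<beta>)"
  by (auto simp: Gpres_def wcls_def quotient_def)

lemma group_Gpres: "group (Gpres \<alpha> \<beta>)"
proof (rule groupI)
  fix x assume "x \<in> carrier (Gpres \<alpha> \<beta>)"
  then obtain w where "x = wcls \<alpha> \<beta> w" by (auto simp: carrier_Gpres)
  then show "\<exists>y\<in>carrier (Gpres \<alpha> \<beta>). y \<otimes>\<^bsub>Gpres \<alpha> \<beta>\<^esub> x = \<one>\<^bsub>Gpres \<alpha> \<beta>\<^esub>"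
    by (intro bexI[of _ "wcls \<alpha> \<beta> (winv w)"])
      (auto simp: wcls_mult wcls_one wcls_eq_iff weq_winv_left carrier_Gpres)
qed (auto simp: carrier_Gpres wcls_mult wcls_one)

lemma wcls_inv: "inv\<^bsub>Gpres \<alpha> \<beta>\<^esub> (wcls \<alpha> \<beta> w) = wcls \<alpha> \<beta> (winv w)"
proof -
  interpret group "Gpres \<alpha> \<beta>" by (rule group_Gpres)
  show ?thesis
    by (rule inv_equality)
      (auto simp: wcls_mult wcls_one wcls_eq_iff weq_winv_left carrier_Gpres)
qed

lemma wcls_concat_replicate:
  "wcls \<alpha> \<beta> (concat (replicate n w)) = wcls \<alpha> \<beta> w [^]\<^bsub>Gpres \<alpha> \<beta>\<^esub> n"
proof (induction n)
  case 0
  interpret group "Gpres \<alpha> \<beta>" by (rule group_Gpres)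
  show ?case by (simp add: wcls_one)
next
  case (Suc n)
  interpret group "Gpres \<alpha> \<beta>" by (rule group_Gpres)
  have "wcls \<alpha> \<beta> w [^]\<^bsub>Gpres \<alpha> \<beta>\<^esub> Suc n = wcls \<alpha> \<beta> w \<otimes>\<^bsub>Gpres \<alpha> \<beta>\<^esub> wcls \<alpha> \<beta> w [^]\<^bsub>Gpres \<alpha> \<beta>\<^esub> n"
    by (rule nat_pow_Suc2) (simp add: carrier_Gpres)
  then show ?case by (simp add: Suc[symmetric] wcls_mult)
qed

lemma wcls_wpow: "wcls \<alpha> \<beta> (wpow w k) = wcls \<alpha> \<beta> w [^]\<^bsub>Gpres \<alpha> \<beta>\<^esub> k"
proof -
  interpret group "Gpres \<alpha> \<beta>" by (rule group_Gpres)
  have "wcls \<alpha> \<beta> w \<in> carrier (Gpres \<alpha> \<beta>)" by (simp add: carrier_Gpres)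
  from nat_pow_inv[OF this, of "nat (- k)"] show ?thesis
    by (cases "0 \<le> k")
      (simp_all only: wpow_def int_pow_def2 wcls_concat_replicate wcls_inv if_True if_False
        not_less[symmetric] simp_thms)
qed

lemma generate_Gpres: "carrier (Gpres \<alpha> \<beta>) = generate (Gpres \<alpha> \<beta>) {gA \<alpha> \<beta>, gB \<alpha> \<beta>}"
proof
  interpret group "Gpres \<alpha> \<beta>" by (rule group_Gpres)
  have AB: "gA \<alpha> \<beta> = wcls \<alpha> \<beta> wA" "gB \<alpha> \<beta> = wcls \<alpha> \<beta> wB"
    by (auto simp: gA_def gB_def wcls_def)
  show "generate (Gpres \<alpha> \<beta>) {gA \<alpha> \<beta>, gB \<alpha> \<beta>} \<subseteq> carrier (Gpres \<alpha> \<beta>)"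
    by (rule generate_incl) (auto simp: AB carrier_Gpres)
  have "wcls \<alpha> \<beta> w \<in> generate (Gpres \<alpha> \<beta>) {gA \<alpha> \<beta>, gB \<alpha> \<beta>}" for w
  proof (induction w)
    case Nil
    then show ?case using generate.one[of "Gpres \<alpha> \<beta>"] by (simp add: wcls_one)
  next
    case (Cons x w)
    have "wcls \<alpha> \<beta> [x] \<in> {gA \<alpha> \<beta>, gB \<alpha> \<beta>, inv\<^bsub>Gpres \<alpha> \<beta>\<^esub> gA \<alpha> \<beta>, inv\<^bsub>Gpres \<alpha> \<beta>\<^esub> gB \<alpha> \<beta>}"
      by (cases x; cases "fst x"; cases "snd x") (auto simp: AB wcls_inv wA_def wB_def winv_def)
    then have "wcls \<alpha> \<beta> [x] \<in> generate (Gpres \<alpha> \<beta>) {gA \<alpha> \<beta>, gB \<alpha> \<beta>}"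
      by (auto intro: generate.incl generate.inv)
    then show ?case
      using generate.eng[OF _ Cons, of "wcls \<alpha> \<beta> [x]"] by (simp add: wcls_mult)
  qed
  then show "carrier (Gpres \<alpha> \<beta>) \<subseteq> generate (Gpres \<alpha> \<beta>) {gA \<alpha> \<beta>, gB \<alpha> \<beta>}"
    by (auto simp: carrier_Gpres)
qed

section \<open>Geometric sums\<close>

text \<open>The q-analogue of n at q = a. These sums are the exponents that arise when C is moved
  past powers of A.\<close>

definition gsum :: "int \<Rightarrow> nat \<Rightarrow> int" where
  "gsum a n = (\<Sum>i<n. a ^ i)"

lemma gsum_0 [simp]: "gsum a 0 = 0" and gsum_Suc: "gsum a (Suc n) = gsum a n + a ^ n"
  by (simp_all add: gsum_def)

lemma gsum_Suc_left: "gsum a (Suc n) = 1 + a * gsum a n"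
  by (simp add: gsum_def sum.lessThan_Suc_shift sum_distrib_left del: sum.lessThan_Suc)

lemma gsum_geometric: "(a - 1) * gsum a n = a ^ n - 1"
  by (induction n) (simp_all add: gsum_Suc algebra_simps)

lemma gsum_add: "gsum a (m + n) = gsum a m + a ^ m * gsum a n"
  by (induction n) (simp_all add: gsum_Suc algebra_simps power_add)

lemma gsum_mult: "gsum a (m * n) = gsum a m * gsum (a ^ m) n"
  by (induction n) (simp_all add: gsum_Suc_left gsum_add algebra_simps)

lemma dvd_power_minus_one: "(a - 1 :: int) dvd a ^ n - 1"
  using gsum_geometric[of a n] by (metis dvd_triv_left)

lemma gsum_cong_count: "(a - 1) dvd gsum a n - int n"
proof (induction n)
  case (Suc n)
  have "gsum a (Suc n) - int (Suc n) = (gsum a n - int n) + (a ^ n - 1)"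
    by (simp add: gsum_Suc)
  then show ?case using dvd_add[OF Suc dvd_power_minus_one[of a n]] by (simp only:)
qed simp

text \<open>Lifting the exponent: by \<open>gsum_mult\<close> each prime factor p contributes a
  factor \<open>gsum (a ^ d) p\<close>, which is congruent to p, hence to 0, modulo p.\<close>

lemma dvd_gsum:
  fixes d n :: nat
  assumes "d dvd n" "d \<noteq> 0" "\<And>p. Factorial_Ring.prime p \<Longrightarrow> p dvd d \<Longrightarrow> int p dvd a - 1"
  shows "int d dvd gsum a n"
proof -
  have "int d dvd gsum a d" using assms(2,3)
  proof (induction d rule: prime_divisors_induct)
    case (factor p d)
    have d: "d \<noteq> 0" "Factorial_Ring.prime p" using factor by auto
    have "int p dvd a ^ d - 1"
      using factor.prems(2)[of p] d dvd_power_minus_one[of a d] by (auto intro: dvd_trans)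
    then have "int p dvd gsum (a ^ d) p - int p"
      using gsum_cong_count[of "a ^ d" p] dvd_trans by blast
    then have "int p dvd gsum (a ^ d) p" 
      using dvd_add[of "int p" "gsum (a ^ d) p - int p" "int p"] by simp
    moreover have "int d dvd gsum a d" using factor d by auto
    ultimately show ?case using gsum_mult[of a d p] by (simp add: mult.commute mult_dvd_mono)
  qed auto
  moreover obtain k where "n = d * k" using assms(1) by blast
  ultimately show ?thesis by (simp add: gsum_mult)
qed

text \<open>Split d = g e with g = gcd(d, a-1). Then e is coprime to (a-1)/g, so e divides n and by
  \<open>dvd_gsum\<close> also \<open>gsum a n\<close>, while g divides a-1.\<close>

lemma dvd_power_minus_one_of_dvd_mult:
  fixes d n :: nat
  assumes "int d dvd int n * (a - 1)" "d \<noteq> 0" "\<And>p. Factorial_Ring.prime p \<Longrightarrow> p dvd d \<Longrightarrow> int p dvd a - 1"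
  shows "int d dvd a ^ n - 1"
proof (cases "a = 1")
  case False
  define g where "g = gcd (int d) (a - 1)"
  have g: "g > 0" using assms(2) by (simp add: g_def)
  obtain e where e: "int d = g * e" unfolding g_def by (meson gcd_dvd1 dvdE)
  obtain w where w: "a - 1 = g * w" unfolding g_def by (meson gcd_dvd2 dvdE)
  have "g * e > 0" using assms(2) by (simp add: e[symmetric])
  then have e0: "e > 0" using g by (simp add: zero_less_mult_iff)
  have "gcd e w = 1"
  proof -
    have "gcd (int d) (a - 1) = g" by (simp add: g_def)
    then have "gcd (g * e) (g * w) = g" by (simp only: e w)
    moreover have "gcd (g * e) (g * w) = g * gcd e w" using g by (simp add: gcd_mult_left)
    ultimately show ?thesis using g by simp
  qed
  then have "coprime e w" by (simp add: coprime_iff_gcd_eq_1)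
  moreover have "e dvd int n * w"
    using assms(1) g dvd_mult_cancel_left[of g e "int n * w"] by (simp add: e w mult.left_commute)
  ultimately have "e dvd int n" by (simp add: coprime_dvd_mult_left_iff)
  moreover define e' where "e' = nat e"
  then have e': "e = int e'" using e0 by simp
  ultimately have "e' dvd n" by simp
  moreover have "e' dvd d" using e e' by (metis dvd_triv_right int_dvd_int_iff)
  ultimately have "int e' dvd gsum a n"
    using e0 e' assms(3) by (intro dvd_gsum) (auto intro: dvd_trans)
  then have "g * e dvd (a - 1) * gsum a n" by (simp add: w e' mult_dvd_mono)
  then show ?thesis by (simp add: e gsum_geometric)
qed simp

lemma fermat_int:
  assumes "Factorial_Ring.prime p" "\<not> int p dvd a"
  shows "int p dvd a ^ (p - 1) - 1"
proof -
  define b where "b = nat (a mod int p)"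
  have p: "p > 0" using assms(1) prime_gt_0_nat by blast
  then have b: "int b = a mod int p" by (simp add: b_def)
  then have "\<not> p dvd b" using assms(2) by (metis int_dvd_int_iff dvd_mod_iff dvd_refl)
  then have "[b ^ (p - 1) = 1] (mod p)" using fermat_theorem[OF assms(1)] by simp
  then have "[int b ^ (p - 1) = 1] (mod int p)"
    using cong_int_iff[of "b ^ (p - 1)" 1 p] by simp
  moreover have "[int b ^ (p - 1) = a ^ (p - 1)] (mod int p)"
    by (rule cong_pow) (simp add: b cong_def)
  ultimately show ?thesis by (metis cong_iff_dvd_diff cong_sym cong_trans)
qed

text \<open>The cofactor of a^e - 1 is a sum of q powers of a^e, each congruent to 1 modulo
  q.\<close>

lemma power_minus_one_mult_dvd:
  fixes a :: int and q :: int
  assumes "M dvd a ^ e - 1" "q dvd a ^ e - 1" "q > 0"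
  shows "q * M dvd a ^ (e * nat q) - 1"
proof -
  have "q dvd gsum (a ^ e) (nat q) - q"
    using gsum_cong_count[of "a ^ e" "nat q"] assms(2,3) by (auto intro: dvd_trans)
  then have "q dvd gsum (a ^ e) (nat q)"
    using dvd_add[of q "gsum (a ^ e) (nat q) - q" q] by simp
  then have "M * q dvd (a ^ e - 1) * gsum (a ^ e) (nat q)" using assms(1) by (rule mult_dvd_mono[rotated])
  then show ?thesis by (simp add: gsum_geometric power_mult mult.commute)
qed

text \<open>Only primes that divide \<^term>\<open>a - 1\<close> or are smaller than \<^term>\<open>p\<close> occur in \<^term>\<open>M\<close>, so the
  order of \<^term>\<open>a\<close> modulo \<^term>\<open>M\<close> is prime to \<^term>\<open>p\<close>.\<close>
lemma exponent_prime_to: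
  fixes M p :: nat and a :: int
  assumes "Factorial_Ring.prime p" "\<not> int p dvd a - 1" "M \<noteq> 0"
    and "\<And>q. Factorial_Ring.prime q \<Longrightarrow> q dvd M \<Longrightarrow> int q dvd a - 1 \<or> q < p \<and> \<not> int q dvd a"
  shows "\<exists>e. \<not> p dvd e \<and> int M dvd a ^ e - 1"
  using assms(3,4)
proof (induction M rule: prime_divisors_induct)
  case (unit M)
  have "\<not> p dvd 1" using assms(1) by (metis not_prime_unit)
  then show ?case using unit by (intro exI[of _ 1]) simp
next
  case (factor q M)
  have q: "Factorial_Ring.prime q" "M \<noteq> 0" using factor by auto
  have q1: "q > 1" using q(1) prime_gt_1_nat by blast
  have "q \<noteq> p" using factor.prems(2)[of q] q assms(2) by auto
  then have pq: "\<not> p dvd q" using assms(1) q(1) by (metis primes_dvd_imp_eq)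
  obtain e where e: "\<not> p dvd e" "int M dvd a ^ e - 1" using factor q by auto
  show ?case
  proof (cases "int q dvd a - 1")
    case True
    then have "int q dvd a ^ e - 1" using dvd_power_minus_one dvd_trans by blast
    from power_minus_one_mult_dvd[OF e(2) this] q1
    have "int (q * M) dvd a ^ (e * q) - 1" by simp
    moreover have "\<not> p dvd e * q" using assms(1) e pq by (simp add: prime_dvd_mult_iff)
    ultimately show ?thesis by blast
  next
    case False
    then have qp: "q < p" "\<not> int q dvd a" using factor.prems(2)[of q] q by auto
    have "\<not> p dvd q - 1" using qp q1 by (meson nat_dvd_not_less less_imp_diff_less zero_less_diff)
    have "int q dvd a ^ (e * (q - 1)) - 1"
      using fermat_int[OF q(1) qp(2)] dvd_power_minus_one[of "a ^ (q - 1)" e]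
      by (auto simp: power_mult[symmetric] mult.commute intro: dvd_trans)
    moreover have "int M dvd a ^ (e * (q - 1)) - 1"
      using e(2) dvd_power_minus_one[of "a ^ e" "q - 1"] by (auto simp: power_mult intro: dvd_trans)
    ultimately have "int (q * M) dvd a ^ (e * (q - 1) * q) - 1"
      using power_minus_one_mult_dvd[of "int M" a "e * (q - 1)" "int q"] q1 by simp
    moreover have "\<not> p dvd e * (q - 1) * q"
      using assms(1) e pq \<open>\<not> p dvd q - 1\<close> by (simp add: prime_dvd_mult_iff)
    ultimately show ?thesis by blast
  qed
qed auto

lemma prime_power_dvd_power_minus_one:
  fixes p :: nat and a :: int
  assumes "int p dvd a ^ e - 1" "p > 0"
  shows "int p ^ Suc j dvd a ^ (e * p ^ j) - 1"
proof (induction j)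
  case (Suc j)
  have "int p dvd a ^ (e * p ^ j) - 1"
    using assms(1) dvd_power_minus_one[of "a ^ e" "p ^ j"] by (auto simp: power_mult intro: dvd_trans)
  from power_minus_one_mult_dvd[OF Suc this] assms(2)
  show ?case by (simp add: mult_ac)
qed (use assms in simp)

text \<open>With P the order of A this is an exponent n for which A^n has order p although
  A^(\<open>gsum a n\<close>) is trivial. It is P/p times a number e prime to p. Taking e a multiple
  of p-1 settles the p-part by Fermat. For the other part, the maximality of p leaves only primes
  dividing a-1 or smaller than p, so the exponent needed there is prime to p.\<close>

lemma exponent_for_prime:
  fixes P p :: nat and a :: int
  assumes p: "Factorial_Ring.prime p" "p dvd P" "\<not> int p dvd a - 1" and P: "P \<noteq> 0" and a: "a \<noteq> 1"
    and cop: "\<And>q. Factorial_Ring.prime q \<Longrightarrow> q dvd P \<Longrightarrow> \<not> int q dvd a"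
    and max: "\<And>q. Factorial_Ring.prime q \<Longrightarrow> q dvd P \<Longrightarrow> \<not> int q dvd a - 1 \<Longrightarrow> q \<le> p"
  obtains n where "\<not> P dvd n" "P dvd n * p" "int P dvd gsum a n"
proof -
  obtain r where r: "P = p ^ multiplicity p P * r" "\<not> p dvd r"
    using multiplicity_decompose'[of P p] P p(1) by (metis not_prime_unit)
  define k where "k = multiplicity p P - 1"
  have "multiplicity p P > 0" using p P by (simp add: prime_multiplicity_gt_zero_iff)
  then have Pr: "P = p ^ Suc k * r" using r(1) by (simp add: k_def)
  have r0: "r \<noteq> 0" using Pr P by auto
  \<comment> \<open>The factor a-1 is included because \<open>gsum a n\<close> is a^n - 1 divided by
    a-1.\<close>
  define M where "M = r * nat \<bar>a - 1\<bar>"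
  have M: "int M dvd int r * (a - 1)" "int r * (a - 1) dvd int M" by (auto simp: M_def)
  have "M \<noteq> 0" using r0 a by (simp add: M_def)
  moreover have "int q dvd a - 1 \<or> q < p \<and> \<not> int q dvd a" if q: "Factorial_Ring.prime q" "q dvd M" for q
  proof (cases "int q dvd a - 1")
    case False
    have "q dvd r \<or> q dvd nat \<bar>a - 1\<bar>" using q by (simp add: M_def prime_dvd_mult_iff)
    then have "q dvd r" using False by (auto simp: nat_abs_dvd_iff nat_dvd_iff dvd_nat_abs_iff)
    then have "q dvd P" "q \<noteq> p" using r(2) by (auto simp: Pr)
    then show ?thesis using q cop[of q] max[of q] False by auto
  qed simp
  ultimately obtain e0 where e0: "\<not> p dvd e0" "int M dvd a ^ e0 - 1"
    using exponent_prime_to[OF p(1,3), of M] by blast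
  have p1: "p > 1" using p(1) prime_gt_1_nat by blast
  define e where "e = e0 * (p - 1)"
  have "\<not> p dvd p - 1" using p1 by (meson nat_dvd_not_less diff_less zero_less_diff zero_less_one less_trans)
  then have e: "\<not> p dvd e" using e0 p(1) by (simp add: e_def prime_dvd_mult_iff)
  have "int p dvd a ^ e - 1"
    using fermat_int[OF p(1) cop[OF p(1,2)]] dvd_power_minus_one[of "a ^ (p - 1)" e0]
    by (auto simp: e_def power_mult[symmetric] mult.commute intro: dvd_trans)
  then have pk: "int p ^ Suc k dvd a ^ (e * p ^ k) - 1"
    using prime_power_dvd_power_minus_one p1 by simp
  define n where "n = e * p ^ k * r"
  have "int (p ^ Suc k) dvd a ^ n - 1"
    using pk dvd_power_minus_one[of "a ^ (e * p ^ k)" r] by (auto simp: n_def power_mult intro: dvd_trans)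
  moreover have "int r * (a - 1) dvd a ^ n - 1"
  proof -
    have "n = e0 * ((p - 1) * p ^ k * r)" by (simp add: n_def e_def)
    then have "a ^ e0 - 1 dvd a ^ n - 1"
      using dvd_power_minus_one[of "a ^ e0" "(p - 1) * p ^ k * r"] by (simp add: power_mult)
    then show ?thesis using e0(2) M(2) dvd_trans by blast
  qed
  moreover have "coprime (int (p ^ Suc k)) (int r * (a - 1))"
  proof -
    have "\<not> int p dvd int r * (a - 1)"
      using p r(2) by (simp add: prime_dvd_mult_iff)
    then have "coprime (int p) (int r * (a - 1))" using p(1) by (intro prime_imp_coprime) simp_all
    then show ?thesis by simp
  qed
  ultimately have "int (p ^ Suc k) * (int r * (a - 1)) dvd a ^ n - 1" by (simp add: divides_mult)
  then have "(a - 1) * int P dvd (a - 1) * gsum a n" by (simp add: Pr gsum_geometric mult_ac)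
  then have "int P dvd gsum a n" using a by simp
  moreover have "\<not> P dvd n"
  proof
    assume "P dvd n"
    then have "p ^ k * r * p dvd p ^ k * r * e" by (simp add: Pr n_def mult_ac)
    then show False using e r0 p1 by simp
  qed
  moreover have "P dvd n * p" by (simp add: Pr n_def)
  ultimately show thesis using that by blast
qed

section \<open>Finiteness of the generator orders\<close>

context group
begin

text \<open>Conjugations are kept in the form x y = y z, so that powers can be moved past y without
  writing its inverse.\<close>

lemma int_pow_twist:
  assumes "x \<in> carrier G" "y \<in> carrier G" "z \<in> carrier G" "x \<otimes> y = y \<otimes> z"
  shows "x [^] (k::int) \<otimes> y = y \<otimes> z [^] k"
proof -
  have *: "x [^] n \<otimes> y = y \<otimes> z [^] n" for n :: nat
  proof (induction n)
    case (Suc n)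
    have "x [^] Suc n \<otimes> y = x [^] n \<otimes> (x \<otimes> y)" using assms by (simp add: m_assoc)
    also have "\<dots> = (x [^] n \<otimes> y) \<otimes> z" using assms by (simp add: m_assoc)
    also have "\<dots> = y \<otimes> z [^] Suc n" using assms Suc by (simp add: m_assoc)
    finally show ?case .
  qed (use assms in simp)
  have **: "inv (x [^] n) \<otimes> y = y \<otimes> inv (z [^] n)" for n :: nat
  proof -
    have "inv (x [^] n) \<otimes> y = inv (x [^] n) \<otimes> (y \<otimes> z [^] n) \<otimes> inv (z [^] n)"
      using assms by (simp add: m_assoc)
    also have "\<dots> = inv (x [^] n) \<otimes> (x [^] n \<otimes> y) \<otimes> inv (z [^] n)" by (simp add: *)
    also have "\<dots> = y \<otimes> inv (z [^] n)" using assms by (simp add: m_assoc[symmetric])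
    finally show ?thesis .
  qed
  show ?thesis using assms(1,3)
    by (cases k rule: int_cases2) (simp_all add: int_pow_int int_pow_neg_int * **)
qed

lemma inv_twist:
  assumes "x \<in> carrier G" "y \<in> carrier G" "z \<in> carrier G" "x \<otimes> y = y \<otimes> z"
  shows "inv y \<otimes> x = z \<otimes> inv y"
proof -
  have "inv y \<otimes> x = inv y \<otimes> (x \<otimes> y) \<otimes> inv y" using assms(1-3) by (simp add: m_assoc)
  also have "\<dots> = z \<otimes> inv y" using assms by (simp add: m_assoc[symmetric])
  finally show ?thesis .
qed

lemma inv_mult_cancel [simp]:
  "x \<in> carrier G \<Longrightarrow> y \<in> carrier G \<Longrightarrow> inv x \<otimes> (x \<otimes> y) = y"
  "x \<in> carrier G \<Longrightarrow> y \<in> carrier G \<Longrightarrow> x \<otimes> (inv x \<otimes> y) = y"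
  by (simp_all add: m_assoc[symmetric])

lemma int_pow_add: "x \<in> carrier G \<Longrightarrow> x [^] (i::int) \<otimes> x [^] (j::int) = x [^] (i + j)"
  by (simp add: int_pow_mult)

lemma int_pow_add_assoc:
  "x \<in> carrier G \<Longrightarrow> y \<in> carrier G \<Longrightarrow> x [^] (i::int) \<otimes> (x [^] (j::int) \<otimes> y) = x [^] (i + j) \<otimes> y"
  by (simp add: int_pow_mult m_assoc)

lemma int_pow_eq_one_mult:
  "x \<in> carrier G \<Longrightarrow> x [^] (i::int) = \<one> \<Longrightarrow> i dvd j \<Longrightarrow> x [^] j = \<one>"
  by (elim dvdE) (metis int_pow_pow int_pow_one)

lemma int_pow_cong:
  assumes "x \<in> carrier G" "x [^] (n::int) = \<one>" "n dvd i - j"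
  shows "x [^] i = x [^] j"
proof -
  have "x [^] i = x [^] (i - j) \<otimes> x [^] j" using assms(1) by (simp add: int_pow_add)
  then show ?thesis using int_pow_eq_one_mult[OF assms] assms(1) by simp
qed

end

text \<open>The relations with conjugations cleared: [B,A] = C^-1, so the second one reads C B C^-1
  = B^\<beta>. The locale speaks of three elements of any group and hence passes to homomorphic
  images.\<close>

locale macdonald = group G for G (structure) +
  fixes A B C and \<alpha> \<beta> :: int
  assumes A [simp]: "A \<in> carrier G" and B [simp]: "B \<in> carrier G" and C [simp]: "C \<in> carrier G"
    and AB: "A \<otimes> B = B \<otimes> (A \<otimes> C)"
    and AC: "A \<otimes> C = C \<otimes> A [^] \<alpha>"
    and CB: "C \<otimes> B = B [^] \<beta> \<otimes> C"
begin

text \<open>Exchanging A and B inverts their commutator and exchanges the exponents. Results about A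
  are transferred to B through this symmetry, and combining a relation with its mirror image yields
  new ones.\<close>

lemma macdonald_swap: "macdonald G B A (inv C) \<beta> \<alpha>"
proof
  have "A \<otimes> (B \<otimes> inv C) = (A \<otimes> B) \<otimes> inv C" by (simp add: m_assoc)
  also have "\<dots> = B \<otimes> A" by (simp add: AB m_assoc)
  finally show "B \<otimes> A = A \<otimes> (B \<otimes> inv C)" by simp
  show "B \<otimes> inv C = inv C \<otimes> B [^] \<beta>"
    using inv_twist[of "B [^] \<beta>" C B] CB by simp
  show "inv C \<otimes> A = A [^] \<alpha> \<otimes> inv C"
    using inv_twist[of A C "A [^] \<alpha>"] AC by simp
qed simp_all

lemma A_pow_C_pow: "A [^] (k::int) \<otimes> C [^] (n::nat) = C [^] n \<otimes> A [^] (k * \<alpha> ^ n)"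
proof (induction n arbitrary: k)
  case (Suc n)
  have "A [^] k \<otimes> C [^] Suc n = (A [^] k \<otimes> C [^] n) \<otimes> C" by (simp add: m_assoc)
  also have "\<dots> = C [^] n \<otimes> (A [^] (k * \<alpha> ^ n) \<otimes> C)" by (simp add: Suc m_assoc)
  also have "A [^] (k * \<alpha> ^ n) \<otimes> C = C \<otimes> (A [^] \<alpha>) [^] (k * \<alpha> ^ n)"
    by (rule int_pow_twist) (simp_all add: AC)
  also have "(A [^] \<alpha>) [^] (k * \<alpha> ^ n) = A [^] (k * \<alpha> ^ Suc n)"
    by (simp add: int_pow_pow mult_ac)
  finally show ?case by (simp add: m_assoc)
qed simp

lemma C_pow_B_pow: "C [^] (n::nat) \<otimes> B [^] (k::int) = B [^] (k * \<beta> ^ n) \<otimes> C [^] n"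
proof -
  interpret swap: macdonald G B A "inv C" \<beta> \<alpha> by (rule macdonald_swap)
  have "B [^] k \<otimes> inv (C [^] n) = inv (C [^] n) \<otimes> B [^] (k * \<beta> ^ n)"
    using swap.A_pow_C_pow[of k n] by (simp add: nat_pow_inv)
  from inv_twist[OF _ _ _ this] show ?thesis by simp
qed

lemma AC_pow: "(A \<otimes> C) [^] (n::nat) = C [^] n \<otimes> A [^] (\<alpha> * gsum \<alpha> n)"
proof (induction n)
  case (Suc n)
  have "(A \<otimes> C) [^] Suc n = C [^] n \<otimes> (A [^] (\<alpha> * gsum \<alpha> n + 1) \<otimes> C [^] (1::nat))"
    by (simp add: Suc m_assoc int_pow_mult)
  also have "\<dots> = C [^] Suc n \<otimes> A [^] (\<alpha> * gsum \<alpha> (Suc n))"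
    by (subst A_pow_C_pow) (simp add: m_assoc gsum_Suc_left algebra_simps)
  finally show ?case .
qed simp

lemma CA_pow: "(C \<otimes> A) [^] (n::nat) = C [^] n \<otimes> A [^] gsum \<alpha> n"
proof (induction n)
  case (Suc n)
  have "(C \<otimes> A) [^] Suc n = C [^] n \<otimes> (A [^] gsum \<alpha> n \<otimes> C [^] (1::nat)) \<otimes> A"
    by (simp add: Suc m_assoc)
  also have "\<dots> = C [^] Suc n \<otimes> A [^] (gsum \<alpha> n * \<alpha> + 1)"
    by (subst A_pow_C_pow) (simp add: m_assoc int_pow_mult)
  finally show ?case by (simp add: gsum_Suc_left algebra_simps)
qed simp

lemma A_int_pow_B: "A [^] (k::int) \<otimes> B = B \<otimes> (A \<otimes> C) [^] k"
  by (rule int_pow_twist) (simp_all add: AB)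

lemma A_pow_B: "A [^] (n::nat) \<otimes> B = B \<otimes> (C [^] n \<otimes> A [^] (\<alpha> * gsum \<alpha> n))"
  using A_int_pow_B[of "int n"] by (simp add: int_pow_int AC_pow)

text \<open>As B^\<beta> = C B C^-1, conjugation by B^\<beta> is conjugation by C, then B, then
  C^-1, each of which the relations describe.\<close>

lemma A_B_pow_beta: "A \<otimes> B [^] \<beta> = B [^] \<beta> \<otimes> (C \<otimes> A) [^] \<alpha>"
proof -
  have "B [^] \<beta> = B [^] \<beta> \<otimes> C \<otimes> inv C" by (simp add: m_assoc)
  also have "\<dots> = C \<otimes> B \<otimes> inv C" by (simp add: CB)
  finally have Bb: "B [^] \<beta> = C \<otimes> B \<otimes> inv C" .
  have "A \<otimes> B [^] \<beta> = (A \<otimes> C) \<otimes> (B \<otimes> inv C)" by (simp add: Bb m_assoc)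
  also have "\<dots> = C \<otimes> (A [^] \<alpha> \<otimes> B) \<otimes> inv C" by (simp add: AC m_assoc)
  also have "\<dots> = C \<otimes> B \<otimes> (A \<otimes> C) [^] \<alpha> \<otimes> inv C" by (simp add: A_int_pow_B m_assoc)
  also have "\<dots> = B [^] \<beta> \<otimes> (C \<otimes> (A \<otimes> C) [^] \<alpha>) \<otimes> inv C" by (simp add: CB m_assoc)
  also have "C \<otimes> (A \<otimes> C) [^] \<alpha> = (C \<otimes> A) [^] \<alpha> \<otimes> C"
    by (rule int_pow_twist[symmetric]) (simp_all add: m_assoc)
  finally show ?thesis by (simp add: m_assoc)
qed

text \<open>Elements of <A, C> have the Baumslag-Solitar shape C^i A^k C^-j, and the grade is the
  exponent sum of C. Grades are not claimed to be unique: an element with two grades is what yields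
  a power of C in <A>, by \<open>one_graded\<close>.\<close>

definition graded :: "int \<Rightarrow> 'a set" where
  "graded e = {C [^] i \<otimes> A [^] k \<otimes> inv (C [^] j) | (i::nat) (k::int) (j::nat). int i - int j = e}"

lemma gradedE:
  assumes "x \<in> graded e"
  obtains i j :: nat and k :: int
  where "x = C [^] i \<otimes> A [^] k \<otimes> inv (C [^] j)" "e = int i - int j"
proof -
  from assms have "\<exists>(i::nat) (k::int) (j::nat). x = C [^] i \<otimes> A [^] k \<otimes> inv (C [^] j) \<and> int i - int j = e"
    by (simp only: graded_def mem_Collect_eq)
  then show thesis by (elim exE conjE) (rule that, assumption, simp)
qed

lemma gradedI:
  "x = C [^] (i::nat) \<otimes> A [^] (k::int) \<otimes> inv (C [^] (j::nat)) \<Longrightarrow> e = int i - int j \<Longrightarrow> x \<in> graded e"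
  unfolding graded_def by (rule CollectI, rule exI[of _ i], rule exI[of _ k], rule exI[of _ j]) simp

lemma graded_closed: "x \<in> graded e \<Longrightarrow> x \<in> carrier G"
  by (erule gradedE) simp

lemma inv_C_pow_A_pow: "inv (C [^] (n::nat)) \<otimes> A [^] (k::int) = A [^] (k * \<alpha> ^ n) \<otimes> inv (C [^] n)"
  by (rule inv_twist) (simp_all add: A_pow_C_pow)

lemma graded_mult:
  assumes "x \<in> graded e" "y \<in> graded f"
  shows "x \<otimes> y \<in> graded (e + f)"
proof -
  obtain i j :: nat and k :: int where x: "x = C [^] i \<otimes> A [^] k \<otimes> inv (C [^] j)" and e: "e = int i - int j"
    using assms(1) by (rule gradedE)
  obtain i' j' :: nat and k' :: int where y: "y = C [^] i' \<otimes> A [^] k' \<otimes> inv (C [^] j')" and f: "f = int i' - int j'"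
    using assms(2) by (rule gradedE)
  show ?thesis
  proof (cases "i' \<le> j")
    case True
    then obtain l where l: "j = i' + l" using le_Suc_ex by blast
    have "inv (C [^] j) \<otimes> C [^] i' = inv (C [^] l) \<otimes> (inv (C [^] i') \<otimes> C [^] i')"
      unfolding l by (simp only: nat_pow_mult[symmetric] C) (simp add: inv_mult_group m_assoc)
    then have *: "inv (C [^] j) \<otimes> C [^] i' = inv (C [^] l)" by simp
    have "x \<otimes> y = C [^] i \<otimes> A [^] k \<otimes> (inv (C [^] j) \<otimes> C [^] i') \<otimes> A [^] k' \<otimes> inv (C [^] j')"
      unfolding x y by (simp add: m_assoc)
    also have "\<dots> = C [^] i \<otimes> A [^] k \<otimes> (inv (C [^] l) \<otimes> A [^] k') \<otimes> inv (C [^] j')"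
      unfolding * by (simp add: m_assoc)
    also have "\<dots> = C [^] i \<otimes> A [^] (k + k' * \<alpha> ^ l) \<otimes> (inv (C [^] l) \<otimes> inv (C [^] j'))"
      by (simp add: inv_C_pow_A_pow m_assoc int_pow_add_assoc)
    also have "inv (C [^] l) \<otimes> inv (C [^] j') = inv (C [^] (j' + l))"
      by (simp add: nat_pow_mult[symmetric] inv_mult_group)
    finally show ?thesis by (rule gradedI) (simp add: e f l)
  next
    case False
    then obtain l where l: "i' = j + l" using le_Suc_ex nat_le_linear by blast
    have "inv (C [^] j) \<otimes> C [^] i' = (inv (C [^] j) \<otimes> C [^] j) \<otimes> C [^] l"
      unfolding l by (simp only: nat_pow_mult[symmetric] C) (simp add: m_assoc)
    then have *: "inv (C [^] j) \<otimes> C [^] i' = C [^] l" by simp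
    have "x \<otimes> y = C [^] i \<otimes> A [^] k \<otimes> (inv (C [^] j) \<otimes> C [^] i') \<otimes> A [^] k' \<otimes> inv (C [^] j')"
      unfolding x y by (simp add: m_assoc)
    also have "\<dots> = C [^] i \<otimes> (A [^] k \<otimes> C [^] l) \<otimes> A [^] k' \<otimes> inv (C [^] j')"
      unfolding * by (simp add: m_assoc)
    also have "\<dots> = (C [^] i \<otimes> C [^] l) \<otimes> A [^] (k * \<alpha> ^ l + k') \<otimes> inv (C [^] j')"
      by (simp add: A_pow_C_pow m_assoc int_pow_add_assoc del: nat_pow_mult)
    also have "C [^] i \<otimes> C [^] l = C [^] (i + l)" by (simp add: nat_pow_mult)
    finally show ?thesis by (rule gradedI) (simp add: e f l)
  qed
qed

lemma graded_inv: "x \<in> graded e \<Longrightarrow> inv x \<in> graded (- e)"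
proof -
  assume "x \<in> graded e"
  then obtain i j :: nat and k :: int where x: "x = C [^] i \<otimes> A [^] k \<otimes> inv (C [^] j)" and e: "e = int i - int j"
    by (rule gradedE)
  have "inv x = C [^] j \<otimes> A [^] (- k) \<otimes> inv (C [^] i)"
    by (simp add: x inv_mult_group m_assoc int_pow_neg)
  then show ?thesis by (rule gradedI) (simp add: e)
qed

lemma graded_one: "\<one> \<in> graded 0"
  by (rule gradedI[of _ 0 0 0]) simp_all

lemma graded_A: "A [^] (k::int) \<in> graded 0"
  by (rule gradedI[of _ 0 k 0]) simp_all

lemma graded_C: "C \<in> graded 1"
  by (rule gradedI[of _ 1 0 0]) simp_all

lemma graded_nat_pow: "x \<in> graded e \<Longrightarrow> x [^] (n::nat) \<in> graded (int n * e)"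
proof (induction n)
  case (Suc n)
  then show ?case using graded_mult[of "x [^] n" "int n * e" x e] by (simp add: algebra_simps)
qed (simp add: graded_one)

lemma graded_int_pow: "x \<in> graded e \<Longrightarrow> x [^] (k::int) \<in> graded (k * e)"
  using graded_nat_pow[of x e] graded_inv[OF graded_nat_pow[of x e]]
  by (cases k rule: int_cases2) (simp_all add: int_pow_int int_pow_neg_int graded_closed)

lemma one_graded: "\<one> \<in> graded e \<Longrightarrow> \<exists>k::int. C [^] e = A [^] k"
proof -
  assume "\<one> \<in> graded e"
  then obtain i j :: nat and k :: int where *: "\<one> = C [^] i \<otimes> A [^] k \<otimes> inv (C [^] j)" and e: "e = int i - int j"
    by (rule gradedE)
  have "A [^] k = inv (C [^] i) \<otimes> (C [^] i \<otimes> A [^] k \<otimes> inv (C [^] j)) \<otimes> C [^] j"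
    by (simp add: m_assoc)
  also have "\<dots> = inv (C [^] i) \<otimes> C [^] j" by (simp add: *[symmetric])
  also have "\<dots> = C [^] (- e)"
    using int_pow_add[of C "- int i" "int j"] by (simp add: e int_pow_neg_int int_pow_int)
  finally have "inv (A [^] k) = C [^] e" by (simp add: int_pow_neg)
  then show ?thesis by (metis A int_pow_neg)
qed

text \<open>Write A^(B^n) = A D_n. One more conjugation by B gives D_(n+1) = C (D_n)^B, so each step
  stays in <B, C> and adds one C. The grading of \<open>swap\<close> counts C^-1, whence the
  sign.\<close>

lemma B_conj_graded:
  "inv A \<otimes> (B [^] (- n) \<otimes> A \<otimes> B [^] (n::int)) \<in> macdonald.graded G B (inv C) (- n)"
proof -
  interpret swap: macdonald G B A "inv C" \<beta> \<alpha> by (rule macdonald_swap)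
  let ?D = "\<lambda>n::int. inv A \<otimes> (B [^] (- n) \<otimes> A \<otimes> B [^] n)"
  have CBg: "C \<in> swap.graded (- 1)" "inv B \<in> swap.graded 0" "B \<in> swap.graded 0"
    using swap.graded_inv[OF swap.graded_C] swap.graded_A[of "- 1"] swap.graded_A[of 1]
    by (simp_all add: int_pow_neg)
  have step: "?D (n + 1) = C \<otimes> (inv B \<otimes> (?D n \<otimes> B))" for n
  proof -
    have "C = inv A \<otimes> (inv B \<otimes> (B \<otimes> (A \<otimes> C)))" by simp
    also have "\<dots> = inv A \<otimes> (inv B \<otimes> (A \<otimes> B))" by (simp add: AB)
    finally have C_eq: "C = inv A \<otimes> (inv B \<otimes> (A \<otimes> B))" .
    have "B [^] (- (n + 1)) = inv B \<otimes> B [^] (- n)" "B [^] (n + 1) = B [^] n \<otimes> B"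
      using int_pow_mult[of B "- 1" "- n"] int_pow_mult[of B n 1]
      by (simp_all add: int_pow_neg algebra_simps)
    then have "?D (n + 1) = inv A \<otimes> (inv B \<otimes> (B [^] (- n) \<otimes> (A \<otimes> (B [^] n \<otimes> B))))"
      by (simp only: m_assoc A B inv_closed int_pow_closed m_closed)
    also have "\<dots> = C \<otimes> (inv B \<otimes> (?D n \<otimes> B))"
      by (subst C_eq) (simp add: m_assoc)
    finally show ?thesis .
  qed
  have up: "?D (n + 1) \<in> swap.graded (- (n + 1))" if "?D n \<in> swap.graded (- n)" for n
  proof -
    have "C \<otimes> (inv B \<otimes> (?D n \<otimes> B)) \<in> swap.graded (- 1 + (0 + (- n + 0)))"
      by (intro swap.graded_mult that CBg)
    moreover have "- 1 + (0 + (- n + 0)) = - (n + 1)" by simp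
    ultimately show ?thesis by (simp only: step)
  qed
  have down: "?D n \<in> swap.graded (- n)" if "?D (n + 1) \<in> swap.graded (- (n + 1))" for n
  proof -
    have "?D n = B \<otimes> (inv C \<otimes> (?D (n + 1) \<otimes> inv B))"
      unfolding step by (simp add: m_assoc)
    moreover have "B \<otimes> (inv C \<otimes> (?D (n + 1) \<otimes> inv B)) \<in> swap.graded (0 + (1 + (- (n + 1) + 0)))"
      by (intro swap.graded_mult that CBg swap.graded_C)
    ultimately show ?thesis by simp
  qed
  show ?thesis
  proof (induction n rule: int_induct[of _ 0])
    case base
    then show ?case using swap.graded_one by simp
  next
    case (step1 i)
    then show ?case using up by simp
  next
    case (step2 i)
    then show ?case using down[of "i - 1"] by simp
  qed
qed

text \<open>The element A^-1 A^(B^\<beta>) has C-exponent \<beta> inside <B, C> and \<alpha> inside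
  <A, C>. Hence some B^k has grade \<alpha>-\<beta> in <A, C>. Then C B^k C^-1 (B^k)^-\<beta> is
  trivial and has grade -(\<beta>-1)(\<alpha>-\<beta>).\<close>

lemma C_pow_in_A: "\<exists>k::int. C [^] ((\<beta> - 1) * (\<alpha> - \<beta>)) = A [^] k"
proof -
  interpret swap: macdonald G B A "inv C" \<beta> \<alpha> by (rule macdonald_swap)
  define x where "x = inv A \<otimes> (C \<otimes> A) [^] \<alpha>"
  have "B [^] (- \<beta>) \<otimes> A \<otimes> B [^] \<beta> = (C \<otimes> A) [^] \<alpha>"
    by (simp add: int_pow_neg m_assoc A_B_pow_beta)
  then have "x \<in> swap.graded (- \<beta>)" using B_conj_graded[of \<beta>] by (simp add: x_def)
  then obtain i j :: nat and k :: int
    where x: "x = (inv C) [^] i \<otimes> B [^] k \<otimes> inv ((inv C) [^] j)" and ij: "- \<beta> = int i - int j"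
    by (rule swap.gradedE)
  have "C \<otimes> A \<in> graded (1 + 0)" using graded_mult[OF graded_C graded_A[of 1]] by simp
  then have "inv A \<otimes> (C \<otimes> A) [^] \<alpha> \<in> graded (0 + \<alpha> * 1)"
    using graded_mult[OF graded_inv[OF graded_A[of 1]] graded_int_pow[of "C \<otimes> A" 1 \<alpha>]] by simp
  then have xg: "x \<in> graded \<alpha>" by (simp add: x_def)
  have "C [^] i \<otimes> (x \<otimes> inv (C [^] j)) = B [^] k"
    by (simp add: x nat_pow_inv m_assoc)
  moreover have "C [^] i \<otimes> (x \<otimes> inv (C [^] j)) \<in> graded (int i * 1 + (\<alpha> + - (int j * 1)))"
    by (intro graded_mult graded_nat_pow graded_inv graded_C xg)
  ultimately have Bk: "B [^] k \<in> graded (\<alpha> - \<beta>)" using ij by (simp add: algebra_simps)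
  have "C \<otimes> B [^] k \<otimes> inv C = (B [^] k) [^] \<beta>"
    using C_pow_B_pow[of 1 k] by (simp add: m_assoc int_pow_pow)
  then have "C \<otimes> B [^] k \<otimes> inv C \<otimes> inv ((B [^] k) [^] \<beta>) = \<one>" by simp
  moreover have "C \<otimes> B [^] k \<otimes> inv C \<otimes> inv ((B [^] k) [^] \<beta>) \<in> graded (1 + (\<alpha> - \<beta>) + - 1 + - (\<beta> * (\<alpha> - \<beta>)))"
    by (intro graded_mult graded_inv graded_int_pow graded_C Bk)
  ultimately have "\<one> \<in> graded (- ((\<beta> - 1) * (\<alpha> - \<beta>)))" by (simp add: algebra_simps)
  from graded_inv[OF this] have "\<one> \<in> graded ((\<beta> - 1) * (\<alpha> - \<beta>))" by simp
  then show ?thesis by (rule one_graded)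
qed

lemma C_pow_central:
  assumes "\<alpha> \<noteq> 1" "\<beta> \<noteq> 1" "\<alpha> \<noteq> \<beta>"
  obtains n :: nat and k l :: int where "n > 0" "C [^] n = A [^] k" "C [^] n = B [^] l"
proof -
  interpret swap: macdonald G B A "inv C" \<beta> \<alpha> by (rule macdonald_swap)
  obtain k where k: "C [^] ((\<beta> - 1) * (\<alpha> - \<beta>)) = A [^] (k::int)" using C_pow_in_A by blast
  obtain l where "inv C [^] ((\<alpha> - 1) * (\<beta> - \<alpha>)) = B [^] (l::int)" using swap.C_pow_in_A by blast
  moreover have "inv C [^] ((\<alpha> - 1) * (\<beta> - \<alpha>)) = C [^] ((\<alpha> - 1) * (\<alpha> - \<beta>))"
    by (simp add: int_pow_inv int_pow_neg[symmetric] algebra_simps)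
  ultimately have l: "C [^] ((\<alpha> - 1) * (\<alpha> - \<beta>)) = B [^] l" by simp
  define e where "e = (\<alpha> - 1) * (\<beta> - 1) * (\<alpha> - \<beta>)"
  have "C [^] e = (C [^] ((\<beta> - 1) * (\<alpha> - \<beta>))) [^] (\<alpha> - 1)"
    by (simp add: e_def int_pow_pow mult_ac)
  then have e1: "C [^] e = A [^] (k * (\<alpha> - 1))" by (simp add: k int_pow_pow)
  have "C [^] e = (C [^] ((\<alpha> - 1) * (\<alpha> - \<beta>))) [^] (\<beta> - 1)"
    by (simp add: e_def int_pow_pow mult_ac)
  then have e2: "C [^] e = B [^] (l * (\<beta> - 1))" by (simp add: l int_pow_pow)
  have "e \<noteq> 0" using assms by (simp add: e_def)
  then consider n where "n > 0" "e = int n" | n where "n > 0" "e = - int n"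
    by (metis int_cases2 neq0_conv of_nat_0 minus_zero)
  then show thesis
  proof cases
    case 1
    then show ?thesis using that[of n "k * (\<alpha> - 1)" "l * (\<beta> - 1)"] e1 e2 by (simp add: int_pow_int)
  next
    case 2
    then have "inv (C [^] n) = A [^] (k * (\<alpha> - 1))" "inv (C [^] n) = B [^] (l * (\<beta> - 1))"
      using e1 e2 by (simp_all add: int_pow_neg_int)
    then have "C [^] n = A [^] (- (k * (\<alpha> - 1)))" "C [^] n = B [^] (- (l * (\<beta> - 1)))"
      by (metis C A B int_pow_neg inv_inv nat_pow_closed)+
    then show ?thesis using that 2 by blast
  qed
qed

text \<open>A power C^n lying in <A> commutes with A, yet conjugation by it raises A to the power
  \<alpha>^n. So A^(\<alpha>^n - 1) is trivial, and |\<alpha>| >= 2 keeps the exponent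
  nonzero.\<close>

lemma finite_order_A:
  assumes "\<alpha> \<noteq> 1" "\<beta> \<noteq> 1" "\<alpha> \<noteq> \<beta>" "\<bar>\<alpha>\<bar> \<ge> 2"
  obtains n :: nat where "n > 0" "A [^] n = \<one>"
proof -
  obtain n :: nat and k l :: int where n: "n > 0" "C [^] n = A [^] k"
    using C_pow_central[OF assms(1-3)] by metis
  have "C [^] n \<otimes> A [^] (\<alpha> ^ n) = A \<otimes> C [^] n" using A_pow_C_pow[of 1 n] by simp
  also have "\<dots> = A [^] (1 + k)" using int_pow_add[of A 1 k] by (simp add: n)
  also have "\<dots> = C [^] n \<otimes> A" using int_pow_add[of A k 1] by (simp add: n add.commute)
  finally have "A [^] (\<alpha> ^ n) = A" by simp
  then have *: "A [^] (\<alpha> ^ n - 1) = \<one>" using int_pow_diff[of A "\<alpha> ^ n" 1] by simp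
  have "\<bar>\<alpha> ^ n\<bar> > 1" using assms(4) n(1) by (simp add: power_abs)
  then have "\<alpha> ^ n - 1 \<noteq> 0" by auto
  then have "A [^] nat \<bar>\<alpha> ^ n - 1\<bar> = \<one>"
    using int_pow_eq_one_mult[OF A *, of "\<bar>\<alpha> ^ n - 1\<bar>"] by (simp add: int_pow_int[symmetric])
  then show thesis using that[of "nat \<bar>\<alpha> ^ n - 1\<bar>"] \<open>\<alpha> ^ n - 1 \<noteq> 0\<close> by simp
qed

lemma finite_order_C:
  assumes "\<alpha> \<noteq> 1" "\<beta> \<noteq> 1" "\<alpha> \<noteq> \<beta>" "\<bar>\<alpha>\<bar> \<ge> 2"
  obtains n :: nat where "n > 0" "C [^] n = \<one>"
proof -
  obtain n :: nat and k l :: int where n: "n > 0" "C [^] n = A [^] k"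
    using C_pow_central[OF assms(1-3)] by metis
  obtain j :: nat where j: "j > 0" "A [^] j = \<one>" using finite_order_A[OF assms] .
  have "C [^] (n * j) = (A [^] k) [^] int j" by (simp add: nat_pow_pow[symmetric] n int_pow_int)
  also have "\<dots> = (A [^] j) [^] k" by (simp add: int_pow_pow mult.commute int_pow_int[symmetric])
  finally show thesis using that[of "n * j"] n j by simp
qed

text \<open>Conjugation by C is injective and acts on <A> as the \<alpha>-th power, so it cannot
  kill A^(ord A / q).\<close>

lemma int_pow_alpha_coprime_order:
  assumes "ord A > 0" "Factorial_Ring.prime q" "q dvd ord A"
  shows "\<not> int q dvd \<alpha>"
proof
  assume "int q dvd \<alpha>"
  obtain k where k: "ord A = q * k" using assms(3) by blast
  have "A [^] int k \<otimes> C = C \<otimes> A [^] (int k * \<alpha>)" using A_pow_C_pow[of "int k" 1] by simp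
  also have "A [^] (int k * \<alpha>) = \<one>"
  proof (rule int_pow_eq_one_mult[OF A])
    show "A [^] int (ord A) = \<one>" by (simp add: int_pow_int)
    show "int (ord A) dvd int k * \<alpha>" using \<open>int q dvd \<alpha>\<close> by (simp add: k mult.commute mult_dvd_mono)
  qed
  finally have "A [^] k = \<one>" by (simp add: int_pow_int)
  then have "q * k dvd k" using pow_eq_id[OF A, of k] k by simp
  moreover have "k > 0" "q > 1" using assms k prime_gt_1_nat by (auto intro: gr0I)
  ultimately show False by (auto dest: dvd_imp_le)
qed

text \<open>For a prime \<open>p\<close> violating the claim, some power \<open>a = A\<^sup>n\<close> of order \<open>p\<close> is conjugated by \<open>B\<close> to
  \<open>c = C\<^sup>n\<close>. Conjugating \<open>a\<^sup>C = a\<^sup>\<alpha>\<close> by \<open>B\<close> puts \<open>c\<close> into \<open>\<langle>B\<rangle>\<close>, so \<open>a = c\<close> commutes with \<open>C\<close>.\<close>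
lemma prime_dvd_order_A:
  assumes P: "ord A > 0" and \<alpha>: "\<alpha> \<noteq> 1" and "Factorial_Ring.prime p" "p dvd ord A"
  shows "int p dvd \<alpha> - 1"
proof (rule ccontr)
  assume notdvd: "\<not> int p dvd \<alpha> - 1"
  \<comment> \<open>The largest violating prime is used because \<open>exponent_for_prime\<close>
    needs all violating primes to be bounded by it.\<close>
  define S where "S = {q. Factorial_Ring.prime q \<and> q dvd ord A \<and> \<not> int q dvd \<alpha> - 1}"
  have "finite S" unfolding S_def using P by (auto intro: finite_subset[OF _ finite_divisors_nat])
  moreover have "p \<in> S" using assms notdvd by (simp add: S_def)
  ultimately have S: "Max S \<in> S" "\<And>q. q \<in> S \<Longrightarrow> q \<le> Max S" using Max_in by auto
  define q where "q = Max S"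
  have q: "Factorial_Ring.prime q" "q dvd ord A" "\<not> int q dvd \<alpha> - 1" using S(1) by (auto simp: q_def S_def)
  obtain n where n: "\<not> ord A dvd n" "ord A dvd n * q" "int (ord A) dvd gsum \<alpha> n"
  proof (rule exponent_for_prime[OF q _ \<alpha>])
    show "ord A \<noteq> 0" using P by simp
    show "\<not> int r dvd \<alpha>" if "Factorial_Ring.prime r" "r dvd ord A" for r
      using int_pow_alpha_coprime_order[OF P that] .
    show "r \<le> q" if "Factorial_Ring.prime r" "r dvd ord A" "\<not> int r dvd \<alpha> - 1" for r
      using S(2)[of r] that by (simp add: q_def S_def)
  qed
  have ordA: "A [^] int (ord A) = \<one>" by (simp add: int_pow_int)
  define a c where "a = A [^] n" and "c = C [^] n"
  have [simp]: "a \<in> carrier G" "c \<in> carrier G" by (simp_all add: a_def c_def)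
  have aB: "a \<otimes> B = B \<otimes> c"
    using A_pow_B[of n] int_pow_eq_one_mult[OF A ordA, of "\<alpha> * gsum \<alpha> n"] n(3)
    by (simp add: a_def c_def)
  have aq: "a [^] int q = \<one>"
    using n(2) pow_eq_id[OF A, of "n * q"] by (simp add: a_def int_pow_int nat_pow_pow)
  have "B \<otimes> c [^] int q = \<one> \<otimes> B"
    using int_pow_twist[OF _ _ _ aB, of "int q"] by (simp add: aq)
  then have cq: "c [^] int q = \<one>" by simp
  have aC: "a \<otimes> C = C \<otimes> a [^] \<alpha>"
    using A_pow_C_pow[of "int n" 1] by (simp add: a_def int_pow_int[symmetric] int_pow_pow)
  have cC: "c \<otimes> C = C \<otimes> c" unfolding c_def by (simp add: nat_pow_comm[of C n 1, simplified])
  have coprime: "coprime (\<alpha> - 1) (int q)"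
    using q by (simp add: prime_imp_coprime coprime_commute)
  have kill: "x = \<one>" if "x \<in> carrier G" "x [^] int q = \<one>" "x [^] (\<alpha> - 1) = \<one>" for x
  proof -
    obtain s t where "s * (\<alpha> - 1) + t * int q = 1"
      using coprime bezout_int[of "\<alpha> - 1" "int q"] by (auto simp: coprime_iff_gcd_eq_1)
    then have "x = x [^] ((\<alpha> - 1) * s) \<otimes> x [^] (int q * t)"
      using that(1) by (simp add: int_pow_add mult.commute)
    then show ?thesis using that by (simp add: int_pow_pow[symmetric])
  qed
  have BCB: "C \<otimes> B = B \<otimes> (B [^] (\<beta> - 1) \<otimes> C)"
    using int_pow_add_assoc[of B C 1 "\<beta> - 1"] by (simp add: CB)
  have "B \<otimes> (c \<otimes> (B [^] (\<beta> - 1) \<otimes> C)) = a \<otimes> (C \<otimes> B)"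
    by (simp add: BCB m_assoc[symmetric] aB)
  also have "\<dots> = C \<otimes> (a [^] \<alpha> \<otimes> B)" by (simp add: m_assoc[symmetric] aC)
  also have "\<dots> = C \<otimes> (B \<otimes> c [^] \<alpha>)" by (simp add: int_pow_twist[OF _ _ _ aB])
  also have "\<dots> = B \<otimes> (B [^] (\<beta> - 1) \<otimes> (C \<otimes> c [^] \<alpha>))"
    by (simp add: m_assoc[symmetric]) (simp add: BCB m_assoc)
  also have "C \<otimes> c [^] \<alpha> = c [^] \<alpha> \<otimes> C" by (rule int_pow_twist[symmetric]) (simp_all add: cC)
  finally have "c \<otimes> B [^] (\<beta> - 1) \<otimes> C = B [^] (\<beta> - 1) \<otimes> c [^] \<alpha> \<otimes> C" by (simp add: m_assoc)
  then have "c \<otimes> B [^] (\<beta> - 1) = B [^] (\<beta> - 1) \<otimes> c [^] \<alpha>" by simp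
  moreover have "c \<otimes> B [^] (\<beta> - 1) = B [^] ((\<beta> - 1) * \<beta> ^ n) \<otimes> c"
    unfolding c_def by (rule C_pow_B_pow)
  ultimately have "B [^] (\<beta> - 1) \<otimes> c [^] \<alpha> = B [^] ((\<beta> - 1) * \<beta> ^ n) \<otimes> c" by simp
  then have "B [^] (\<beta> - 1) \<otimes> c [^] \<alpha> \<otimes> inv c = B [^] ((\<beta> - 1) * \<beta> ^ n)"
    by (simp only:) (simp add: m_assoc)
  moreover have "c [^] \<alpha> \<otimes> inv c = c [^] (\<alpha> - 1)"
    using int_pow_add[of c \<alpha> "- 1"] by (simp add: int_pow_neg)
  ultimately have "B [^] (\<beta> - 1) \<otimes> c [^] (\<alpha> - 1) = B [^] ((\<beta> - 1) * \<beta> ^ n)"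
    by (simp add: m_assoc)
  then have "c [^] (\<alpha> - 1) = inv (B [^] (\<beta> - 1)) \<otimes> B [^] ((\<beta> - 1) * \<beta> ^ n)"
    by (metis B C c_def int_pow_closed inv_mult_cancel(1) nat_pow_closed)
  then have cu: "c [^] (\<alpha> - 1) = B [^] (- (\<beta> - 1) + (\<beta> - 1) * \<beta> ^ n)"
    by (simp only: int_pow_neg[symmetric] int_pow_add B)
  \<comment> \<open>Since c^q is trivial and q is prime to \<alpha>-1, c is a power of
    c^(\<alpha>-1), which has just been placed in <B>.\<close>
  obtain s t where st: "s * (\<alpha> - 1) + t * int q = 1"
    using coprime bezout_int[of "\<alpha> - 1" "int q"] by (auto simp: coprime_iff_gcd_eq_1)
  then have "c = c [^] ((\<alpha> - 1) * s) \<otimes> c [^] (int q * t)" by (simp add: int_pow_add mult.commute)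
  then have "c = (c [^] (\<alpha> - 1)) [^] s" by (simp add: int_pow_pow[symmetric] cq)
  then have "c = B [^] ((- (\<beta> - 1) + (\<beta> - 1) * \<beta> ^ n) * s)" by (simp only: cu int_pow_pow B)
  then have "c \<otimes> B = B \<otimes> c"
    by (metis B int_pow_add int_pow_1 add.commute)
  then have "a \<otimes> B = c \<otimes> B" using aB by simp
  then have "a = c" by simp
  then have "C \<otimes> a [^] \<alpha> = C \<otimes> a" using aC cC by simp
  then have "a [^] \<alpha> = a" by simp
  then have "a [^] (\<alpha> - 1) = \<one>" using int_pow_diff[of a \<alpha> 1] by simp
  then have "a = \<one>" using kill aq by simp
  then show False using n(1) pow_eq_id[OF A, of n] by (simp add: a_def)
qed

end

section \<open>Separating the primes\<close>

context group
begin

text \<open>A generator of finite order has its inverse among its positive powers, so closure under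
  conjugation by the generators alone extends to the whole group.\<close>

lemma normal_of_generators:
  assumes "subgroup N G" "S \<subseteq> carrier G" "carrier G = generate G S"
    and tors: "\<And>g. g \<in> S \<Longrightarrow> \<exists>n::nat>0. g [^] n = \<one>"
    and conj: "\<And>g y. g \<in> S \<Longrightarrow> y \<in> N \<Longrightarrow> inv g \<otimes> y \<otimes> g \<in> N"
  shows "N \<lhd> G"
proof -
  have N: "y \<in> carrier G" if "y \<in> N" for y using subgroup.mem_carrier[OF assms(1)] that by simp
  have conj_mult: "inv (g \<otimes> h) \<otimes> y \<otimes> (g \<otimes> h) = inv h \<otimes> (inv g \<otimes> y \<otimes> g) \<otimes> h"
    if "g \<in> carrier G" "h \<in> carrier G" "y \<in> N" for g h y
    using that N by (simp add: inv_mult_group m_assoc)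
  have pow: "inv (g [^] n) \<otimes> y \<otimes> g [^] n \<in> N" if "g \<in> S" "y \<in> N" for g y and n :: nat
  proof (induction n)
    case (Suc n)
    then show ?case using that conj conj_mult[of "g [^] n" g y] assms(2) by auto
  qed (use that N in simp)
  have "inv g \<otimes> y \<otimes> g \<in> N" if "g \<in> generate G S" "y \<in> N" for g y
    using that
  proof (induction arbitrary: y rule: generate.induct)
    case (inv g)
    have g: "g \<in> carrier G" using inv assms(2) by auto
    obtain n :: nat where "n > 0" "g [^] n = \<one>" using tors inv by blast
    then have "g [^] (n - 1) \<otimes> g = \<one>" using nat_pow_Suc[of g "n - 1"] by simp
    then have "inv g = g [^] (n - 1)" using g by (intro inv_equality) simp_all
    then show ?case using pow[OF inv.hyps inv.prems, of "n - 1"] by simp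
  next
    case (eng g h)
    then show ?case using conj_mult[of g h y] assms(2) generate_in_carrier by auto
  qed (use conj N in auto)
  then have *: "inv g \<otimes> y \<otimes> g \<in> N" if "g \<in> carrier G" "y \<in> N" for g y
    using that assms(3) by simp
  show ?thesis
  proof (rule normal_invI[OF assms(1)])
    show "x \<otimes> h \<otimes> inv x \<in> N" if "x \<in> carrier G" "h \<in> N" for x h
      using *[of "inv x" h] that by simp
  qed
qed

text \<open>The extension is N<h>: modulo N the cyclic group <h> is normalised by the generators,
  and its order divides q.\<close>

lemma adjoin_normal:
  assumes N: "N \<lhd> G" and h: "h \<in> carrier G" and X: "S \<subseteq> carrier G" "carrier G = generate G S"
    and tors: "\<And>g. g \<in> S \<Longrightarrow> \<exists>n::nat>0. g [^] n = \<one>"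
    and conj: "\<And>g. g \<in> S \<Longrightarrow> \<exists>x\<in>N. \<exists>k::int. inv g \<otimes> h \<otimes> g = x \<otimes> h [^] k"
    and hq: "h [^] (q::nat) \<in> N"
  obtains N' where "N' \<lhd> G" "N \<subseteq> N'" "h \<in> N'" "\<And>y. y \<in> N' \<Longrightarrow> y [^] q \<in> N"
proof -
  interpret N: normal N G by (rule N)
  define N' where "N' = {x \<otimes> h [^] k | x k. x \<in> N \<and> (k::int) \<in> UNIV}"
  have N'I: "x \<otimes> h [^] (k::int) \<in> N'" if "x \<in> N" for x k using that by (auto simp: N'_def)
  have N'E: "\<exists>x\<in>N. \<exists>k::int. y = x \<otimes> h [^] k" if "y \<in> N'" for y using that by (auto simp: N'_def)
  have sub: "N \<subseteq> N'" using N'I[of _ 0] by auto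
  have hN': "h \<in> N'" using N'I[of \<one> 1] h by simp
  have conjN: "z \<otimes> x \<otimes> inv z \<in> N" if "z \<in> carrier G" "x \<in> N" for x z
    using that by (rule N.inv_op_closed2)
  have move: "z \<otimes> x = (z \<otimes> x \<otimes> inv z) \<otimes> z" if "z \<in> carrier G" "x \<in> N" for x z
    using that by (simp add: m_assoc)
  have subgr: "subgroup N' G"
  proof (rule subgroupI)
    show "N' \<subseteq> carrier G" using h by (auto simp: N'_def)
    show "N' \<noteq> {}" using hN' by auto
    show "inv y \<in> N'" if "y \<in> N'" for y
    proof -
      from N'E[OF that] obtain x k where y: "x \<in> N" "y = x \<otimes> h [^] (k::int)" by blast
      have "inv y = h [^] (- k) \<otimes> inv x" using y h by (simp add: inv_mult_group int_pow_neg)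
      also have "\<dots> = (h [^] (- k) \<otimes> inv x \<otimes> inv (h [^] (- k))) \<otimes> h [^] (- k)"
        using move[of "h [^] (- k)" "inv x"] y h by simp
      finally show ?thesis using N'I[OF conjN[of "h [^] (- k)" "inv x"]] y h by simp
    qed
    show "y \<otimes> y' \<in> N'" if "y \<in> N'" "y' \<in> N'" for y y'
    proof -
      from N'E[OF that(1)] obtain x k where y: "x \<in> N" "y = x \<otimes> h [^] (k::int)" by blast
      from N'E[OF that(2)] obtain x' k' where y': "x' \<in> N" "y' = x' \<otimes> h [^] (k'::int)" by blast
      have "y \<otimes> y' = x \<otimes> (h [^] k \<otimes> x') \<otimes> h [^] k'" using y y' h by (simp add: m_assoc)
      also have "\<dots> = x \<otimes> (h [^] k \<otimes> x' \<otimes> inv (h [^] k)) \<otimes> h [^] (k + k')"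
        using y y' h move[of "h [^] k" x'] by (simp add: m_assoc int_pow_mult)
      finally show ?thesis using N'I[OF N.m_closed[OF y(1) conjN[of "h [^] k" x']]] y' h by simp
    qed
  qed
  have "N' \<lhd> G"
  proof (rule normal_of_generators[OF subgr X tors])
    fix g y assume g: "g \<in> S" and "y \<in> N'"
    then obtain x k where y: "x \<in> N" "y = x \<otimes> h [^] (k::int)" using N'E by blast
    have gc: "g \<in> carrier G" using g X by auto
    have "inv g \<otimes> h \<otimes> g \<in> N'" using conj[OF g] N'I by auto
    then have "(inv g \<otimes> h \<otimes> g) [^] k \<in> N'" using subgroup_int_pow_closed[OF subgr] by simp
    moreover have "h [^] k \<otimes> g = g \<otimes> (inv g \<otimes> h \<otimes> g) [^] k"
      using gc h by (intro int_pow_twist) (simp_all add: m_assoc)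
    then have "(inv g \<otimes> h \<otimes> g) [^] k = inv g \<otimes> (h [^] k \<otimes> g)" using gc h by simp
    moreover have "inv g \<otimes> x \<otimes> g \<in> N'" using N.inv_op_closed1[OF gc y(1)] sub by auto
    ultimately have "(inv g \<otimes> x \<otimes> g) \<otimes> (inv g \<otimes> (h [^] k \<otimes> g)) \<in> N'"
      using subgroup.m_closed[OF subgr] by simp
    then show "inv g \<otimes> y \<otimes> g \<in> N'" using gc h y by (simp add: m_assoc)
  qed
  moreover have "y [^] q \<in> N" if "y \<in> N'" for y
  proof -
    from N'E[OF that] obtain x k where y: "x \<in> N" "y = x \<otimes> h [^] (k::int)" by blast
    have "\<exists>x'\<in>N. y [^] n = x' \<otimes> (h [^] k) [^] n" for n :: nat
    proof (induction n)
      case (Suc n)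
      then obtain x' where x': "x' \<in> N" "y [^] n = x' \<otimes> (h [^] k) [^] n" by blast
      let ?z = "(h [^] k) [^] n"
      have z: "?z \<in> carrier G" using h by simp
      have "y [^] Suc n = x' \<otimes> (?z \<otimes> x) \<otimes> h [^] k" using x' y h by (simp add: m_assoc)
      also have "\<dots> = x' \<otimes> ((?z \<otimes> x \<otimes> inv ?z) \<otimes> ?z) \<otimes> h [^] k" using move[OF z y(1)] by simp
      also have "\<dots> = (x' \<otimes> (?z \<otimes> x \<otimes> inv ?z)) \<otimes> (h [^] k) [^] Suc n"
        using x' y h z N.m_closed[OF x'(1) conjN[OF z y(1)]] by (simp add: m_assoc)
      finally show ?case using N.m_closed[OF x'(1) conjN[OF z y(1)]] by blast
    qed (use y in auto)
    then obtain x' where x': "x' \<in> N" "y [^] q = x' \<otimes> (h [^] k) [^] q" by blast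
    have "(h [^] k) [^] q = (h [^] q) [^] k"
      using h by (simp add: int_pow_int[symmetric] int_pow_pow mult.commute)
    also have "\<dots> \<in> N" using hq N.subgroup_axioms subgroup_int_pow_closed by blast
    finally show ?thesis using x' by auto
  qed
  ultimately show thesis using that sub hN' by blast
qed

lemma int_pow_gcd_mem:
  assumes "subgroup N G" "x \<in> carrier G" "x [^] (i::int) \<in> N" "x [^] (j::int) \<in> N" "gcd i j dvd k"
  shows "x [^] k \<in> N"
proof -
  obtain s t where st: "s * i + t * j = gcd i j" using bezout_int by blast
  obtain d where "k = gcd i j * d" using assms(5) by blast
  then have "k = i * (s * d) + j * (t * d)" by (simp add: st[symmetric] algebra_simps)
  then have "x [^] k = (x [^] i) [^] (s * d) \<otimes> (x [^] j) [^] (t * d)"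
    using assms(2) by (simp add: int_pow_mult int_pow_pow)
  then show ?thesis using assms subgroup_int_pow_closed subgroup.m_closed by metis
qed

end

section \<open>Normal subgroups obtained by adjoining powers of C, A, B\<close>

context macdonald
begin

lemma conj_C_pow_A: "inv A \<otimes> C [^] (n::nat) \<otimes> A = C [^] n \<otimes> A [^] (1 - \<alpha> ^ n)"
proof -
  have "A \<otimes> C [^] n = C [^] n \<otimes> A [^] (\<alpha> ^ n)" using A_pow_C_pow[of 1 n] by simp
  then have "inv A \<otimes> (A \<otimes> C [^] n) \<otimes> A [^] (1 - \<alpha> ^ n) = inv A \<otimes> (C [^] n \<otimes> A [^] (\<alpha> ^ n)) \<otimes> A [^] (1 - \<alpha> ^ n)"
    by simp
  then show ?thesis by (simp add: m_assoc int_pow_add)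
qed

lemma conj_C_pow_B: "inv B \<otimes> C [^] (n::nat) \<otimes> B = B [^] (\<beta> ^ n - 1) \<otimes> C [^] n"
  using C_pow_B_pow[of n 1] int_pow_add_assoc[of B "C [^] n" "- 1" "\<beta> ^ n"]
  by (simp add: m_assoc int_pow_neg)

lemma conj_A_pow_B: "inv B \<otimes> A [^] (n::nat) \<otimes> B = C [^] n \<otimes> A [^] (\<alpha> * gsum \<alpha> n)"
  by (simp add: m_assoc A_pow_B)

end

text \<open>P and Q will be the orders of A and B, whose primes are controlled by
  \<open>prime_dvd_order_A\<close>.\<close>

locale macdonald_finite = macdonald +
  fixes P Q :: nat
  assumes gen: "carrier G = generate G {A, B}"
    and P: "P > 0" "A [^] P = \<one>" and Q: "Q > 0" "B [^] Q = \<one>"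
    and primesP: "\<And>p. Factorial_Ring.prime p \<Longrightarrow> p dvd P \<Longrightarrow> int p dvd \<alpha> - 1"
    and primesQ: "\<And>p. Factorial_Ring.prime p \<Longrightarrow> p dvd Q \<Longrightarrow> int p dvd \<beta> - 1"
begin

lemma macdonald_finite_swap: "macdonald_finite G B A (inv C) \<beta> \<alpha> Q P"
proof (intro macdonald_finite.intro macdonald_finite_axioms.intro macdonald_swap)
  show "carrier G = generate G {B, A}" using gen by (simp add: insert_commute)
qed (fact P Q primesP primesQ)+

text \<open>Serves to put the commutator of C^n and A into N. For d = gcd(P, n q) the element A^d
  lies in N, and d divides n (\<alpha>-1): either q divides d and hence \<alpha>-1, or d already
  divides n.\<close>

lemma A_pow_mem:
  fixes n q :: nat
  assumes "subgroup N G" "A [^] (n * q) \<in> N" "Factorial_Ring.prime q"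
  shows "A [^] (\<alpha> ^ n - 1) \<in> N"
proof -
  define d where "d = gcd P (n * q)"
  have d: "d dvd P" "d dvd n * q" "d \<noteq> 0" using P by (auto simp: d_def)
  have dp: "int p dvd \<alpha> - 1" if "Factorial_Ring.prime p" "p dvd d" for p
    using that d(1) primesP dvd_trans by blast
  have "int d dvd int n * (\<alpha> - 1)"
  proof (cases "q dvd d")
    case True
    then have "int (n * q) dvd int n * (\<alpha> - 1)" using dp assms(3) by simp
    then show ?thesis using d(2) by (meson dvd_trans int_dvd_int_iff)
  next
    case False
    then have "coprime d q" using prime_imp_coprime[OF assms(3)] by (simp add: coprime_commute)
    then have "d dvd n" using d(2) by (simp add: coprime_dvd_mult_left_iff)
    then show ?thesis by simp
  qed
  then have "int d dvd \<alpha> ^ n - 1" using dvd_power_minus_one_of_dvd_mult d(3) dp by blast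
  then have "gcd (int P) (int (n * q)) dvd \<alpha> ^ n - 1" unfolding d_def gcd_int_int_eq .
  moreover have "A [^] int P \<in> N" using P subgroup.one_closed[OF assms(1)] by (simp add: int_pow_int)
  moreover have "A [^] int (n * q) \<in> N" using assms(2) by (simp only: int_pow_int)
  ultimately show ?thesis using int_pow_gcd_mem[OF assms(1) A] by blast
qed

text \<open>By \<open>dvd_gsum\<close> gcd(P, n) divides the sum, and A^gcd(P, n) is a power of A^n.
  It follows that B conjugates A^n into <C^n><A^n>.\<close>

lemma A_pow_gsum: "\<exists>k::int. A [^] (\<alpha> * gsum \<alpha> (n::nat)) = (A [^] n) [^] k"
proof -
  have "int (gcd P n) dvd gsum \<alpha> n"
    using P primesP by (intro dvd_gsum) (auto intro: dvd_trans)
  then have "gcd (int P) (int n) dvd \<alpha> * gsum \<alpha> n" by (simp add: gcd_int_int_eq)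
  moreover obtain s t where "s * int P + t * int n = gcd (int P) (int n)" using bezout_int by blast
  ultimately obtain j where "\<alpha> * gsum \<alpha> n = (s * int P + t * int n) * j" by (metis dvdE)
  then have "\<alpha> * gsum \<alpha> n = int P * (s * j) + int n * (t * j)" by (simp add: algebra_simps)
  then have "A [^] (\<alpha> * gsum \<alpha> n) = (A [^] P) [^] (s * j) \<otimes> (A [^] n) [^] (t * j)"
    by (simp only: int_pow_mult int_pow_pow A int_pow_int[symmetric])
  then show ?thesis using P by auto
qed

text \<open>C^n goes first, as its commutators with A and B already lie in N; conjugating A^n by B
  or B^n by A then produces only C^n and powers of the element itself. Three extensions, each with
  q-th powers falling back, give the exponent q^3.\<close>

lemma chain_step:
  fixes n q :: nat
  assumes N: "N \<lhd> G" and q: "Factorial_Ring.prime q"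
    and mem: "A [^] (n * q) \<in> N" "B [^] (n * q) \<in> N" "C [^] (n * q) \<in> N"
  obtains N' where "N' \<lhd> G" "A [^] n \<in> N'" "B [^] n \<in> N'" "C [^] n \<in> N'" "\<And>y. y \<in> N' \<Longrightarrow> y [^] (q ^ 3) \<in> N"
proof -
  interpret swap: macdonald_finite G B A "inv C" \<beta> \<alpha> Q P by (rule macdonald_finite_swap)
  interpret N: normal N G by (rule N)
  have X: "{A, B} \<subseteq> carrier G" by simp
  have tors: "\<exists>n::nat>0. g [^] n = \<one>" if "g \<in> {A, B}" for g using that P Q by auto
  have 1: "A [^] (1 - \<alpha> ^ n) \<in> N"
    using N.m_inv_closed[OF A_pow_mem[OF N.subgroup_axioms mem(1) q]] by (simp add: int_pow_neg[symmetric])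
  have 2: "B [^] (\<beta> ^ n - 1) \<in> N"
    using swap.A_pow_mem[OF N.subgroup_axioms mem(2) q] .
  obtain N1 where N1: "N1 \<lhd> G" "N \<subseteq> N1" "C [^] n \<in> N1" "\<And>y. y \<in> N1 \<Longrightarrow> y [^] q \<in> N"
  proof (rule adjoin_normal[OF N _ X gen tors, of "C [^] n" q])
    fix g assume "g \<in> {A, B}"
    then show "\<exists>x\<in>N. \<exists>k::int. inv g \<otimes> C [^] n \<otimes> g = x \<otimes> (C [^] n) [^] k"
    proof (elim insertE emptyE)
      assume "g = A"
      moreover have "C [^] n \<otimes> A [^] (1 - \<alpha> ^ n) = (C [^] n \<otimes> A [^] (1 - \<alpha> ^ n) \<otimes> inv (C [^] n)) \<otimes> (C [^] n) [^] (1::int)"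
        by (simp add: m_assoc)
      ultimately have "inv g \<otimes> C [^] n \<otimes> g = (C [^] n \<otimes> A [^] (1 - \<alpha> ^ n) \<otimes> inv (C [^] n)) \<otimes> (C [^] n) [^] (1::int)"
        using conj_C_pow_A by simp
      moreover have "C [^] n \<otimes> A [^] (1 - \<alpha> ^ n) \<otimes> inv (C [^] n) \<in> N"
        using N.inv_op_closed2[OF _ 1] by simp
      ultimately show ?thesis by (intro bexI exI)
    next
      assume "g = B"
      then have "inv g \<otimes> C [^] n \<otimes> g = B [^] (\<beta> ^ n - 1) \<otimes> (C [^] n) [^] (1::int)"
        using conj_C_pow_B by simp
      then show ?thesis using 2 by (intro bexI exI)
    qed
  qed (use mem in \<open>simp_all add: nat_pow_pow\<close>)
  interpret N1: normal N1 G by (rule N1)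
  obtain N2 where N2: "N2 \<lhd> G" "N1 \<subseteq> N2" "A [^] n \<in> N2" "\<And>y. y \<in> N2 \<Longrightarrow> y [^] q \<in> N1"
  proof (rule adjoin_normal[OF N1(1) _ X gen tors, of "A [^] n" q])
    fix g assume "g \<in> {A, B}"
    then show "\<exists>x\<in>N1. \<exists>k::int. inv g \<otimes> A [^] n \<otimes> g = x \<otimes> (A [^] n) [^] k"
    proof (elim insertE emptyE)
      assume "g = A"
      then have "inv g \<otimes> A [^] n \<otimes> g = \<one> \<otimes> (A [^] n) [^] (1::int)"
        using nat_pow_comm[of A n 1] by (simp add: m_assoc)
      then show ?thesis using N1.one_closed by (intro bexI exI)
    next
      assume "g = B"
      obtain k :: int where "A [^] (\<alpha> * gsum \<alpha> n) = (A [^] n) [^] k" using A_pow_gsum by blast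
      then have "inv g \<otimes> A [^] n \<otimes> g = C [^] n \<otimes> (A [^] n) [^] k"
        using conj_A_pow_B[of n] \<open>g = B\<close> by simp
      then show ?thesis using N1(3) by (intro bexI exI)
    qed
  qed (use mem N1 in \<open>auto simp: nat_pow_pow\<close>)
  interpret N2: normal N2 G by (rule N2)
  obtain N3 where N3: "N3 \<lhd> G" "N2 \<subseteq> N3" "B [^] n \<in> N3" "\<And>y. y \<in> N3 \<Longrightarrow> y [^] q \<in> N2"
  proof (rule adjoin_normal[OF N2(1) _ X gen tors, of "B [^] n" q])
    fix g assume "g \<in> {A, B}"
    then show "\<exists>x\<in>N2. \<exists>k::int. inv g \<otimes> B [^] n \<otimes> g = x \<otimes> (B [^] n) [^] k"
    proof (elim insertE emptyE)
      assume "g = B"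
      then have "inv g \<otimes> B [^] n \<otimes> g = \<one> \<otimes> (B [^] n) [^] (1::int)"
        using nat_pow_comm[of B n 1] by (simp add: m_assoc)
      then show ?thesis using N2.one_closed by (intro bexI exI)
    next
      assume "g = A"
      have mem: "(inv C) [^] n \<in> N2" using N1(3) N2(2) N2.m_inv_closed by (auto simp: nat_pow_inv)
      obtain k :: int where "B [^] (\<beta> * gsum \<beta> n) = (B [^] n) [^] k" using swap.A_pow_gsum by blast
      then have "inv g \<otimes> B [^] n \<otimes> g = (inv C) [^] n \<otimes> (B [^] n) [^] k"
        using swap.conj_A_pow_B[of n] \<open>g = A\<close> by simp
      then show ?thesis using mem by (intro bexI exI)
    qed
  qed (use mem N1 N2 in \<open>auto simp: nat_pow_pow\<close>)
  have "y [^] (q ^ 3) \<in> N" if "y \<in> N3" for y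
  proof -
    have y: "y \<in> carrier G" using that subgroup.mem_carrier[OF normal_imp_subgroup[OF N3(1)]] by simp
    have "((y [^] q) [^] q) [^] q \<in> N" by (rule N1(4)[OF N2(4)[OF N3(4)[OF that]]])
    then show ?thesis using y by (simp add: nat_pow_pow power3_eq_cube)
  qed
  moreover have "A [^] n \<in> N3" "C [^] n \<in> N3" using N1(3) N2(2,3) N3(2) by auto
  ultimately show thesis using that N3(1,3) by blast
qed

text \<open>Used twice for one factorisation of a common exponent of A, B, C, with F2 first its
  2-part and then its odd part.\<close>

lemma chain:
  fixes F1 F2 :: nat
  assumes "F2 \<noteq> 0" "A [^] (F1 * F2) = \<one>" "B [^] (F1 * F2) = \<one>" "C [^] (F1 * F2) = \<one>"
  shows "\<exists>N. N \<lhd> G \<and> A [^] F1 \<in> N \<and> B [^] F1 \<in> N \<and> C [^] F1 \<in> N \<and> (\<forall>x\<in>N. \<exists>j. x [^] (F2 ^ j) = \<one>)"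
  using assms
proof (induction F2 arbitrary: F1 rule: prime_divisors_induct)
  case (unit F2)
  then show ?case using one_is_normal by (intro exI[of _ "{\<one>}"]) simp
next
  case (factor q F2)
  have "F2 \<noteq> 0" "A [^] (F1 * q * F2) = \<one>" "B [^] (F1 * q * F2) = \<one>" "C [^] (F1 * q * F2) = \<one>"
    using factor.prems by (auto simp: mult.assoc)
  from factor.IH[OF this]
  obtain N where N: "N \<lhd> G" "A [^] (F1 * q) \<in> N" "B [^] (F1 * q) \<in> N" "C [^] (F1 * q) \<in> N"
    and tors: "\<forall>x\<in>N. \<exists>j. x [^] (F2 ^ j) = \<one>"
    by blast
  from chain_step[OF N(1) factor(1) N(2-4)] obtain N' where
    N': "N' \<lhd> G" "A [^] F1 \<in> N'" "B [^] F1 \<in> N'" "C [^] F1 \<in> N'" "\<And>y. y \<in> N' \<Longrightarrow> y [^] (q ^ 3) \<in> N"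
    by blast
  have "\<exists>j. x [^] ((q * F2) ^ j) = \<one>" if "x \<in> N'" for x
  proof -
    have x: "x \<in> carrier G" using that subgroup.mem_carrier[OF normal_imp_subgroup[OF N'(1)]] by simp
    from N'(5)[OF that] tors obtain j where "(x [^] (q ^ 3)) [^] (F2 ^ j) = \<one>" by blast
    then have "x [^] (q ^ 3 * F2 ^ j) = \<one>" using x by (simp add: nat_pow_pow)
    moreover have "(q * F2) ^ (j + 3) = q ^ 3 * F2 ^ j * (q ^ j * F2 ^ 3)"
      by (simp add: power_add power_mult_distrib)
    ultimately have "x [^] ((q * F2) ^ (j + 3)) = \<one>"
      using nat_pow_pow[OF x, of "q ^ 3 * F2 ^ j" "q ^ j * F2 ^ 3"] by simp
    then show ?thesis by blast
  qed
  then show ?case using N' by blast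
qed simp

end

section \<open>Two-adic estimates\<close>

text \<open>Quadratic precision is what is needed: u will be a multiple of 2^m, and the estimates
  below are modulo 2^(3m) or coarser.\<close>

lemma power_expand3: "u ^ 3 dvd (1 + u) ^ n - (1 + int n * u + int (n choose 2) * u\<^sup>2)" for u :: int
proof (induction n)
  case (Suc n)
  have "int (Suc n choose 2) = int n + int (n choose 2)" by (simp add: numeral_2_eq_2)
  then have "(1 + u) ^ Suc n - (1 + int (Suc n) * u + int (Suc n choose 2) * u\<^sup>2)
      = (1 + u) * ((1 + u) ^ n - (1 + int n * u + int (n choose 2) * u\<^sup>2)) + u ^ 3 * int (n choose 2)"
    by (simp add: algebra_simps power2_eq_square power3_eq_cube)
  then show ?case using Suc by simp
qed (simp add: binomial_eq_0)

lemma gsum_expand3: "u ^ 3 dvd gsum (1 + u) n - (int n + int (n choose 2) * u + int (n choose 3) * u\<^sup>2)"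
proof (induction n)
  case (Suc n)
  have "int (Suc n choose 2) = int n + int (n choose 2)" "int (Suc n choose 3) = int (n choose 2) + int (n choose 3)"
    by (simp_all add: numeral_2_eq_2 numeral_3_eq_3)
  then have "gsum (1 + u) (Suc n) - (int (Suc n) + int (Suc n choose 2) * u + int (Suc n choose 3) * u\<^sup>2)
      = (gsum (1 + u) n - (int n + int (n choose 2) * u + int (n choose 3) * u\<^sup>2))
      + ((1 + u) ^ n - (1 + int n * u + int (n choose 2) * u\<^sup>2))"
    by (simp add: gsum_Suc algebra_simps)
  then show ?case using dvd_add[OF Suc power_expand3[of u n]] by (simp only:)
qed (simp add: binomial_eq_0)

lemma choose2: "2 * int (n choose 2) = int n * (int n - 1)"
  by (induction n) (simp_all add: numeral_2_eq_2 algebra_simps)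

lemma choose3: "6 * int (n choose 3) = int n * (int n - 1) * (int n - 2)"
proof (induction n)
  case (Suc n)
  have "6 * int (Suc n choose 3) = 6 * int (n choose 3) + 3 * (2 * int (n choose 2))"
    by (simp add: numeral_3_eq_3 numeral_2_eq_2)
  then show ?case by (simp add: Suc choose2 algebra_simps)
qed simp

text \<open>Equal to \<open>(b - 1) * (\<Sum>i<n. i * b ^ i)\<close>: the exponent of \<open>B\<close> in \<open>A\<^sup>-\<^sup>1 A\<^sup>B\<^sup>n\<close>.\<close>
definition fsum :: "int \<Rightarrow> nat \<Rightarrow> int" where
  "fsum b n = int n * b ^ n - b * gsum b n"

lemma fsum_Suc: "fsum b (Suc n) = b * (fsum b n + b ^ n - 1)"
  by (simp add: fsum_def gsum_Suc_left algebra_simps)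

lemma fsum_expand: "u ^ 3 dvd fsum (1 + u) n - (u * int (n choose 2) + u\<^sup>2 * (\<Sum>i<n. (int i)\<^sup>2))"
proof -
  have *: "fsum (1 + u) (Suc n) = fsum (1 + u) n + u * (int n * (1 + u) ^ n)" for n
    by (simp add: fsum_def gsum_Suc algebra_simps)
  show ?thesis
  proof (induction n)
    case (Suc n)
    have "int (Suc n choose 2) = int n + int (n choose 2)" by (simp add: numeral_2_eq_2)
    then have "fsum (1 + u) (Suc n) - (u * int (Suc n choose 2) + u\<^sup>2 * (\<Sum>i<Suc n. (int i)\<^sup>2))
      = (fsum (1 + u) n - (u * int (n choose 2) + u\<^sup>2 * (\<Sum>i<n. (int i)\<^sup>2)))
       + u * int n * ((1 + u) ^ n - (1 + int n * u + int (n choose 2) * u\<^sup>2)) + u ^ 3 * (int n * int (n choose 2))"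
      by (simp add: * algebra_simps power2_eq_square power3_eq_cube)
    moreover have "u ^ 3 dvd u * int n * ((1 + u) ^ n - (1 + int n * u + int (n choose 2) * u\<^sup>2))"
      using power_expand3[of u n] by simp
    ultimately show ?case using Suc by simp
  qed (simp add: fsum_def binomial_eq_0)
qed

lemma sum_squares_int: "6 * (\<Sum>i<n. (int i)\<^sup>2) = int n * (int n - 1) * (2 * int n - 1)"
  by (induction n) (simp_all add: algebra_simps power2_eq_square)

lemma odd_square_mod4: "odd (x::int) \<Longrightarrow> 4 dvd x\<^sup>2 - 1"
proof (elim oddE)
  fix k assume "x = 2 * k + 1"
  then have "x\<^sup>2 - 1 = 4 * (k\<^sup>2 + k)" by (simp add: power2_eq_square algebra_simps)
  then show "4 dvd x\<^sup>2 - 1" by simp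
qed

lemma pow2_split: "3 \<le> m \<Longrightarrow> (2::int) ^ m = 8 * 2 ^ (m - 3)"
  using power_add[of "2::int" 3 "m - 3"] by simp

lemma pow2_dvd_mono: "a \<le> b \<Longrightarrow> (2::int) ^ b dvd x \<Longrightarrow> 2 ^ a dvd x"
  by (meson dvd_trans le_imp_power_dvd)

text \<open>The leading term is 2^m v (b choose 2) = 2^(2m-1) v^2 b, where v^2 and b are 1 modulo 4.
  The quadratic term has an additional factor 2 from the sum of squares.\<close>

lemma fsum_self:
  fixes b m :: nat
  assumes "m \<ge> 3" and b: "int b = 1 + 2 ^ m * v" and "odd v"
  shows "2 ^ (2 * m + 1) dvd fsum (int b) b - 2 ^ (2 * m - 1)"
proof -
  \<comment> \<open>Writing 2^m = 8 M turns 2^(2m-1) and the like into polynomials in M, so the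
    congruence becomes a ring identity.\<close>
  define M :: int where "M = 2 ^ (m - 3)"
  have M: "(2::int) ^ m = 8 * M" using assms(1) pow2_split M_def by simp
  have "(2::int) ^ (2 * m) = 64 * M\<^sup>2"
    using M by (simp add: power_mult mult.commute[of 2] power_mult_distrib)
  then have M2: "(2::int) ^ (2 * m + 1) = 128 * M\<^sup>2" "(2::int) ^ (2 * m - 1) = 32 * M\<^sup>2"
    using assms(1) by (simp_all add: power_diff)
  define S where "S = (\<Sum>i<b. (int i)\<^sup>2)"
  define D where "D = int (b choose 2)"
  have bv: "int b = 1 + 8 * M * v" by (simp add: b M)
  have "2 * D = 2 * (4 * M * v * int b)" unfolding D_def choose2 by (simp add: bv)
  then have D: "D = 4 * M * v * int b" by simp
  have "6 * S = 2 * (4 * M * v * int b * (2 * int b - 1))"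
    unfolding S_def sum_squares_int by (simp add: bv)
  then have "3 * S = 2 * (2 * M * v * int b * (2 * int b - 1))" by simp
  then have "even (3 * S)" by (metis dvd_triv_left)
  then obtain S' where S': "S = 2 * S'" by auto
  obtain v' where "v\<^sup>2 - 1 = 4 * v'" using odd_square_mod4[OF assms(3)] by blast
  then have v': "v\<^sup>2 = 1 + 4 * v'" by simp
  obtain R where R: "fsum (int b) b - (8 * M * v * D + (8 * M * v)\<^sup>2 * S) = (8 * M * v) ^ 3 * R"
    using fsum_expand[of "8 * M * v" b] unfolding bv[symmetric] D_def S_def by blast
  have "fsum (int b) b - 32 * M\<^sup>2 = 32 * M\<^sup>2 * (v\<^sup>2 - 1) + 256 * M ^ 3 * v ^ 3
      + 128 * M\<^sup>2 * v\<^sup>2 * S' + 512 * M ^ 3 * v ^ 3 * R"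
    using R by (simp add: D S' bv power2_eq_square power3_eq_cube algebra_simps)
  also have "\<dots> = 128 * M\<^sup>2 * (v' + 2 * M * v ^ 3 + v\<^sup>2 * S' + 4 * M * v ^ 3 * R)"
    unfolding v' by (simp add: power2_eq_square power3_eq_cube algebra_simps)
  finally show ?thesis by (simp only: M2 dvd_triv_left)
qed

text \<open>The exponent of \<open>A\<close> in \<open>(A\<^sup>n)\<^sup>B = C\<^sup>n A\<^sup>n A\<^sup>T\<close>.\<close>
definition tsum :: "int \<Rightarrow> nat \<Rightarrow> int" where
  "tsum a n = a * gsum a n - int n"

lemma tsum_double: "tsum a (2 * n) = (1 + a ^ n) * tsum a n + int n * (a ^ n - 1)"
proof -
  have "gsum a (n + n) = gsum a n * (1 + a ^ n)" by (simp add: gsum_add algebra_simps)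
  then show ?thesis unfolding tsum_def mult_2[of n] by (simp add: algebra_simps)
qed

lemma pow2_dvd_power_minus_one:
  assumes "(2::int) ^ m dvd a - 1" "m \<ge> 1" "2 ^ k dvd n"
  shows "(2::int) ^ (m + k) dvd a ^ n - 1"
proof -
  have "p = 2" if "Factorial_Ring.prime p" "p dvd 2 ^ k" for p :: nat
    using that by (metis prime_dvd_power primes_dvd_imp_eq two_is_prime_nat)
  moreover have "(2::int) dvd a - 1" using pow2_dvd_mono[OF assms(2,1)] by (simp only: power_one_right)
  ultimately have "int p dvd a - 1" if "Factorial_Ring.prime p" "p dvd 2 ^ k" for p :: nat
    using that by (metis of_nat_numeral)
  then have "int (2 ^ k) dvd gsum a n" using assms(3) by (intro dvd_gsum) simp_all
  then have "2 ^ m * 2 ^ k dvd (a - 1) * gsum a n" using assms(1) by (intro mult_dvd_mono) simp_all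
  then show ?thesis by (simp add: gsum_geometric power_add)
qed

text \<open>To first order the sum is (a-1) n (n+1) / 2; the missing factor 2 is this
  halving.\<close>

lemma pow2_dvd_tsum:
  assumes "(2::int) ^ m dvd a - 1" "m \<ge> 1"
  shows "(2::int) ^ (m + k - 1) dvd tsum a (2 ^ k * n)"
proof (induction k)
  case 0
  have "a - 1 dvd gsum a n - int n" by (rule gsum_cong_count)
  then have "a - 1 dvd (gsum a n - int n) + (a - 1) * gsum a n" by (intro dvd_add) simp_all
  moreover have "(gsum a n - int n) + (a - 1) * gsum a n = tsum a n" by (simp add: tsum_def algebra_simps)
  ultimately have "2 ^ m dvd tsum a n" using assms(1) dvd_trans by metis
  then show ?case using pow2_dvd_mono[of "m - 1" m] by simp
next
  case (Suc k)
  let ?n = "2 ^ k * n"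
  have e: "m + Suc k - 1 = Suc (m + k - 1)" using assms(2) by simp
  have "2 ^ (m + k) dvd a ^ ?n - 1" using assms by (intro pow2_dvd_power_minus_one) simp_all
  then have 1: "2 ^ (m + k) dvd int ?n * (a ^ ?n - 1)" by simp
  have "2 ^ 1 dvd a ^ ?n - 1"
    using pow2_dvd_mono[OF _ \<open>2 ^ (m + k) dvd a ^ ?n - 1\<close>, of 1] assms(2) by (simp only: trans_le_add1)
  then have "2 dvd (a ^ ?n - 1) + 2" by (intro dvd_add) simp_all
  then have "2 dvd 1 + a ^ ?n" by (simp only: diff_add_eq add.commute) (simp add: algebra_simps)
  then have "2 * 2 ^ (m + k - 1) dvd (1 + a ^ ?n) * tsum a ?n" using Suc by (intro mult_dvd_mono)
  moreover have "m + k = Suc (m + k - 1)" using assms(2) by simp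
  ultimately have "2 ^ (m + k) dvd tsum a (2 * ?n)"
    unfolding tsum_double using 1 by (metis dvd_add power_Suc)
  then show ?case by (simp add: mult.assoc)
qed

text \<open>Each doubling of n multiplies the sum by 1 + a^n, which is 2 modulo 4. The exact
  valuation is what later bounds the order of c and the class from below.\<close>

lemma gsum_two_adic:
  assumes "4 dvd a - 1" "odd x"
  shows "\<exists>y. odd y \<and> gsum a (2 ^ k * x) = 2 ^ k * y"
proof (induction k)
  case 0
  have "a - 1 dvd gsum a x - int x" by (rule gsum_cong_count)
  then have "2 dvd gsum a x - int x" using assms(1) by (metis dvd_trans dvd_def mult_2 numeral_Bit0)
  then show ?case using assms(2) by (intro exI[of _ "gsum a x"]) auto
next
  case (Suc k)
  then obtain y where y: "odd y" "gsum a (2 ^ k * x) = 2 ^ k * y" by blast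
  let ?n = "2 ^ k * x"
  have "4 dvd a ^ ?n - 1" using assms(1) dvd_power_minus_one dvd_trans by blast
  then obtain z where z: "a ^ ?n = 1 + 4 * z" by (metis add.commute diff_add_cancel dvdE)
  have "gsum a (?n + ?n) = gsum a ?n * (1 + a ^ ?n)" by (simp add: gsum_add distrib_left)
  also have "\<dots> = 2 ^ Suc k * (y * (1 + 2 * z))" unfolding y z by (simp add: algebra_simps)
  also have "?n + ?n = 2 ^ Suc k * x" by simp
  finally show ?case using y(1) by (intro exI[of _ "y * (1 + 2 * z)"]) simp
qed

text \<open>The term u^2 (n choose 2) has valuation at least 2m + (2m-3), and everything after it is
  divisible by u^3.\<close>

lemma power_minus_one_mod:
  assumes "m \<ge> 3" "u = 2 ^ m * u'" "(2::nat) ^ (2 * m - 2) dvd n"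
  shows "2 ^ (3 * m) dvd (1 + u) ^ n - 1 - u * int n"
proof -
  define M :: int where "M = 2 ^ (m - 3)"
  have M: "(2::int) ^ m = 8 * M" using assms(1) pow2_split M_def by simp
  then have M3: "(2::int) ^ (3 * m) = 512 * M ^ 3"
    by (simp add: power_mult mult.commute[of 3] power_mult_distrib)
  have "(2::int) ^ (2 * m) = 64 * M\<^sup>2"
    using M by (simp add: power_mult mult.commute[of 2] power_mult_distrib)
  then have M2: "(2::int) ^ (2 * m - 2) = 16 * M\<^sup>2" using assms(1) by (simp add: power_diff)
  obtain k where "n = 2 ^ (2 * m - 2) * k" using assms(3) by blast
  then have k: "int n = 16 * M\<^sup>2 * int k" using M2 by simp
  have u: "u = 8 * M * u'" using assms(2) M by simp
  have "2 * int (n choose 2) = 2 * (8 * M\<^sup>2 * int k * (int n - 1))" unfolding choose2 by (simp add: k)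
  then have c2: "int (n choose 2) = 8 * M\<^sup>2 * int k * (int n - 1)" by simp
  obtain R where R: "gsum (1 + u) n - (int n + int (n choose 2) * u + int (n choose 3) * u\<^sup>2) = u ^ 3 * R"
    using gsum_expand3 by blast
  have "(1 + u) ^ n - 1 - u * int n = u * (gsum (1 + u) n - int n)"
    using gsum_geometric[of "1 + u" n] by (simp add: algebra_simps)
  also have "\<dots> = u\<^sup>2 * int (n choose 2) + u ^ 3 * (int (n choose 3) + u * R)"
    using R by (simp add: algebra_simps power2_eq_square power3_eq_cube)
  also have "\<dots> = 512 * M ^ 3 * (M * u'\<^sup>2 * int k * (int n - 1) + u' ^ 3 * (int (n choose 3) + u * R))"
    unfolding c2 by (simp add: u algebra_simps power2_eq_square power3_eq_cube)
  finally show ?thesis by (simp only: M3 dvd_triv_left)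
qed

text \<open>To first order the sum is u n (n+1) / 2, and n/2 is 2^(2m-2) modulo 2^(2m).\<close>

lemma tsum_mod:
  assumes "m \<ge> 3" "u = 2 ^ m * u'" "2 ^ (2 * m + 1) dvd int n - 2 ^ (2 * m - 1)"
  shows "2 ^ (3 * m) dvd tsum (1 + u) n - u * 2 ^ (2 * m - 2)"
proof -
  define M :: int where "M = 2 ^ (m - 3)"
  have M: "(2::int) ^ m = 8 * M" using assms(1) pow2_split M_def by simp
  then have M3: "(2::int) ^ (3 * m) = 512 * M ^ 3"
    by (simp add: power_mult mult.commute[of 3] power_mult_distrib)
  have "(2::int) ^ (2 * m) = 64 * M\<^sup>2"
    using M by (simp add: power_mult mult.commute[of 2] power_mult_distrib)
  then have M2: "(2::int) ^ (2 * m + 1) = 128 * M\<^sup>2" "(2::int) ^ (2 * m - 1) = 32 * M\<^sup>2"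
    "(2::int) ^ (2 * m - 2) = 16 * M\<^sup>2"
    using assms(1) by (simp_all add: power_diff)
  obtain z where z: "int n - 32 * M\<^sup>2 = 128 * M\<^sup>2 * z" using assms(3) unfolding M2 by blast
  define y where "y = 16 * M\<^sup>2 * (1 + 4 * z)"
  have n: "int n = 2 * y" using z by (simp add: y_def algebra_simps)
  have u: "u = 8 * M * u'" using assms(2) M by simp
  have "2 * int (n choose 2) = 2 * (y * (int n - 1))" unfolding choose2 by (simp add: n)
  then have c2: "int (n choose 2) = y * (2 * y - 1)" using n by simp
  have "6 * int (n choose 3) = 2 * (2 * y * (2 * y - 1) * (y - 1))"
    unfolding choose3 by (simp add: n algebra_simps)
  then have "3 * int (n choose 3) = 16 * M\<^sup>2 * (2 * (1 + 4 * z) * (2 * y - 1) * (y - 1))"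
    by (simp add: y_def)
  then have "8 * M dvd 3 * int (n choose 3)" by (simp add: power2_eq_square)
  moreover have "coprime (8 * M) 3"
  proof -
    have "coprime ((2::int) ^ m) 3" by simp
    then show ?thesis by (simp add: M)
  qed
  ultimately have "8 * M dvd int (n choose 3)" by (simp add: coprime_dvd_mult_right_iff)
  then obtain c where c: "int (n choose 3) = 8 * M * c" by blast
  obtain R where R: "gsum (1 + u) n - (int n + int (n choose 2) * u + int (n choose 3) * u\<^sup>2) = u ^ 3 * R"
    using gsum_expand3 by blast
  then have g: "gsum (1 + u) n = int n + int (n choose 2) * u + int (n choose 3) * u\<^sup>2 + u ^ 3 * R" by simp
  have "tsum (1 + u) n - u * (16 * M\<^sup>2)
      = u * (y - 16 * M\<^sup>2) + 2 * u * y\<^sup>2 + u\<^sup>2 * (y * (2 * y - 1)) + (1 + u) * u\<^sup>2 * (8 * M * c) + (1 + u) * u ^ 3 * R"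
    unfolding tsum_def g c2 c n by (simp add: algebra_simps power2_eq_square power3_eq_cube)
  also have "\<dots> = 512 * M ^ 3 * (u' * z + 8 * M\<^sup>2 * u' * (1 + 4 * z)\<^sup>2 + 2 * M * u'\<^sup>2 * (1 + 4 * z) * (2 * y - 1)
      + (1 + u) * u'\<^sup>2 * c + (1 + u) * u' ^ 3 * R)"
    unfolding u by (simp add: y_def algebra_simps power2_eq_square power3_eq_cube)
  finally show ?thesis by (simp only: M3 M2 dvd_triv_left)
qed

section \<open>Power relations in the 2-part\<close>

lemma two_adic_inverse: "odd (y::int) \<Longrightarrow> \<exists>w. odd w \<and> 2 ^ L dvd y * w - 1"
proof -
  assume "odd y"
  then have "coprime y (2 ^ L)" by simp
  then obtain s t where st: "s * y + t * 2 ^ L = 1"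
    using bezout_int[of y "2 ^ L"] by (auto simp: coprime_iff_gcd_eq_1)
  show ?thesis
  proof (cases L)
    \<comment> \<open>Modulo 1 the congruence says nothing about parity, so an odd witness is chosen
      separately.\<close>
    case 0
    then show ?thesis by (intro exI[of _ 1]) simp
  next
    case (Suc l)
    have "s * y = 1 - t * 2 ^ L" using st by simp
    then have "odd (s * y)" by (simp add: Suc)
    moreover have "y * s - 1 = 2 ^ L * (- t)" using st by (simp add: algebra_simps)
    ultimately show ?thesis by (metis dvd_triv_left even_mult_iff)
  qed
qed

lemma (in group) twist_of_inv:
  assumes "x \<in> carrier G" "y \<in> carrier G" "z \<in> carrier G" "inv y \<otimes> x = z \<otimes> inv y"
  shows "x \<otimes> y = y \<otimes> z"
proof -
  have "x \<otimes> y = y \<otimes> (inv y \<otimes> x) \<otimes> y" using assms(1-3) by (simp add: m_assoc[symmetric])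
  also have "\<dots> = y \<otimes> z" unfolding assms(4) using assms(1-3) by (simp add: m_assoc)
  finally show ?thesis .
qed

text \<open>Odd factors of an exponent are invertible on an element of 2-power order; this converts
  valuations into membership and order statements.\<close>

lemma (in group) pow2_odd_mem:
  fixes y :: int
  assumes "subgroup N G" "x \<in> carrier G" "x [^] ((2::int) ^ L) = \<one>" "x [^] (2 ^ k * y) \<in> N" "odd y" "2 ^ k dvd j"
  shows "x [^] (j::int) \<in> N"
proof (rule int_pow_gcd_mem[OF assms(1,2)])
  show "x [^] ((2::int) ^ L) \<in> N" using assms(1,3) by (simp add: subgroup.one_closed)
  have "coprime (gcd (2 ^ L) (2 ^ k * y)) y"
    using assms(5) by (meson coprime_divisors coprime_power_left_iff dvd_refl gcd_dvd1 coprime_left_2_iff_odd)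
  moreover have "gcd (2 ^ L) (2 ^ k * y) dvd 2 ^ k * y" by simp
  ultimately have "gcd (2 ^ L) (2 ^ k * y) dvd 2 ^ k" by (simp only: coprime_dvd_mult_left_iff)
  then show "gcd (2 ^ L) (2 ^ k * y) dvd j" using assms(6) dvd_trans by blast
qed (fact assms)

lemma (in group) pow2_odd_one:
  fixes y :: int
  assumes "x \<in> carrier G" "x [^] ((2::int) ^ L) = \<one>" "x [^] (2 ^ k * y) = \<one>" "odd y" "2 ^ k dvd j"
  shows "x [^] (j::int) = \<one>"
  using pow2_odd_mem[OF triv_subgroup assms(1,2), of k y j] assms(3-5) by simp

lemma (in group) int_pow_range_subgroup:
  assumes "x \<in> carrier G"
  shows "subgroup (range (\<lambda>k::int. x [^] k)) G"
proof (rule subgroupI)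
  show "range (\<lambda>k::int. x [^] k) \<noteq> {}" by auto
  show "inv y \<in> range (\<lambda>k::int. x [^] k)" if "y \<in> range (\<lambda>k::int. x [^] k)" for y
  proof -
    from that obtain k :: int where "y = x [^] k" by blast
    then have "inv y = x [^] (- k)" using assms by (simp add: int_pow_neg)
    then show ?thesis by blast
  qed
  show "y \<otimes> z \<in> range (\<lambda>k::int. x [^] k)"
    if "y \<in> range (\<lambda>k::int. x [^] k)" "z \<in> range (\<lambda>k::int. x [^] k)" for y z
  proof -
    from that obtain k l :: int where "y = x [^] k" "z = x [^] l" by blast
    then have "y \<otimes> z = x [^] (k + l)" using assms by (simp add: int_pow_mult)
    then show ?thesis by blast
  qed
qed (use assms in auto)

context macdonald
begin

lemma commutes_C:
  assumes z: "z \<in> carrier G" and zA: "z \<otimes> A = A \<otimes> z" and zB: "z \<otimes> B = B \<otimes> z"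
  shows "z \<otimes> C = C \<otimes> z"
proof -
  have "B \<otimes> (A \<otimes> (z \<otimes> C)) = B \<otimes> (z \<otimes> A) \<otimes> C" unfolding zA using z by (simp add: m_assoc)
  also have "\<dots> = z \<otimes> B \<otimes> A \<otimes> C" unfolding zB using z by (simp add: m_assoc)
  also have "\<dots> = z \<otimes> A \<otimes> B" using z by (simp add: m_assoc AB)
  also have "\<dots> = A \<otimes> (z \<otimes> B)" unfolding zA using z by (simp add: m_assoc)
  also have "\<dots> = A \<otimes> B \<otimes> z" unfolding zB using z by (simp add: m_assoc)
  also have "\<dots> = B \<otimes> (A \<otimes> (C \<otimes> z))" using z by (simp add: AB m_assoc)
  finally show ?thesis using z by simp
qed

text \<open>Obtained by iterating A^B = A C. At n = \<beta> it is the second expression for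
  A^(B^\<beta>), to be compared with \<open>A_B_pow_beta\<close>.\<close>

lemma A_B_pow: "A \<otimes> B [^] (n::nat) = B [^] n \<otimes> (A \<otimes> (B [^] fsum \<beta> n \<otimes> C [^] n))"
proof (induction n)
  case (Suc n)
  have 1: "C [^] n \<otimes> B = B [^] (\<beta> ^ n) \<otimes> C [^] n" using C_pow_B_pow[of n 1] by simp
  have 2: "C \<otimes> B [^] k = B [^] (k * \<beta>) \<otimes> C" for k :: int using C_pow_B_pow[of 1 k] by simp
  have "A \<otimes> B [^] Suc n = (A \<otimes> B [^] n) \<otimes> B" by (simp add: m_assoc)
  also have "\<dots> = B [^] n \<otimes> (A \<otimes> (B [^] fsum \<beta> n \<otimes> (C [^] n \<otimes> B)))" by (simp add: Suc m_assoc)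
  also have "\<dots> = B [^] n \<otimes> (A \<otimes> (B [^] (fsum \<beta> n + \<beta> ^ n) \<otimes> C [^] n))"
    unfolding 1 by (simp add: int_pow_add_assoc)
  also have "B [^] (fsum \<beta> n + \<beta> ^ n) = B \<otimes> B [^] (fsum \<beta> n + \<beta> ^ n - 1)"
    using int_pow_add[of B 1 "fsum \<beta> n + \<beta> ^ n - 1"] by simp
  also have "B [^] n \<otimes> (A \<otimes> ((B \<otimes> B [^] (fsum \<beta> n + \<beta> ^ n - 1)) \<otimes> C [^] n))
     = B [^] n \<otimes> ((A \<otimes> B) \<otimes> (B [^] (fsum \<beta> n + \<beta> ^ n - 1) \<otimes> C [^] n))" by (simp add: m_assoc)
  also have "\<dots> = B [^] n \<otimes> (B \<otimes> (A \<otimes> ((C \<otimes> B [^] (fsum \<beta> n + \<beta> ^ n - 1)) \<otimes> C [^] n)))"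
    by (simp add: AB m_assoc)
  also have "\<dots> = B [^] Suc n \<otimes> (A \<otimes> (B [^] fsum \<beta> (Suc n) \<otimes> (C \<otimes> C [^] n)))"
    unfolding 2 by (simp add: m_assoc fsum_Suc mult.commute)
  also have "C \<otimes> C [^] n = C [^] Suc n" using nat_pow_Suc2[of C n] by simp
  finally show ?case .
qed (simp add: fsum_def)

end

text \<open>The exponents are naturals here because they also serve as iteration counts. 2^L is an a
  priori exponent, large enough that passing to representatives modulo 2^L preserves every
  congruence in use.\<close>

locale macdonald_two = macdonald G A B C "int \<alpha>" "int \<beta>" for G (structure) and A B C and \<alpha> \<beta> :: nat +
  fixes m L :: nat and u v \<eta> :: int
  assumes m: "m \<ge> 3" and alpha: "int \<alpha> = 1 + 2 ^ m * u" and beta: "int \<beta> = 1 + 2 ^ m * v"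
    and u: "odd u" and v: "odd v"
    and N: "int \<alpha> - int \<beta> = 2 ^ (2 * m - 2) * \<eta>" and eta: "odd \<eta>"
    and L: "L \<ge> 4 * m"
    and torsA: "A [^] ((2::int) ^ L) = \<one>" and torsB: "B [^] ((2::int) ^ L) = \<one>"
    and torsC: "C [^] ((2::int) ^ L) = \<one>"
begin

lemma macdonald_two_swap: "macdonald_two G B A (inv C) \<beta> \<alpha> m L v u (- \<eta>)"
proof (intro macdonald_two.intro macdonald_two_axioms.intro macdonald_swap)
  show "int \<beta> - int \<alpha> = 2 ^ (2 * m - 2) * - \<eta>" using N by simp
  show "inv C [^] ((2::int) ^ L) = \<one>" using torsC by (simp add: int_pow_inv)
  show "odd (- \<eta>)" using eta by simp
qed (fact m alpha beta u v L torsA torsB)+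

lemma pow2_3m: "(2::int) ^ (3 * m) = 2 ^ (3 * m - 2) * 4" "(2::int) ^ (3 * m - 1) = 2 ^ (3 * m - 2) * 2"
proof -
  have "3 * m = 3 * m - 2 + 2" "3 * m - 1 = 3 * m - 2 + 1" using m by simp_all
  then have "(2::int) ^ (3 * m) = 2 ^ (3 * m - 2) * 2 ^ 2" "(2::int) ^ (3 * m - 1) = 2 ^ (3 * m - 2) * 2 ^ 1"
    by (metis power_add)+
  then show "(2::int) ^ (3 * m) = 2 ^ (3 * m - 2) * 4" "(2::int) ^ (3 * m - 1) = 2 ^ (3 * m - 2) * 2" by simp_all
qed

lemma odd_alpha: "odd (int \<alpha>)"
  using alpha m by simp

text \<open>\<alpha> is odd, hence invertible modulo 2^L, so C^-1 now normalises <A> as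
  well.\<close>

lemma C_pow_A_pow: "\<exists>w. odd w \<and> (\<forall>j::int. C [^] (n::nat) \<otimes> A [^] j = A [^] (j * w) \<otimes> C [^] n)"
proof -
  have "odd (int \<alpha> ^ n)" using odd_alpha by simp
  then obtain w where w: "odd w" "2 ^ L dvd int \<alpha> ^ n * w - 1" using two_adic_inverse by blast
  have "C [^] n \<otimes> A [^] j = A [^] (j * w) \<otimes> C [^] n" for j :: int
  proof -
    have "A [^] (j * w) \<otimes> C [^] n = C [^] n \<otimes> A [^] (j * w * int \<alpha> ^ n)" by (rule A_pow_C_pow)
    also have "A [^] (j * w * int \<alpha> ^ n) = A [^] j"
    proof (rule int_pow_cong[OF A torsA])
      have "j * w * int \<alpha> ^ n - j = j * (int \<alpha> ^ n * w - 1)" by (simp add: algebra_simps)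
      then show "2 ^ L dvd j * w * int \<alpha> ^ n - j" using w(2) by simp
    qed
    finally show ?thesis by simp
  qed
  then show ?thesis using w(1) by blast
qed

definition fA :: int where "fA = fsum (int \<alpha>) \<alpha>"
definition fB :: int where "fB = fsum (int \<beta>) \<beta>"

lemma fB_mod: "2 ^ (2 * m + 1) dvd fB - 2 ^ (2 * m - 1)"
  unfolding fB_def using fsum_self[OF m beta v] .

lemma odd_factor:
  assumes "(2::int) ^ (k + 1) dvd x - 2 ^ k"
  obtains y where "odd y" "x = 2 ^ k * y"
proof -
  obtain z where "x - 2 ^ k = 2 ^ (k + 1) * z" using assms by blast
  then have "x = 2 ^ k * (1 + 2 * z)" by (simp add: algebra_simps)
  then show thesis using that[of "1 + 2 * z"] by simp
qed

lemma fB_factor: obtains y where "odd y" "fB = 2 ^ (2 * m - 1) * y"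
proof -
  have "2 ^ (2 * m - 1 + 1) dvd fB - 2 ^ (2 * m - 1)"
    by (rule pow2_dvd_mono[OF _ fB_mod]) simp
  then show thesis using that by (rule odd_factor)
qed

lemma fA_factor: obtains y where "odd y" "fA = 2 ^ (2 * m - 1) * y"
proof -
  interpret swap: macdonald_two G B A "inv C" \<beta> \<alpha> m L v u "- \<eta>" by (rule macdonald_two_swap)
  show thesis using swap.fB_factor that unfolding swap.fB_def fA_def by blast
qed

lemma fA_mod: "2 ^ (2 * m + 1) dvd fA - 2 ^ (2 * m - 1)"
proof -
  interpret swap: macdonald_two G B A "inv C" \<beta> \<alpha> m L v u "- \<eta>" by (rule macdonald_two_swap)
  show ?thesis using swap.fB_mod unfolding swap.fB_def fA_def .
qed

text \<open>Equate \<open>A_B_pow\<close> at n = \<beta> with \<open>A_B_pow_beta\<close> and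
  cancel. Times \<alpha>, the exponent of A before the odd factor w enters is -fA, which fixes its
  valuation 2m-1.\<close>

lemma B_pow_fB:
  obtains g y :: int where "B [^] fB = C [^] (int \<alpha> - int \<beta>) \<otimes> A [^] g" "odd y" "g = 2 ^ (2 * m - 1) * y"
proof -
  define s where "s = gsum (int \<alpha>) \<alpha>"
  have "B [^] \<beta> \<otimes> (A \<otimes> (B [^] fB \<otimes> C [^] \<beta>)) = A \<otimes> B [^] int \<beta>"
    unfolding fB_def int_pow_int by (rule A_B_pow[symmetric])
  also have "\<dots> = B [^] \<beta> \<otimes> (C [^] \<alpha> \<otimes> A [^] s)"
    using A_B_pow_beta unfolding int_pow_int CA_pow s_def .
  finally have "A \<otimes> (B [^] fB \<otimes> C [^] \<beta>) = C [^] \<alpha> \<otimes> A [^] s" by simp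
  then have "inv A \<otimes> (A \<otimes> (B [^] fB \<otimes> C [^] \<beta>)) = (A [^] (- 1 :: int) \<otimes> C [^] \<alpha>) \<otimes> A [^] s"
    by (simp add: int_pow_neg m_assoc)
  then have "B [^] fB \<otimes> C [^] \<beta> = C [^] \<alpha> \<otimes> A [^] (s - int \<alpha> ^ \<alpha>)"
    unfolding A_pow_C_pow by (simp add: m_assoc int_pow_add)
  moreover obtain w where w: "odd w" "\<And>j::int. C [^] \<beta> \<otimes> A [^] j = A [^] (j * w) \<otimes> C [^] \<beta>"
    using C_pow_A_pow[of \<beta>] by blast
  moreover have "C [^] \<alpha> = C [^] (int \<alpha> - int \<beta>) \<otimes> C [^] \<beta>"
    using int_pow_add[of C "int \<alpha> - int \<beta>" "int \<beta>"] by (simp add: int_pow_int)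
  ultimately have "B [^] fB \<otimes> C [^] \<beta> = C [^] (int \<alpha> - int \<beta>) \<otimes> A [^] ((s - int \<alpha> ^ \<alpha>) * w) \<otimes> C [^] \<beta>"
    by (simp add: m_assoc)
  then have 1: "B [^] fB = C [^] (int \<alpha> - int \<beta>) \<otimes> A [^] ((s - int \<alpha> ^ \<alpha>) * w)" by simp
  have eq: "int \<alpha> * (s - int \<alpha> ^ \<alpha>) = - fA"
    by (simp add: fA_def fsum_def s_def algebra_simps)
  obtain y where y: "odd y" "fA = 2 ^ (2 * m - 1) * y" by (rule fA_factor)
  have "2 ^ (2 * m - 1) dvd int \<alpha> * (s - int \<alpha> ^ \<alpha>)" unfolding eq y by simp
  moreover have "coprime ((2::int) ^ (2 * m - 1)) (int \<alpha>)" using odd_alpha by simp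
  ultimately have "2 ^ (2 * m - 1) dvd s - int \<alpha> ^ \<alpha>" by (simp add: coprime_dvd_mult_right_iff)
  then obtain z where z: "s - int \<alpha> ^ \<alpha> = 2 ^ (2 * m - 1) * z" by blast
  have "2 ^ (2 * m - 1) * (int \<alpha> * z) = 2 ^ (2 * m - 1) * (- y)" using eq unfolding z y by (simp add: algebra_simps)
  then have "int \<alpha> * z = - y" by (simp only: mult_cancel_left) simp
  then have "odd z" using y(1) by (metis even_minus even_mult_iff)
  then have "odd (z * w)" "(s - int \<alpha> ^ \<alpha>) * w = 2 ^ (2 * m - 1) * (z * w)" using w z by simp_all
  with 1 show thesis using that by blast
qed

lemma A_pow_fA:
  obtains g y :: int where "A [^] fA = C [^] (int \<alpha> - int \<beta>) \<otimes> B [^] g" "odd y" "g = 2 ^ (2 * m - 1) * y"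
proof -
  interpret swap: macdonald_two G B A "inv C" \<beta> \<alpha> m L v u "- \<eta>" by (rule macdonald_two_swap)
  have "inv C [^] (int \<beta> - int \<alpha>) = C [^] (int \<alpha> - int \<beta>)"
    by (simp add: int_pow_inv int_pow_neg[symmetric])
  then show thesis using swap.B_pow_fB that unfolding swap.fB_def fA_def by metis
qed

lemma nat_representative: "\<exists>n::nat. 2 ^ L dvd int n - z"
proof -
  have "2 ^ L dvd z mod 2 ^ L - z" by (metis dvd_minus_mod dvd_diff_commute)
  moreover have "int (nat (z mod 2 ^ L)) = z mod 2 ^ L" by simp
  ultimately show ?thesis by metis
qed

lemma N_representative:
  obtains n :: nat where "2 ^ L dvd int n - (int \<alpha> - int \<beta>)" "C [^] (int \<alpha> - int \<beta>) = C [^] n" "2 ^ (2 * m - 2) dvd n"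
proof -
  obtain n :: nat where n: "2 ^ L dvd int n - (int \<alpha> - int \<beta>)" using nat_representative by blast
  have "C [^] int n = C [^] (int \<alpha> - int \<beta>)" by (rule int_pow_cong[OF C torsC n])
  moreover have "2 ^ (2 * m - 2) dvd int n - (int \<alpha> - int \<beta>)"
    by (rule pow2_dvd_mono[OF _ n]) (use L in simp)
  then have "2 ^ (2 * m - 2) dvd int n - (int \<alpha> - int \<beta>) + (int \<alpha> - int \<beta>)"
    by (rule dvd_add) (simp add: N)
  then have "int (2 ^ (2 * m - 2)) dvd int n" by simp
  then have "2 ^ (2 * m - 2) dvd n" by (simp only: int_dvd_int_iff)
  ultimately show thesis using that n by (simp add: int_pow_int)
qed

text \<open>Conjugating A^fA = C^(\<alpha>-\<beta>) B^g by C leaves the factor C^(\<alpha>-\<beta>)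
  alone, so A^(fA (\<alpha>-1)) is a power of B and commutes with A, B and C. Commuting with C in
  turn gives A^(fA (\<alpha>-1)^2) = 1, of valuation (2m-1) + 2m.\<close>

lemma A_pow_4m: "2 ^ (4 * m - 1) dvd j \<Longrightarrow> A [^] (j::int) = \<one>"
proof -
  assume j: "2 ^ (4 * m - 1) dvd j"
  interpret swap: macdonald_two G B A "inv C" \<beta> \<alpha> m L v u "- \<eta>" by (rule macdonald_two_swap)
  obtain g y where g: "A [^] fA = C [^] (int \<alpha> - int \<beta>) \<otimes> B [^] (g::int)" "odd y" "g = 2 ^ (2 * m - 1) * y"
    by (rule A_pow_fA)
  obtain w where "\<And>j::int. inv C [^] (1::nat) \<otimes> B [^] j = B [^] (j * w) \<otimes> inv C [^] (1::nat)"
    using swap.C_pow_A_pow[of 1] by blast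
  then have w: "inv C \<otimes> B [^] j = B [^] (j * w) \<otimes> inv C" for j :: int by simp
  have BC: "B [^] g \<otimes> C = C \<otimes> B [^] (g * w)"
    by (rule twist_of_inv) (simp_all add: w)
  have "C \<otimes> A [^] (fA * int \<alpha>) = A [^] fA \<otimes> C" using A_pow_C_pow[of fA 1] by simp
  also have "\<dots> = C [^] (int \<alpha> - int \<beta>) \<otimes> (C \<otimes> B [^] (g * w))" by (simp add: g(1) m_assoc BC)
  also have "\<dots> = C \<otimes> (C [^] (int \<alpha> - int \<beta>) \<otimes> B [^] (g * w))"
    using int_pow_twist[of C C C "int \<alpha> - int \<beta>"] by (simp add: m_assoc[symmetric])
  finally have "A [^] (fA * int \<alpha>) = C [^] (int \<alpha> - int \<beta>) \<otimes> B [^] (g * w)" by simp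
  then have "inv (A [^] fA) \<otimes> A [^] (fA * int \<alpha>) = inv (B [^] g) \<otimes> B [^] (g * w)"
    by (simp add: g(1) inv_mult_group m_assoc)
  then have AB': "A [^] (- fA + fA * int \<alpha>) = B [^] (- g + g * w)"
    by (simp only: int_pow_neg[symmetric] int_pow_add A B)
  let ?z = "A [^] (- fA + fA * int \<alpha>)"
  have zA: "?z \<otimes> A = A \<otimes> ?z" by (rule int_pow_twist) simp_all
  have zB: "?z \<otimes> B = B \<otimes> ?z" unfolding AB' by (rule int_pow_twist) simp_all
  have zC: "?z \<otimes> C = C \<otimes> ?z" by (rule commutes_C[OF _ zA zB]) simp
  have "C \<otimes> A [^] ((- fA + fA * int \<alpha>) * int \<alpha>) = C \<otimes> ?z"
    using A_pow_C_pow[of "- fA + fA * int \<alpha>" 1] zC by simp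
  then have "A [^] ((- fA + fA * int \<alpha>) * int \<alpha>) = ?z" by simp
  then have one: "A [^] ((- fA + fA * int \<alpha>) * int \<alpha> - (- fA + fA * int \<alpha>)) = \<one>"
    by (simp add: int_pow_diff)
  obtain y' where y': "odd y'" "fA = 2 ^ (2 * m - 1) * y'" by (rule fA_factor)
  have "(- fA + fA * int \<alpha>) * int \<alpha> - (- fA + fA * int \<alpha>) = (2 ^ m * u)\<^sup>2 * fA"
    by (simp add: alpha power2_eq_square algebra_simps)
  also have "\<dots> = (2 ^ m * 2 ^ m * 2 ^ (2 * m - 1)) * (u\<^sup>2 * y')"
    by (simp add: y' power2_eq_square algebra_simps)
  also have "(2::int) ^ m * 2 ^ m * 2 ^ (2 * m - 1) = 2 ^ (4 * m - 1)"
    using m by (simp add: power_add[symmetric])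
  finally have "(- fA + fA * int \<alpha>) * int \<alpha> - (- fA + fA * int \<alpha>) = 2 ^ (4 * m - 1) * (u\<^sup>2 * y')" .
  with one have "A [^] (2 ^ (4 * m - 1) * (u\<^sup>2 * y')) = \<one>" by (simp only:)
  then show ?thesis using pow2_odd_one[OF A torsA _ _ j] u y' by simp
qed

lemma B_pow_4m: "2 ^ (4 * m - 1) dvd j \<Longrightarrow> B [^] (j::int) = \<one>"
proof -
  interpret swap: macdonald_two G B A "inv C" \<beta> \<alpha> m L v u "- \<eta>" by (rule macdonald_two_swap)
  show "2 ^ (4 * m - 1) dvd j \<Longrightarrow> B [^] (j::int) = \<one>" by (rule swap.A_pow_4m)
qed

text \<open>C^(\<alpha>-\<beta>) multiplies exponents of B by a number that is 1 modulo 2^(3m-2); on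
  j the change is divisible by 2^(5m-3), beyond the bound of \<open>B_pow_4m\<close>.\<close>

lemma C_N_commutes_B:
  assumes "2 ^ (2 * m - 1) dvd j"
  shows "C [^] (int \<alpha> - int \<beta>) \<otimes> B [^] (j::int) = B [^] j \<otimes> C [^] (int \<alpha> - int \<beta>)"
proof -
  obtain n :: nat where n: "C [^] (int \<alpha> - int \<beta>) = C [^] n" "2 ^ (2 * m - 2) dvd n"
    using N_representative by metis
  have "C [^] n \<otimes> B [^] j = B [^] (j * int \<beta> ^ n) \<otimes> C [^] n" by (rule C_pow_B_pow)
  also have "B [^] (j * int \<beta> ^ n) = B [^] j"
  proof (rule int_pow_cong[OF B B_pow_4m])
    have "2 ^ (m + (2 * m - 2)) dvd int \<beta> ^ n - 1"
      by (rule pow2_dvd_power_minus_one) (use n m in \<open>simp_all add: beta\<close>)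
    then have "2 ^ (2 * m - 1) * 2 ^ (m + (2 * m - 2)) dvd j * (int \<beta> ^ n - 1)"
      using assms by (intro mult_dvd_mono)
    then have "2 ^ (2 * m - 1 + (m + (2 * m - 2))) dvd j * (int \<beta> ^ n - 1)" by (simp only: power_add)
    then have "2 ^ (4 * m - 1) dvd j * (int \<beta> ^ n - 1)" by (rule pow2_dvd_mono[rotated]) (use m in simp)
    then show "2 ^ (4 * m - 1) dvd j * int \<beta> ^ n - j" by (simp add: algebra_simps)
  qed simp
  finally show ?thesis by (simp add: n)
qed

text \<open>A^i is a power of A^fA = C^(\<alpha>-\<beta>) B^g, both of whose factors commute with
  B^j.\<close>

lemma A_B_commute:
  assumes "2 ^ (2 * m - 1) dvd i" "2 ^ (2 * m - 1) dvd j"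
  shows "A [^] (i::int) \<otimes> B [^] (j::int) = B [^] j \<otimes> A [^] i"
proof -
  obtain g where g: "A [^] fA = C [^] (int \<alpha> - int \<beta>) \<otimes> B [^] (g::int)" using A_pow_fA by metis
  have 1: "A [^] fA \<otimes> B [^] j = B [^] j \<otimes> A [^] fA"
  proof -
    have "A [^] fA \<otimes> B [^] j = (C [^] (int \<alpha> - int \<beta>) \<otimes> B [^] j) \<otimes> B [^] g"
      by (simp add: g m_assoc int_pow_add add.commute)
    also have "\<dots> = B [^] j \<otimes> A [^] fA" by (simp add: C_N_commutes_B[OF assms(2)] g m_assoc)
    finally show ?thesis .
  qed
  obtain y where y: "odd y" "fA = 2 ^ (2 * m - 1) * y" by (rule fA_factor)
  have "A [^] i \<in> range (\<lambda>k::int. (A [^] fA) [^] k)"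
  proof (rule pow2_odd_mem[OF int_pow_range_subgroup A torsA])
    show "A [^] (2 ^ (2 * m - 1) * y) \<in> range (\<lambda>k::int. (A [^] fA) [^] k)"
      unfolding y(2)[symmetric] by (rule range_eqI[of _ _ 1]) simp
  qed (use y assms in simp_all)
  then obtain k :: int where "A [^] i = (A [^] fA) [^] k" by blast
  then show ?thesis using int_pow_twist[OF _ _ _ 1, of k] by simp
qed

text \<open>Conjugate A^fA = C^(\<alpha>-\<beta>) B^g by B. The left side yields C^fA together with
  A^fA and a \<open>tsum\<close> correction; the right side changes only by B^(\<beta>^n - 1), where
  n represents \<alpha>-\<beta>.\<close>

lemma C_pow_fA:
  obtains h k :: int where "C [^] fA = B [^] h \<otimes> A [^] (- k)"
    "2 ^ (3 * m) dvd h - 2 ^ m * v * (int \<alpha> - int \<beta>)" "2 ^ (3 * m) dvd k - 2 ^ m * u * 2 ^ (2 * m - 2)"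
proof -
  obtain g where g: "A [^] fA = C [^] (int \<alpha> - int \<beta>) \<otimes> B [^] (g::int)" using A_pow_fA by metis
  obtain n :: nat where n: "2 ^ L dvd int n - (int \<alpha> - int \<beta>)" "C [^] (int \<alpha> - int \<beta>) = C [^] n" "2 ^ (2 * m - 2) dvd n"
    by (rule N_representative)
  obtain f :: nat where f: "2 ^ L dvd int f - fA" using nat_representative by blast
  have fAf: "A [^] fA = A [^] f" "C [^] fA = C [^] f"
    using int_pow_cong[OF A torsA f] int_pow_cong[OF C torsC f] by (simp_all add: int_pow_int)
  have "B \<otimes> (C [^] f \<otimes> A [^] (int \<alpha> * gsum (int \<alpha>) f)) = A [^] f \<otimes> B" by (rule A_pow_B[symmetric])
  also have "\<dots> = C [^] n \<otimes> B [^] g \<otimes> B [^] (1::int)" by (simp add: fAf(1)[symmetric] g n(2))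
  also have "\<dots> = (C [^] n \<otimes> B [^] (1::int)) \<otimes> B [^] g"
    by (simp only: m_assoc int_pow_add B C nat_pow_closed int_pow_closed add.commute)
  also have "\<dots> = B [^] (int \<beta> ^ n) \<otimes> A [^] fA" unfolding C_pow_B_pow by (simp add: g n(2) m_assoc)
  also have "B [^] (int \<beta> ^ n) = B \<otimes> B [^] (int \<beta> ^ n - 1)" using int_pow_add[of B 1 "int \<beta> ^ n - 1"] by simp
  finally have "C [^] f \<otimes> A [^] (int \<alpha> * gsum (int \<alpha>) f) = B [^] (int \<beta> ^ n - 1) \<otimes> A [^] int f"
    by (simp add: m_assoc fAf int_pow_int)
  then have "C [^] f \<otimes> A [^] (int \<alpha> * gsum (int \<alpha>) f) \<otimes> A [^] (- (int \<alpha> * gsum (int \<alpha>) f))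
     = B [^] (int \<beta> ^ n - 1) \<otimes> A [^] int f \<otimes> A [^] (- (int \<alpha> * gsum (int \<alpha>) f))" by simp
  then have "C [^] f = B [^] (int \<beta> ^ n - 1) \<otimes> A [^] (- tsum (int \<alpha>) f)"
    by (simp add: m_assoc int_pow_add tsum_def)
  moreover have "2 ^ (3 * m) dvd (int \<beta> ^ n - 1) - 2 ^ m * v * (int \<alpha> - int \<beta>)"
  proof -
    have "2 ^ (3 * m) dvd int \<beta> ^ n - 1 - 2 ^ m * v * int n"
      unfolding beta by (rule power_minus_one_mod[OF m _ n(3)]) simp
    moreover have "2 ^ (3 * m) dvd 2 ^ m * v * (int n - (int \<alpha> - int \<beta>))"
      by (rule dvd_mult, rule pow2_dvd_mono[OF _ n(1)]) (use L in simp)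
    ultimately have "2 ^ (3 * m) dvd (int \<beta> ^ n - 1 - 2 ^ m * v * int n) + 2 ^ m * v * (int n - (int \<alpha> - int \<beta>))"
      by (rule dvd_add)
    then show ?thesis by (simp add: algebra_simps)
  qed
  moreover have "2 ^ (3 * m) dvd tsum (int \<alpha>) f - 2 ^ m * u * 2 ^ (2 * m - 2)"
  proof -
    have "2 ^ (2 * m + 1) dvd int f - fA" by (rule pow2_dvd_mono[OF _ f]) (use L m in simp)
    from dvd_add[OF this fA_mod] have "2 ^ (2 * m + 1) dvd int f - 2 ^ (2 * m - 1)" by simp
    then show ?thesis unfolding alpha by (intro tsum_mod[OF m]) simp_all
  qed
  ultimately show thesis using that fAf by metis
qed

lemma dvd_of_mod:
  assumes "2 ^ (3 * m) dvd x - 2 ^ m * y * 2 ^ (2 * m - 2)" "k \<le> 3 * m - 2"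
  shows "(2::int) ^ k dvd x"
proof -
  have "2 ^ m * y * 2 ^ (2 * m - 2) = 2 ^ (3 * m - 2) * y"
    using m by (simp add: power_add[symmetric])
  moreover have "2 ^ (3 * m - 2) dvd x - 2 ^ m * y * 2 ^ (2 * m - 2)"
    by (rule pow2_dvd_mono[OF _ assms(1)]) simp
  ultimately have "2 ^ (3 * m - 2) dvd x" by (metis diff_add_cancel dvd_add dvd_triv_left)
  then show ?thesis using assms(2) pow2_dvd_mono by blast
qed

text \<open>C^fA is also a power of C^(\<alpha>-\<beta>) = A^fA B^-g, namely the 2e-th with e odd,
  and its two factors commute. Compared with \<open>C_pow_fA\<close>, the corrections h and k are
  divisible by 2^(2m+1), so both sides keep valuation exactly 2m.\<close>

lemma A_B_power_relation: obtains y :: int where "odd y" "A [^] (2 ^ (2 * m) :: int) = B [^] (2 ^ (2 * m) * y)"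
proof -
  obtain g z where g: "A [^] fA = C [^] (int \<alpha> - int \<beta>) \<otimes> B [^] (g::int)" "odd z" "g = 2 ^ (2 * m - 1) * z"
    by (rule A_pow_fA)
  obtain h k where hk: "C [^] fA = B [^] h \<otimes> A [^] (- k)"
    "2 ^ (3 * m) dvd h - 2 ^ m * v * (int \<alpha> - int \<beta>)" "2 ^ (3 * m) dvd k - 2 ^ m * u * 2 ^ (2 * m - 2)"
    by (rule C_pow_fA)
  have h': "2 ^ (3 * m) dvd h - 2 ^ m * (v * \<eta>) * 2 ^ (2 * m - 2)" using hk(2) by (simp add: N mult_ac)
  obtain y where y: "odd y" "fA = 2 ^ (2 * m - 1) * y" by (rule fA_factor)
  obtain w where w: "odd w" "2 ^ L dvd \<eta> * w - 1" using two_adic_inverse[OF eta] by blast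
  \<comment> \<open>The 2-adic quotient of fA by 2 (\<alpha>-\<beta>), taken modulo 2^L.\<close>
  define e where "e = y * w"
  have two: "(2::int) ^ (2 * m - 1) = 2 * 2 ^ (2 * m - 2)" "(2::int) ^ (2 * m) = 2 * 2 ^ (2 * m - 1)"
  proof -
    have "2 * m - 1 = Suc (2 * m - 2)" "2 * m = Suc (2 * m - 1)" using m by simp_all
    then show "(2::int) ^ (2 * m - 1) = 2 * 2 ^ (2 * m - 2)" "(2::int) ^ (2 * m) = 2 * 2 ^ (2 * m - 1)"
      by (metis power_Suc)+
  qed
  have "fA - (int \<alpha> - int \<beta>) * (2 * e) = 2 ^ (2 * m - 1) * y * (- (\<eta> * w - 1))"
    unfolding y N e_def two by (simp add: algebra_simps)
  then have "2 ^ L dvd fA - (int \<alpha> - int \<beta>) * (2 * e)" using w(2) by (simp only: dvd_mult dvd_minus_iff)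
  then have "C [^] fA = (C [^] (int \<alpha> - int \<beta>)) [^] (2 * e)"
    using int_pow_cong[OF C torsC] by (simp add: int_pow_pow)
  also have "C [^] (int \<alpha> - int \<beta>) = A [^] fA \<otimes> B [^] (- g)"
    by (simp add: g(1) m_assoc int_pow_add)
  also have "\<dots> [^] (2 * e) = (A [^] fA) [^] (2 * e) \<otimes> (B [^] (- g)) [^] (2 * e)"
    by (rule int_pow_mult_distrib) (simp_all add: A_B_commute y g)
  also have "\<dots> = A [^] (fA * (2 * e)) \<otimes> B [^] (- (g * (2 * e)))" by (simp add: int_pow_pow)
  finally have eq: "A [^] (fA * (2 * e)) \<otimes> B [^] (- (g * (2 * e))) = B [^] h \<otimes> A [^] (- k)" using hk(1) by simp
  have kd: "2 ^ (2 * m + 1) dvd k" by (rule dvd_of_mod[OF hk(3)]) (use m in simp)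
  have hd: "2 ^ (2 * m + 1) dvd h" by (rule dvd_of_mod[OF h']) (use m in simp)
  have "A [^] (fA * (2 * e)) \<otimes> B [^] (- (g * (2 * e))) \<otimes> A [^] k \<otimes> B [^] (g * (2 * e))
      = B [^] h \<otimes> A [^] (- k) \<otimes> A [^] k \<otimes> B [^] (g * (2 * e))" by (simp add: eq)
  moreover have "B [^] (- (g * (2 * e))) \<otimes> A [^] k = A [^] k \<otimes> B [^] (- (g * (2 * e)))"
    by (rule A_B_commute[symmetric]) (use pow2_dvd_mono[OF _ kd, of "2 * m - 1"] g in simp_all)
  ultimately have "A [^] (fA * (2 * e) + k) = B [^] (h + g * (2 * e))"
    by (simp add: m_assoc int_pow_add int_pow_add_assoc)
  moreover obtain k' where "k = 2 ^ (2 * m + 1) * k'" using kd by blast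
  then have "fA * (2 * e) + k = 2 ^ (2 * m) * (y * e + 2 * k')" using two by (simp add: y algebra_simps)
  moreover obtain h' where "h = 2 ^ (2 * m + 1) * h'" using hd by blast
  then have "h + g * (2 * e) = 2 ^ (2 * m) * (z * e + 2 * h')" using two by (simp add: g algebra_simps)
  ultimately have AB': "A [^] (2 ^ (2 * m) * (y * e + 2 * k')) = B [^] (2 ^ (2 * m) * (z * e + 2 * h'))" by simp
  have odds: "odd (y * e + 2 * k')" "odd (z * e + 2 * h')" using y g w by (simp_all add: e_def)
  obtain w' where w': "odd w'" "2 ^ L dvd (y * e + 2 * k') * w' - 1" using two_adic_inverse[OF odds(1)] by blast
  have "A [^] (2 ^ (2 * m) :: int) = A [^] (2 ^ (2 * m) * (y * e + 2 * k') * w')"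
  proof (rule int_pow_cong[OF A torsA, symmetric])
    have "2 ^ (2 * m) * (y * e + 2 * k') * w' - 2 ^ (2 * m) = 2 ^ (2 * m) * ((y * e + 2 * k') * w' - 1)"
      by (simp add: algebra_simps)
    then show "2 ^ L dvd 2 ^ (2 * m) * (y * e + 2 * k') * w' - 2 ^ (2 * m)" using w'(2) by (simp only: dvd_mult)
  qed
  also have "\<dots> = (A [^] (2 ^ (2 * m) * (y * e + 2 * k'))) [^] w'" by (simp only: int_pow_pow A)
  also have "\<dots> = B [^] (2 ^ (2 * m) * ((z * e + 2 * h') * w'))" by (simp only: AB' int_pow_pow B mult.assoc)
  finally show thesis using that[of "(z * e + 2 * h') * w'"] odds w' by simp
qed

lemma A_2m_commutes_B: "2 ^ (2 * m) dvd j \<Longrightarrow> A [^] (j::int) \<otimes> B = B \<otimes> A [^] j"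
proof -
  assume "2 ^ (2 * m) dvd j"
  then obtain k where k: "j = 2 ^ (2 * m) * k" by blast
  obtain y :: int where y: "A [^] (2 ^ (2 * m) :: int) = B [^] (2 ^ (2 * m) * y)" using A_B_power_relation by metis
  have "A [^] j = B [^] (2 ^ (2 * m) * y * k)" by (simp only: k int_pow_pow[symmetric] A B y)
  then show ?thesis by (simp only:) (rule int_pow_twist, simp_all)
qed

lemma A_2m_commutes_C: "2 ^ (2 * m) dvd j \<Longrightarrow> A [^] (j::int) \<otimes> C = C \<otimes> A [^] j"
  by (rule commutes_C[OF _ _ A_2m_commutes_B]) (simp_all add: int_pow_twist[of A A A])

text \<open>A^(2^(2m)), being also a power of B, commutes with C, which raises it to the power
  \<alpha>; hence its (\<alpha>-1)-st power is trivial.\<close>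

lemma A_pow_3m: "2 ^ (3 * m) dvd j \<Longrightarrow> A [^] (j::int) = \<one>"
proof -
  assume j: "2 ^ (3 * m) dvd j"
  have "C \<otimes> A [^] (2 ^ (2 * m) * int \<alpha>) = C \<otimes> A [^] (2 ^ (2 * m) :: int)"
    using A_pow_C_pow[of "2 ^ (2 * m)" 1] A_2m_commutes_C[of "2 ^ (2 * m)"] by simp
  then have "A [^] (2 ^ (2 * m) * int \<alpha>) = A [^] (2 ^ (2 * m) :: int)" by simp
  then have "A [^] (2 ^ (2 * m) * int \<alpha> - 2 ^ (2 * m)) = \<one>" by (simp add: int_pow_diff)
  moreover have "2 ^ (2 * m) * int \<alpha> - 2 ^ (2 * m) = 2 ^ (3 * m) * u"
    by (simp add: alpha algebra_simps power_add[symmetric])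
  ultimately have "A [^] (2 ^ (3 * m) * u) = \<one>" by (simp only:)
  then show ?thesis using pow2_odd_one[OF A torsA _ u j] by simp
qed

lemma B_pow_3m: "2 ^ (3 * m) dvd j \<Longrightarrow> B [^] (j::int) = \<one>"
proof -
  interpret swap: macdonald_two G B A "inv C" \<beta> \<alpha> m L v u "- \<eta>" by (rule macdonald_two_swap)
  show "2 ^ (3 * m) dvd j \<Longrightarrow> B [^] (j::int) = \<one>" by (rule swap.A_pow_3m)
qed

text \<open>In the fourth power of \<open>C_pow_fA\<close> both exponents are multiples of 2^(3m),
  so C^(4 fA) is trivial. As fA is 2^(2m-1) modulo 2^(2m+1), it may then be replaced by
  2^(2m-1).\<close>

lemma C_pow_half:
  obtains h k :: int where "C [^] (2 ^ (2 * m - 1) :: int) = B [^] h \<otimes> A [^] (- k)"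
    "2 ^ (3 * m) dvd h - 2 ^ m * v * (int \<alpha> - int \<beta>)" "2 ^ (3 * m) dvd k - 2 ^ m * u * 2 ^ (2 * m - 2)"
    "C [^] (2 ^ (2 * m + 1) :: int) = \<one>"
proof -
  obtain h k where hk: "C [^] fA = B [^] h \<otimes> A [^] (- k)"
    "2 ^ (3 * m) dvd h - 2 ^ m * v * (int \<alpha> - int \<beta>)" "2 ^ (3 * m) dvd k - 2 ^ m * u * 2 ^ (2 * m - 2)"
    by (rule C_pow_fA)
  have h': "2 ^ (3 * m) dvd h - 2 ^ m * (v * \<eta>) * 2 ^ (2 * m - 2)" using hk(2) by (simp add: N mult_ac)
  have h2: "2 ^ (3 * m - 2) dvd h" and k2: "2 ^ (3 * m - 2) dvd k" using dvd_of_mod[OF h'] dvd_of_mod[OF hk(3)] by simp_all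
  have e: "2 * m - 1 \<le> 3 * m - 2" "2 ^ (3 * m) = (4::int) * 2 ^ (3 * m - 2)"
    using m pow2_3m by simp_all
  have "(C [^] fA) [^] (4::int) = (B [^] h) [^] (4::int) \<otimes> (A [^] (- k)) [^] (4::int)"
    unfolding hk(1)
    by (rule int_pow_mult_distrib)
      (use pow2_dvd_mono[OF e(1) h2] pow2_dvd_mono[OF e(1) k2] in \<open>simp_all add: A_B_commute\<close>)
  also have "(B [^] h) [^] (4::int) = \<one>" unfolding int_pow_pow[OF B]
    by (rule B_pow_3m) (simp only: pow2_3m(1) mult_dvd_mono[OF h2 dvd_refl])
  also have "(A [^] (- k)) [^] (4::int) = \<one>" unfolding int_pow_pow[OF A]
    by (rule A_pow_3m) (simp only: pow2_3m(1) mult_dvd_mono[OF _ dvd_refl] dvd_minus_iff k2)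
  finally have C4: "C [^] (fA * 4) = \<one>" by (simp add: int_pow_pow)
  obtain y where y: "odd y" "fA = 2 ^ (2 * m - 1) * y" by (rule fA_factor)
  have "fA * 4 = 2 ^ (2 * m + 1) * y"
    using m power_add[of "2::int" 2 "2 * m - 1"] by (simp add: y)
  with C4 have "C [^] (2 ^ (2 * m + 1) * y) = \<one>" by (simp only:)
  then have C_one: "C [^] (2 ^ (2 * m + 1) :: int) = \<one>" by (rule pow2_odd_one[OF C torsC _ y(1)]) (rule dvd_refl)
  have "C [^] (2 ^ (2 * m - 1) :: int) = C [^] fA" by (rule int_pow_cong[OF C C_one fA_mod, symmetric])
  then show thesis using that hk C_one by simp
qed

text \<open>\<open>C_pow_half\<close> and its mirror image describe inverse elements. Multiplying
  them gives A^(-2^(3m-2) u (\<eta>+1)) = B^(2^(3m-2) v (1-\<eta>)). For odd \<eta> one of \<eta>+1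
  and 1-\<eta> is divisible by 4, which makes that side trivial, and the other is twice an odd
  number. \<open>A_B_power_relation\<close> carries the bound to the other generator.\<close>

lemma A_B_order_half: "A [^] (2 ^ (3 * m - 1) :: int) = \<one> \<and> B [^] (2 ^ (3 * m - 1) :: int) = \<one>"
proof -
  interpret swap: macdonald_two G B A "inv C" \<beta> \<alpha> m L v u "- \<eta>" by (rule macdonald_two_swap)
  obtain h k where hk: "C [^] (2 ^ (2 * m - 1) :: int) = B [^] h \<otimes> A [^] (- k)"
    "2 ^ (3 * m) dvd h - 2 ^ m * v * (int \<alpha> - int \<beta>)" "2 ^ (3 * m) dvd k - 2 ^ m * u * 2 ^ (2 * m - 2)"
    using C_pow_half by metis
  obtain h' k' where hk': "inv C [^] (2 ^ (2 * m - 1) :: int) = A [^] h' \<otimes> B [^] (- k')"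
    "2 ^ (3 * m) dvd h' - 2 ^ m * u * (int \<beta> - int \<alpha>)" "2 ^ (3 * m) dvd k' - 2 ^ m * v * 2 ^ (2 * m - 2)"
    using swap.C_pow_half by metis
  have "B [^] h \<otimes> A [^] (- k) \<otimes> (A [^] h' \<otimes> B [^] (- k')) = \<one>"
    unfolding hk(1)[symmetric] hk'(1)[symmetric] by (simp add: int_pow_inv)
  then have "B [^] (- h) \<otimes> (B [^] h \<otimes> A [^] (- k) \<otimes> (A [^] h' \<otimes> B [^] (- k'))) \<otimes> B [^] k' = B [^] (- h) \<otimes> \<one> \<otimes> B [^] k'"
    by simp
  then have eq: "A [^] (h' - k) = B [^] (k' - h)"
    by (simp add: m_assoc int_pow_add int_pow_add_assoc)
  have p: "(2::int) ^ m * 2 ^ (2 * m - 2) = 2 ^ (3 * m - 2)" "(2::int) ^ (3 * m) = 2 ^ (3 * m - 2) * 4"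
    "(2::int) ^ (3 * m - 1) = 2 ^ (3 * m - 2) * 2"
    using m pow2_3m by (simp_all add: power_add[symmetric])
  have "2 ^ (3 * m) dvd (h' - 2 ^ m * u * (int \<beta> - int \<alpha>)) - (k - 2 ^ m * u * 2 ^ (2 * m - 2))"
    using hk'(2) hk(3) by (rule dvd_diff)
  moreover have "int \<beta> - int \<alpha> = 2 ^ (2 * m - 2) * (- \<eta>)" using N by simp
  ultimately have "2 ^ (3 * m) dvd (h' - k) - (- (2 ^ m * 2 ^ (2 * m - 2)) * (u * (\<eta> + 1)))"
    by (simp only:) (simp add: algebra_simps)
  then have "A [^] (h' - k) = A [^] (- (2 ^ m * 2 ^ (2 * m - 2)) * (u * (\<eta> + 1)))"
    by (rule int_pow_cong[OF A A_pow_3m[OF dvd_refl]])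
  then have A1: "A [^] (h' - k) = A [^] (2 ^ (3 * m - 2) * (- u * (\<eta> + 1)))" unfolding p by simp
  have "2 ^ (3 * m) dvd (k' - 2 ^ m * v * 2 ^ (2 * m - 2)) - (h - 2 ^ m * v * (int \<alpha> - int \<beta>))"
    using hk'(3) hk(2) by (rule dvd_diff)
  then have "2 ^ (3 * m) dvd (k' - h) - ((2 ^ m * 2 ^ (2 * m - 2)) * (v * (1 - \<eta>)))"
    unfolding N by (simp add: algebra_simps)
  then have "B [^] (k' - h) = B [^] ((2 ^ m * 2 ^ (2 * m - 2)) * (v * (1 - \<eta>)))"
    by (rule int_pow_cong[OF B B_pow_3m[OF dvd_refl]])
  then have B1: "B [^] (k' - h) = B [^] (2 ^ (3 * m - 2) * (v * (1 - \<eta>)))" unfolding p by simp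
  have eq2: "A [^] (2 ^ (3 * m - 2) * (- u * (\<eta> + 1))) = B [^] (2 ^ (3 * m - 2) * (v * (1 - \<eta>)))"
    using eq A1 B1 by simp
  obtain y :: int where y: "odd y" "A [^] (2 ^ (2 * m) :: int) = B [^] (2 ^ (2 * m) * y)"
    by (rule A_B_power_relation)
  have "(2::int) ^ (2 * m) * 2 ^ (m - 1) = 2 ^ (3 * m - 1)" using m by (simp add: power_add[symmetric])
  then have "A [^] (2 ^ (3 * m - 1) :: int) = (A [^] (2 ^ (2 * m) :: int)) [^] (2 ^ (m - 1) :: int)"
    by (simp add: int_pow_pow)
  also have "\<dots> = B [^] (2 ^ (2 * m) * 2 ^ (m - 1) * y)" unfolding y by (simp add: int_pow_pow mult_ac)
  also have "(2::int) ^ (2 * m) * 2 ^ (m - 1) = 2 ^ (3 * m - 1)" using m by (simp add: power_add[symmetric])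
  finally have AB': "A [^] (2 ^ (3 * m - 1) :: int) = B [^] (2 ^ (3 * m - 1) * y)" .
  obtain r where "\<eta> = 2 * r + 1" using eta by (rule oddE)
  then consider s where "odd s" "\<eta> + 1 = 2 * s" "4 dvd 1 - \<eta>" | s where "odd s" "1 - \<eta> = 2 * s" "4 dvd \<eta> + 1"
  proof (cases "even r")
    case True
    then obtain q where "r = 2 * q" by blast
    then show ?thesis using that(1)[of "r + 1"] \<open>\<eta> = 2 * r + 1\<close> by simp
  next
    case False
    then obtain q where "r = 2 * q + 1" by (rule oddE)
    then show ?thesis using that(2)[of "- r"] \<open>\<eta> = 2 * r + 1\<close> by simp
  qed
  then show ?thesis
  proof cases
    case 1
    have "2 ^ (3 * m) dvd 2 ^ (3 * m - 2) * (v * (1 - \<eta>))" unfolding p using 1(3) by simp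
    from eq2[unfolded B_pow_3m[OF this]] have "A [^] (2 ^ (3 * m - 2) * (- u * (\<eta> + 1))) = \<one>" .
    moreover have "2 ^ (3 * m - 2) * (- u * (\<eta> + 1)) = 2 ^ (3 * m - 1) * (- u * s)" unfolding p by (simp add: 1)
    ultimately have "A [^] (2 ^ (3 * m - 1) * (- u * s)) = \<one>" by (simp only:)
    then have A2: "A [^] (2 ^ (3 * m - 1) :: int) = \<one>"
      by (rule pow2_odd_one[OF A torsA]) (use u 1(1) in simp_all)
    then have "B [^] (2 ^ (3 * m - 1) * y) = \<one>" using AB' by simp
    then show ?thesis using A2 pow2_odd_one[OF B torsB _ y(1)] by simp
  next
    case 2
    have "2 ^ (3 * m) dvd 2 ^ (3 * m - 2) * (- u * (\<eta> + 1))" unfolding p using 2(3) by simp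
    from eq2[unfolded A_pow_3m[OF this]] have "B [^] (2 ^ (3 * m - 2) * (v * (1 - \<eta>))) = \<one>" by simp
    moreover have "2 ^ (3 * m - 2) * (v * (1 - \<eta>)) = 2 ^ (3 * m - 1) * (v * s)" unfolding p by (simp add: 2)
    ultimately have "B [^] (2 ^ (3 * m - 1) * (v * s)) = \<one>" by (simp only:)
    then have B2: "B [^] (2 ^ (3 * m - 1) :: int) = \<one>"
      by (rule pow2_odd_one[OF B torsB]) (use v 2(1) in simp_all)
    then have "B [^] (2 ^ (3 * m - 1) * y) = \<one>" by (simp only: int_pow_pow[symmetric] B int_pow_one)
    then show ?thesis using B2 AB' by simp
  qed
qed

lemma A_pow_order: "2 ^ (3 * m - 1) dvd j \<Longrightarrow> A [^] (j::int) = \<one>"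
  and B_pow_order: "2 ^ (3 * m - 1) dvd j \<Longrightarrow> B [^] (j::int) = \<one>"
  using A_B_order_half int_pow_eq_one_mult[OF A] int_pow_eq_one_mult[OF B] by blast+

text \<open>Both elements have order at most 2 by now, so the odd exponent y of
  \<open>A_B_power_relation\<close> disappears.\<close>

lemma A_B_top_power: "A [^] (2 ^ (3 * m - 2) :: int) = B [^] (2 ^ (3 * m - 2) :: int)"
proof -
  obtain y :: int where y: "odd y" "A [^] (2 ^ (2 * m) :: int) = B [^] (2 ^ (2 * m) * y)"
    by (rule A_B_power_relation)
  have p: "(2::int) ^ (2 * m) * 2 ^ (m - 2) = 2 ^ (3 * m - 2)" "(2::int) ^ (3 * m - 1) = 2 ^ (3 * m - 2) * 2"
    using m pow2_3m by (simp_all add: power_add[symmetric])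
  have "A [^] (2 ^ (3 * m - 2) :: int) = (A [^] (2 ^ (2 * m) :: int)) [^] (2 ^ (m - 2) :: int)"
    by (simp only: int_pow_pow A p)
  also have "\<dots> = B [^] (2 ^ (2 * m) * 2 ^ (m - 2) * y)" unfolding y by (simp add: int_pow_pow mult_ac)
  also have "\<dots> = B [^] (2 ^ (3 * m - 2) :: int)" unfolding p
  proof (rule int_pow_cong[OF B B_pow_order])
    have "2 ^ (3 * m - 2) * y - 2 ^ (3 * m - 2) = 2 ^ (3 * m - 2) * (y - 1)" by (simp add: algebra_simps)
    then show "2 ^ (3 * m - 1) dvd 2 ^ (3 * m - 2) * y - 2 ^ (3 * m - 2)" unfolding p using y(1) by simp
  qed simp
  finally show ?thesis .
qed

text \<open>As u, v and \<eta> are odd, both exponents in \<open>C_pow_half\<close> are 2^(3m-2)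
  modulo 2^(3m-1); the two factors cancel by \<open>A_B_top_power\<close>.\<close>

lemma C_pow_order: "2 ^ (2 * m - 1) dvd j \<Longrightarrow> C [^] (j::int) = \<one>"
proof -
  obtain h k where hk: "C [^] (2 ^ (2 * m - 1) :: int) = B [^] h \<otimes> A [^] (- k)"
    "2 ^ (3 * m) dvd h - 2 ^ m * v * (int \<alpha> - int \<beta>)" "2 ^ (3 * m) dvd k - 2 ^ m * u * 2 ^ (2 * m - 2)"
    using C_pow_half by metis
  have p: "(2::int) ^ m * 2 ^ (2 * m - 2) = 2 ^ (3 * m - 2)" "(2::int) ^ (3 * m - 1) = 2 ^ (3 * m - 2) * 2"
    using m pow2_3m by (simp_all add: power_add[symmetric])
  have "2 ^ (3 * m - 1) dvd h - 2 ^ m * v * (int \<alpha> - int \<beta>)" "2 ^ (3 * m - 1) dvd k - 2 ^ m * u * 2 ^ (2 * m - 2)"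
    using hk(2,3) pow2_dvd_mono[of "3 * m - 1" "3 * m"] by simp_all
  moreover have "2 ^ m * v * (int \<alpha> - int \<beta>) = 2 ^ (3 * m - 2) * (v * \<eta>)" unfolding N p(1)[symmetric] by (simp add: mult_ac)
  moreover have "2 ^ m * u * 2 ^ (2 * m - 2) = 2 ^ (3 * m - 2) * u" unfolding p(1)[symmetric] by (simp add: mult_ac)
  ultimately have d: "2 ^ (3 * m - 1) dvd h - 2 ^ (3 * m - 2) * (v * \<eta>)" "2 ^ (3 * m - 1) dvd k - 2 ^ (3 * m - 2) * u"
    by simp_all
  have "2 ^ (3 * m - 1) dvd 2 ^ (3 * m - 2) * (v * \<eta> - 1)" "2 ^ (3 * m - 1) dvd 2 ^ (3 * m - 2) * (u - 1)"
    unfolding p(2) using u v eta by simp_all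
  from dvd_add[OF d(1) this(1)] dvd_add[OF d(2) this(2)]
  have "2 ^ (3 * m - 1) dvd h - 2 ^ (3 * m - 2)" "2 ^ (3 * m - 1) dvd k - 2 ^ (3 * m - 2)"
    by (simp_all add: algebra_simps)
  then have "B [^] h = B [^] (2 ^ (3 * m - 2) :: int)" "A [^] k = A [^] (2 ^ (3 * m - 2) :: int)"
    using int_pow_cong[OF B B_pow_order[OF dvd_refl]] int_pow_cong[OF A A_pow_order[OF dvd_refl]] by blast+
  then have "C [^] (2 ^ (2 * m - 1) :: int) = \<one>" using hk(1) by (simp add: int_pow_neg A_B_top_power)
  then show "2 ^ (2 * m - 1) dvd j \<Longrightarrow> C [^] (j::int) = \<one>" using int_pow_eq_one_mult[OF C] by blast
qed

end

section \<open>A model of the coset space\<close>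

text \<open>The binomial polynomials (x choose 2) and (x choose 3), for negative x as well.\<close>

definition P2 :: "int \<Rightarrow> int" where "P2 x = x * (x - 1) div 2"
definition P3 :: "int \<Rightarrow> int" where "P3 x = x * (x - 1) * (x - 2) div 6"

lemma P2: "2 * P2 x = x * (x - 1)"
  unfolding P2_def by (rule dvd_mult_div_cancel) simp

lemma P3_6: "6 * P3 x = x * (x - 1) * (x - 2)"
proof -
  have "2 dvd x * (x - 1) * (x - 2)" by simp
  moreover have "3 dvd x * (x - 1) * (x - 2)"
  proof -
    have "x mod 3 = 0 \<or> x mod 3 = 1 \<or> x mod 3 = 2" by presburger
    then have "3 dvd x \<or> 3 dvd x - 1 \<or> 3 dvd x - 2" by presburger
    then show ?thesis by (auto intro: dvd_mult dvd_mult2)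
  qed
  ultimately have "2 * 3 dvd x * (x - 1) * (x - 2)" by (intro divides_mult) simp_all
  then show ?thesis unfolding P3_def by (intro dvd_mult_div_cancel) simp
qed

lemma P3: "3 * P3 x = P2 x * (x - 2)"
proof -
  have "2 * (3 * P3 x) = (2 * P2 x) * (x - 2)" by (simp add: P2 P3_6[simplified])
  then show ?thesis by simp
qed

lemma P2_add: "P2 (x + h) = P2 x + x * h + P2 h"
proof -
  have "2 * P2 (x + h) = 2 * (P2 x + x * h + P2 h)"
    unfolding distrib_left P2 by (simp add: algebra_simps)
  then show ?thesis by simp
qed

lemma P3_add: "P3 (x + h) = P3 x + P2 x * h + x * P2 h + P3 h"
proof -
  have "6 * P3 (x + h) = 6 * P3 x + 3 * ((2 * P2 x) * h + x * (2 * P2 h)) + 6 * P3 h"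
    unfolding P3_6 P2 by (simp add: algebra_simps)
  then show ?thesis by (simp add: algebra_simps)
qed

lemma P2_even: "P2 (2 * y) = y * (2 * y - 1)"
  using P2[of "2 * y"] by (simp add: algebra_simps)

lemma P2_0 [simp]: "P2 0 = 0" and P3_0 [simp]: "P3 0 = 0"
  by (simp_all add: P2_def P3_def)

text \<open>Here \<open>8 * p = 2 ^ m\<close>, \<open>\<alpha> = 1 + 8 * p * u\<close>, \<open>\<beta> = 1 + 8 * p * v\<close>, and \<open>1 + 8 * p * t\<close> is an inverse of \<open>\<alpha>\<close>
  modulo \<open>2 ^ (3 * m - 1) = 256 * p ^ 3\<close>. A pair \<open>(x, j)\<close> stands for the coset \<open>a\<^sup>x b\<^sup>j \<langle>c\<rangle>\<close>.\<close>
locale macdonald_model =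
  fixes p u v t \<eta> \<rho> :: int and \<beta> :: nat
  assumes p: "\<exists>k. p = 2 ^ k"
    and odd_u: "odd u" and odd_v: "odd v" and odd_t: "odd t" and odd_eta: "odd \<eta>"
    and t: "u + t + 8 * p * u * t = 32 * p\<^sup>2 * \<rho>"
    and uv: "u - v = 2 * p * \<eta>"
    and beta: "int \<beta> = 1 + 8 * p * v"
begin

abbreviation q :: int where "q \<equiv> 256 * p ^ 3"

text \<open>\<open>gfun x\<close> truncates ((1 + 8pt)^x - 1) / (8pt), the exponent of a in (a c)^x
  = a^G c^x, and \<open>efun x\<close> truncates \<beta>^x. The omitted terms contain (8p)^3 = 512
  p^3 and vanish modulo q.\<close>

definition gfun :: "int \<Rightarrow> int" where
  "gfun x = x + 8 * p * t * P2 x + 64 * p\<^sup>2 * t\<^sup>2 * P3 x"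

definition efun :: "int \<Rightarrow> int" where
  "efun x = 1 + 8 * p * v * x + 64 * p\<^sup>2 * v\<^sup>2 * P2 x"

lemma p_pos: "p > 0" using p by auto

lemma dvd_P3: "4 * p dvd P2 h \<Longrightarrow> 4 * p dvd P3 h"
proof -
  assume "4 * p dvd P2 h"
  then have "4 * p dvd 3 * P3 h" unfolding P3 by simp
  moreover obtain k where "p = 2 ^ k" using p by blast
  then have "4 * p = 2 ^ (k + 2)" by simp
  then have "coprime (4 * p) 3" by (simp only: coprime_power_left_iff) simp
  ultimately show ?thesis by (simp add: coprime_dvd_mult_right_iff)
qed

lemma dvd_P_mult: "4 * p dvd P2 (8 * p * h)" "4 * p dvd P3 (8 * p * h)"
proof -
  have "P2 (8 * p * h) = 4 * p * (h * (8 * p * h - 1))"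
    using P2_even[of "4 * p * h"] by (simp add: algebra_simps)
  then show "4 * p dvd P2 (8 * p * h)" by simp
  then show "4 * p dvd P3 (8 * p * h)" by (rule dvd_P3)
qed

lemma efun_shift: "q dvd efun (x + 32 * p\<^sup>2 * h) - efun x"
proof -
  have P2h: "P2 (32 * p\<^sup>2 * h) = 16 * p\<^sup>2 * h * (32 * p\<^sup>2 * h - 1)"
    using P2_even[of "16 * p\<^sup>2 * h"] by (simp add: algebra_simps)
  have "efun (x + 32 * p\<^sup>2 * h) - efun x
     = q * (v * h + 4 * p * v\<^sup>2 * (2 * x * h + h * (32 * p\<^sup>2 * h - 1)))"
    unfolding efun_def P2_add P2h by (simp add: algebra_simps power2_eq_square power3_eq_cube)
  then show ?thesis by (simp only: dvd_triv_left)
qed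

lemma efun_eighth: "q dvd efun (x + 8 * p * h) - (efun x + 64 * p\<^sup>2 * v * h)"
proof -
  obtain c where c: "P2 (8 * p * h) = 4 * p * c" using dvd_P_mult by blast
  have "efun (x + 8 * p * h) - (efun x + 64 * p\<^sup>2 * v * h) = q * (v\<^sup>2 * (2 * x * h + c))"
    unfolding efun_def P2_add c by (simp add: algebra_simps power2_eq_square power3_eq_cube)
  then show ?thesis by (simp only: dvd_triv_left)
qed

lemma efun_add: "q dvd efun x * efun y - efun (x + y)"
proof -
  have "efun x * efun y - efun (x + y)
    = q * (2 * v ^ 3 * (x * P2 y + y * P2 x) + 16 * p * v ^ 4 * P2 x * P2 y)"
    unfolding efun_def P2_add by (simp add: algebra_simps power2_eq_square power3_eq_cube power4_eq_xxxx)
  then show ?thesis by (simp only: dvd_triv_left)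
qed

lemma gfun_shift:
  "q dvd gfun (x + 32 * p\<^sup>2 * h) - (gfun x + 32 * p\<^sup>2 * h + 128 * p ^ 3 * h)"
proof -
  have P2h: "P2 (32 * p\<^sup>2 * h) = 16 * p\<^sup>2 * h * (32 * p\<^sup>2 * h - 1)"
    using P2_even[of "16 * p\<^sup>2 * h"] by (simp add: algebra_simps)
  obtain c where c: "P3 (32 * p\<^sup>2 * h) = 4 * p * c"
  proof -
    have "8 * p * (4 * p * h) = 32 * p\<^sup>2 * h" by (simp add: power2_eq_square)
    then show thesis using that dvd_P_mult(2)[of "4 * p * h"] by (metis dvdE)
  qed
  \<comment> \<open>The shift contributes -128 p^3 t h, which is 128 p^3 h modulo q because t is
    odd.\<close>
  have "even (t + 1)" using odd_t by simp
  then obtain t' where t': "t + 1 = 2 * t'" by blast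
  have "gfun (x + 32 * p\<^sup>2 * h) - (gfun x + 32 * p\<^sup>2 * h + 128 * p ^ 3 * h)
    = q * (t * h * (x + 16 * p\<^sup>2 * h) + t\<^sup>2 * (8 * p * P2 x * h + 4 * p * x * h * (32 * p\<^sup>2 * h - 1) + c))
      - 128 * p ^ 3 * h * (t + 1)"
    unfolding gfun_def P2_add P3_add P2h c by (simp add: algebra_simps power2_eq_square power3_eq_cube)
  also have "\<dots> = q * (t * h * (x + 16 * p\<^sup>2 * h) + t\<^sup>2 * (8 * p * P2 x * h + 4 * p * x * h * (32 * p\<^sup>2 * h - 1) + c) - h * t')"
    unfolding t' by (simp add: algebra_simps)
  finally show ?thesis by (simp only: dvd_triv_left)
qed

lemma gfun_eighth: "q dvd gfun (x + 8 * p * h) - (gfun x + 8 * p * h + 32 * p\<^sup>2 * t * (2 * x - 1) * h)"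
proof -
  have P2h: "P2 (8 * p * h) = 4 * p * (h * (8 * p * h - 1))"
    using P2_even[of "4 * p * h"] by (simp add: algebra_simps)
  obtain c where c: "P3 (8 * p * h) = 4 * p * c" using dvd_P_mult by blast
  have "gfun (x + 8 * p * h) - (gfun x + 8 * p * h + 32 * p\<^sup>2 * t * (2 * x - 1) * h)
     = q * (t * h\<^sup>2 + t\<^sup>2 * (2 * P2 x * h + x * (h * (8 * p * h - 1)) + c))"
    unfolding gfun_def P2_add P3_add P2h c by (simp add: algebra_simps power2_eq_square power3_eq_cube)
  then show ?thesis by (simp only: dvd_triv_left)
qed

text \<open>Closed forms for iterates of b^-1: \<open>xit n x\<close> iterates \<open>gfun\<close>,
  \<open>sit n x\<close> is the sum of the first n iterates modulo 32 p^2 (a period of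
  \<open>efun\<close>), and \<open>kit n x\<close> accumulates the -1 of each step. Polynomials in n
  are used because both \<beta> and the full period are substituted for n.\<close>

definition xit :: "int \<Rightarrow> int \<Rightarrow> int" where
  "xit n x = x + 8 * p * t * n * P2 x + 64 * p\<^sup>2 * t\<^sup>2 * n * P3 x
    + 32 * p\<^sup>2 * t\<^sup>2 * P2 n * (2 * x - 1) * P2 x + 128 * p ^ 3 * P3 n * P2 x"

definition sit :: "int \<Rightarrow> int \<Rightarrow> int" where
  "sit n x = n * x + 8 * p * t * P2 n * P2 x"

definition kit :: "int \<Rightarrow> int \<Rightarrow> int" where
  "kit n x = n + 8 * p * v * x * P2 (n + 1) + 128 * p\<^sup>2 * v * t * P2 x * P3 (n + 1)
    + 64 * p\<^sup>2 * v\<^sup>2 * (x\<^sup>2 * P3 (n + 1) + P2 x * P2 (n + 1))"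

lemma P2_Suc: "P2 (n + 1) = P2 n + n" and P3_Suc: "P3 (n + 1) = P3 n + P2 n"
  by (simp_all add: P2_add P3_add, simp_all add: P2_def P3_def)

lemma xit_step: "[gfun (xit n x) = xit (n + 1) x] (mod q)"
proof -
  define h where "h = t * n * P2 x + 8 * p * t\<^sup>2 * n * P3 x + 4 * p * t\<^sup>2 * P2 n * (2 * x - 1) * P2 x + 16 * p\<^sup>2 * P3 n * P2 x"
  have x: "xit n x = x + 8 * p * h"
    unfolding xit_def h_def by (simp add: algebra_simps power2_eq_square power3_eq_cube)
  \<comment> \<open>Modulo q an odd coefficient of 128 p^3 may be replaced by 1; this produces the
    last term of \<open>xit\<close>.\<close>
  have "odd (t ^ 3 * (2 * x - 1)\<^sup>2)" using odd_t by simp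
  then obtain s where s: "t ^ 3 * (2 * x - 1)\<^sup>2 = 2 * s + 1" by (rule oddE)
  have "32 * p\<^sup>2 * t * (2 * x - 1) * h = 32 * p\<^sup>2 * t\<^sup>2 * n * (2 * x - 1) * P2 x
     + 128 * p ^ 3 * (t ^ 3 * (2 * x - 1)\<^sup>2) * P2 n * P2 x
     + q * (t ^ 3 * (2 * x - 1) * n * P3 x + 2 * p * t * (2 * x - 1) * P3 n * P2 x)"
    unfolding h_def by (simp add: algebra_simps power2_eq_square power3_eq_cube)
  then have "gfun x + 8 * p * h + 32 * p\<^sup>2 * t * (2 * x - 1) * h - xit (n + 1) x
     = q * (s * P2 n * P2 x + (t ^ 3 * (2 * x - 1) * n * P3 x + 2 * p * t * (2 * x - 1) * P3 n * P2 x))"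
    unfolding s unfolding xit_def h_def gfun_def P2_Suc P3_Suc
    by (simp add: algebra_simps power2_eq_square power3_eq_cube)
  then have "[gfun x + 8 * p * h + 32 * p\<^sup>2 * t * (2 * x - 1) * h = xit (n + 1) x] (mod q)"
    by (simp only: cong_iff_dvd_diff dvd_triv_left)
  moreover have "[gfun (xit n x) = gfun x + 8 * p * h + 32 * p\<^sup>2 * t * (2 * x - 1) * h] (mod q)"
    unfolding x cong_iff_dvd_diff by (rule gfun_eighth)
  ultimately show ?thesis using cong_trans by blast
qed

lemma jit_step: "[efun (xit n x) * (efun (sit n x) * j - kit n x - 1) = efun (sit (n + 1) x) * j - kit (n + 1) x] (mod q)"
proof -
  define w where "w = 2 * t\<^sup>2 * n * P3 x + t\<^sup>2 * P2 n * (2 * x - 1) * P2 x + 4 * p * P3 n * P2 x"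
  have x: "xit n x = x + 8 * p * (t * n * P2 x) + 32 * p\<^sup>2 * w"
    unfolding xit_def w_def by (simp add: algebra_simps power2_eq_square power3_eq_cube)
  have "xit n x + sit n x = sit (n + 1) x + 32 * p\<^sup>2 * w"
    unfolding x sit_def P2_Suc by (simp add: algebra_simps)
  then have "[efun (xit n x + sit n x) = efun (sit (n + 1) x)] (mod q)"
    unfolding cong_iff_dvd_diff using efun_shift by simp
  moreover have "[efun (xit n x) * efun (sit n x) = efun (xit n x + sit n x)] (mod q)"
    unfolding cong_iff_dvd_diff by (rule efun_add)
  ultimately have 1: "[efun (xit n x) * efun (sit n x) = efun (sit (n + 1) x)] (mod q)"
    using cong_trans by blast
  define e where "e = efun x + 64 * p\<^sup>2 * v * (t * n * P2 x)"
  have "[efun (xit n x) = efun (x + 8 * p * (t * n * P2 x))] (mod q)"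
    unfolding x cong_iff_dvd_diff by (rule efun_shift)
  moreover have "[efun (x + 8 * p * (t * n * P2 x)) = e] (mod q)"
    unfolding cong_iff_dvd_diff e_def by (rule efun_eighth)
  ultimately have "[efun (xit n x) = e] (mod q)" using cong_trans by blast
  then have 2: "[efun (xit n x) * (kit n x + 1) = e * (kit n x + 1)] (mod q)" by (rule cong_scalar_right)
  define c2 c3 where "c2 = P2 (n + 1)" and "c3 = P3 (n + 1)"
  have c2: "2 * c2 = (n + 1) * n" unfolding c2_def P2 by simp
  have c': "P2 (n + 1 + 1) = c2 + (n + 1)" "P3 (n + 1 + 1) = c3 + c2"
    unfolding c2_def c3_def by (simp_all only: P2_Suc P3_Suc)
  define y where "y = P2 x"
  define k2 where "k2 = 2 * v * t * y * c3 + v\<^sup>2 * (x\<^sup>2 * c3 + y * c2)"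
  have k: "kit n x = n + 8 * p * v * x * c2 + 64 * p\<^sup>2 * k2"
    unfolding kit_def c2_def[symmetric] c3_def[symmetric] y_def[symmetric] k2_def by (simp add: algebra_simps)
  have k': "kit (n + 1) x = n + 1 + 8 * p * v * x * (c2 + (n + 1))
      + 64 * p\<^sup>2 * (k2 + v * t * y * (2 * c2) + v\<^sup>2 * (x\<^sup>2 * c2 + y * (n + 1)))"
    unfolding kit_def c' y_def[symmetric] k2_def by (simp add: algebra_simps)
  have e: "e = 1 + 8 * p * v * x + 64 * p\<^sup>2 * (v\<^sup>2 * y + v * t * n * y)"
    unfolding e_def efun_def y_def by (simp add: algebra_simps)
  have "e * (kit n x + 1) - kit (n + 1) x = q * (2 * v * x * k2 + 2 * (v\<^sup>2 * y + v * t * n * y) * v * x * c2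
      + 16 * p * (v\<^sup>2 * y + v * t * n * y) * k2)"
    unfolding e k k' c2 by (simp add: algebra_simps power2_eq_square power3_eq_cube)
  then have "[e * (kit n x + 1) = kit (n + 1) x] (mod q)"
    by (simp only: cong_iff_dvd_diff dvd_triv_left)
  with 2 have "[efun (xit n x) * (kit n x + 1) = kit (n + 1) x] (mod q)" using cong_trans by blast
  from cong_diff[OF cong_scalar_right[OF 1, of j] this] show ?thesis by (simp add: algebra_simps)
qed

text \<open>The action of \<open>B\<^sup>-\<^sup>1\<close>: it expresses \<open>b\<^sup>-\<^sup>1 a\<^sup>x b\<^sup>j\<close> as \<open>a\<^sup>G b\<^sup>E\<close> modulo \<open>\<langle>c\<rangle>\<close>.\<close>
definition binv :: "int \<times> int \<Rightarrow> int \<times> int" where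
  "binv z = (gfun (fst z), efun (fst z) * (snd z - 1))"

definition cgr :: "int \<times> int \<Rightarrow> int \<times> int \<Rightarrow> bool" where
  "cgr z w \<longleftrightarrow> [fst z = fst w] (mod q) \<and> [snd z = snd w] (mod q)"

lemma cgr_refl [simp]: "cgr z z"
  and cgr_trans: "cgr z w \<Longrightarrow> cgr w y \<Longrightarrow> cgr z y"
  and cgr_sym: "cgr z w \<Longrightarrow> cgr w z"
  unfolding cgr_def by (auto intro: cong_trans cong_sym)

lemma efun_cong: "[x = y] (mod q) \<Longrightarrow> [efun x = efun y] (mod q)"
proof -
  assume "[x = y] (mod q)"
  then obtain k where "x - y = q * k" unfolding cong_iff_dvd_diff by blast
  then have x: "x = y + 32 * p\<^sup>2 * (8 * p * k)" by (simp add: power2_eq_square power3_eq_cube)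
  show ?thesis unfolding cong_iff_dvd_diff x by (rule efun_shift)
qed

lemma gfun_cong: "[x = y] (mod q) \<Longrightarrow> [gfun x = gfun y] (mod q)"
proof -
  assume "[x = y] (mod q)"
  then obtain k where "x - y = q * k" unfolding cong_iff_dvd_diff by blast
  then have x: "x = y + 32 * p\<^sup>2 * (8 * p * k)" by (simp add: power2_eq_square power3_eq_cube)
  have "[gfun x = gfun y + 32 * p\<^sup>2 * (8 * p * k) + 128 * p ^ 3 * (8 * p * k)] (mod q)"
    unfolding x cong_iff_dvd_diff by (rule gfun_shift)
  moreover have "gfun y + 32 * p\<^sup>2 * (8 * p * k) + 128 * p ^ 3 * (8 * p * k) - gfun y = q * (k + 4 * p * k)"
    by (simp add: algebra_simps power2_eq_square power3_eq_cube)
  then have "[gfun y + 32 * p\<^sup>2 * (8 * p * k) + 128 * p ^ 3 * (8 * p * k) = gfun y] (mod q)"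
    by (simp only: cong_iff_dvd_diff dvd_triv_left)
  ultimately show ?thesis using cong_trans by blast
qed

lemma binv_cgr: "cgr z w \<Longrightarrow> cgr (binv z) (binv w)"
  unfolding cgr_def binv_def by (simp add: gfun_cong cong_mult[OF efun_cong cong_diff[OF _ cong_refl]])

lemma binv_funpow: "cgr ((binv ^^ n) (x, j)) (xit (int n) x, efun (sit (int n) x) * j - kit (int n) x)"
proof (induction n)
  case 0
  have "P2 1 = 0" "P3 1 = 0" by (simp_all add: P2_def P3_def)
  then show ?case by (simp add: xit_def sit_def kit_def efun_def)
next
  case (Suc n)
  have "cgr (binv ((binv ^^ n) (x, j))) (binv (xit (int n) x, efun (sit (int n) x) * j - kit (int n) x))"
    by (rule binv_cgr[OF Suc])
  moreover have "cgr (binv (xit (int n) x, efun (sit (int n) x) * j - kit (int n) x))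
     (xit (int n + 1) x, efun (sit (int n + 1) x) * j - kit (int n + 1) x)"
    unfolding cgr_def binv_def using xit_step jit_step by simp
  ultimately show ?case using cgr_trans by (simp add: add.commute)
qed

text \<open>The factor 6 absorbs the denominators of \<open>P2\<close> and \<open>P3\<close>, so
  every term of the closed forms that depends on n is divisible by q at n = 6 q.\<close>

definition period :: nat where "period = nat (6 * q)"

lemma int_period: "int period = 6 * q"
  using p_pos by (simp add: period_def)

lemma binv_period: "cgr ((binv ^^ period) z) z"
proof -
  obtain x j where z: "z = (x, j)" by (cases z)
  define Z where "Z = q"
  have h: "P2 (6 * Z) = Z * (3 * (6 * Z - 1))" "P3 (6 * Z) = Z * ((6 * Z - 1) * (6 * Z - 2))"
    using P2[of "6 * Z"] P3_6[of "6 * Z"] by (simp_all add: algebra_simps)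
  have h1: "P2 (6 * Z + 1) = Z * (3 * (6 * Z - 1) + 6)" "P3 (6 * Z + 1) = Z * ((6 * Z - 1) * (6 * Z - 2) + 3 * (6 * Z - 1))"
    unfolding P2_Suc P3_Suc h by (simp_all add: algebra_simps)
  have "xit (6 * Z) x - x = Z * (6 * (8 * p * t * P2 x + 64 * p\<^sup>2 * t\<^sup>2 * P3 x)
     + 32 * p\<^sup>2 * t\<^sup>2 * (3 * (6 * Z - 1)) * (2 * x - 1) * P2 x + 128 * p ^ 3 * ((6 * Z - 1) * (6 * Z - 2)) * P2 x)"
    unfolding xit_def h by (simp add: algebra_simps)
  then have 1: "[xit (6 * Z) x = x] (mod Z)" by (simp only: cong_iff_dvd_diff dvd_triv_left)
  have "sit (6 * Z) x - 0 = Z * (6 * x + 8 * p * t * (3 * (6 * Z - 1)) * P2 x)"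
    unfolding sit_def h by (simp add: algebra_simps)
  then have "[sit (6 * Z) x = 0] (mod Z)" by (simp only: cong_iff_dvd_diff dvd_triv_left)
  from efun_cong[OF this[unfolded Z_def], folded Z_def] have "[efun (sit (6 * Z) x) = 1] (mod Z)" by (simp add: efun_def)
  from cong_scalar_right[OF this] have 2: "[efun (sit (6 * Z) x) * j = 1 * j] (mod Z)" .
  have "kit (6 * Z) x - 0 = Z * (6 + 8 * p * v * x * (3 * (6 * Z - 1) + 6)
    + 128 * p\<^sup>2 * v * t * P2 x * ((6 * Z - 1) * (6 * Z - 2) + 3 * (6 * Z - 1))
    + 64 * p\<^sup>2 * v\<^sup>2 * (x\<^sup>2 * ((6 * Z - 1) * (6 * Z - 2) + 3 * (6 * Z - 1)) + P2 x * (3 * (6 * Z - 1) + 6)))"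
    unfolding kit_def h1 by (simp add: algebra_simps)
  then have 3: "[kit (6 * Z) x = 0] (mod Z)" by (simp only: cong_iff_dvd_diff dvd_triv_left)
  have "[efun (sit (6 * q) x) * j - kit (6 * q) x = j] (mod q)" using cong_diff[OF 2 3] unfolding Z_def by simp
  note 1 = 1[unfolded Z_def] and this
  then have "cgr (xit (6 * q) x, efun (sit (6 * q) x) * j - kit (6 * q) x) z" using 1 by (simp add: cgr_def z)
  then show ?thesis using binv_funpow[of period x j] cgr_trans by (simp add: z int_period)
qed

text \<open>In the group, \<open>A_pow_fA\<close> ties a^(32 p^2 y) with y odd to a power of b and
  to c^(16 p^2 \<eta>); moving the latter past b^j changes j by an odd multiple of 128 p^3 j modulo
  q. The coefficients u^2 and v^2 are those by which the second relation fails on pairs, see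
  \<open>binv_beta_fst\<close> and \<open>binv_beta_snd\<close>.\<close>

definition eqv :: "int \<times> int \<Rightarrow> int \<times> int \<Rightarrow> bool" where
  "eqv z w \<longleftrightarrow> (\<exists>k. [fst w = fst z + k * (32 * p\<^sup>2 * u\<^sup>2)] (mod q)
    \<and> [snd w = snd z + k * (32 * p\<^sup>2 * v\<^sup>2 + 128 * p ^ 3 * snd z)] (mod q))"

text \<open>The last equation records that the parity of the second coordinate is an invariant. So
  128 p^3 times it is constant modulo q along a class, and shifts compose and invert additively in
  k.\<close>

lemma eqvE:
  assumes "eqv z w"
  obtains k r s y where "fst w = fst z + k * (32 * p\<^sup>2 * u\<^sup>2) + q * r"
    "snd w = snd z + k * (32 * p\<^sup>2 * v\<^sup>2 + 128 * p ^ 3 * snd z) + q * s" "snd w = snd z + 2 * y"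
proof -
  obtain k where "[fst w = fst z + k * (32 * p\<^sup>2 * u\<^sup>2)] (mod q)"
    and "[snd w = snd z + k * (32 * p\<^sup>2 * v\<^sup>2 + 128 * p ^ 3 * snd z)] (mod q)"
    using assms unfolding eqv_def by blast
  then obtain r s where r: "fst w - (fst z + k * (32 * p\<^sup>2 * u\<^sup>2)) = q * r"
    and s: "snd w - (snd z + k * (32 * p\<^sup>2 * v\<^sup>2 + 128 * p ^ 3 * snd z)) = q * s"
    unfolding cong_iff_dvd_diff by (elim dvdE)
  have "snd w = snd z + 2 * (k * (16 * p\<^sup>2 * v\<^sup>2 + 64 * p ^ 3 * snd z) + 128 * p ^ 3 * s)"
    using s by (simp add: algebra_simps)
  moreover have "fst w = fst z + k * (32 * p\<^sup>2 * u\<^sup>2) + q * r"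
    "snd w = snd z + k * (32 * p\<^sup>2 * v\<^sup>2 + 128 * p ^ 3 * snd z) + q * s" using r s by linarith+
  ultimately show thesis using that by blast
qed

lemma eqvI:
  assumes "fst w = fst z + k * (32 * p\<^sup>2 * u\<^sup>2) + q * r"
    "snd w = snd z + k * (32 * p\<^sup>2 * v\<^sup>2 + 128 * p ^ 3 * snd z) + q * s"
  shows "eqv z w"
proof -
  have "fst w - (fst z + k * (32 * p\<^sup>2 * u\<^sup>2)) = q * r"
    "snd w - (snd z + k * (32 * p\<^sup>2 * v\<^sup>2 + 128 * p ^ 3 * snd z)) = q * s" using assms by simp_all
  then show ?thesis unfolding eqv_def cong_iff_dvd_diff by (intro exI[of _ k]) (simp only: dvd_triv_left simp_thms)
qed

lemma cgr_imp_eqv: "cgr z w \<Longrightarrow> eqv z w"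
  unfolding cgr_def eqv_def by (intro exI[of _ 0]) (simp add: cong_sym)

lemma eqv_refl [simp]: "eqv z z" by (simp add: cgr_imp_eqv)

lemma eqv_sym: "eqv z w \<Longrightarrow> eqv w z"
proof (elim eqvE)
  fix k r s y
  assume 1: "fst w = fst z + k * (32 * p\<^sup>2 * u\<^sup>2) + q * r"
    and 2: "snd w = snd z + k * (32 * p\<^sup>2 * v\<^sup>2 + 128 * p ^ 3 * snd z) + q * s" and 3: "snd w = snd z + 2 * y"
  have "fst z = fst w + (- k) * (32 * p\<^sup>2 * u\<^sup>2) + q * (- r)" using 1 by simp
  moreover have "128 * p ^ 3 * (k * snd w) = 128 * p ^ 3 * (k * snd z) + q * (k * y)"
    unfolding 3 by (simp add: algebra_simps)
  then have "snd z = snd w + (- k) * (32 * p\<^sup>2 * v\<^sup>2 + 128 * p ^ 3 * snd w) + q * (k * y - s)"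
    using 2 by (simp add: algebra_simps)
  ultimately show ?thesis by (rule eqvI)
qed

lemma eqv_trans: "eqv z w \<Longrightarrow> eqv w z' \<Longrightarrow> eqv z z'"
proof (elim eqvE)
  fix k r s y k' r' s' y'
  assume 1: "fst w = fst z + k * (32 * p\<^sup>2 * u\<^sup>2) + q * r"
    and 2: "snd w = snd z + k * (32 * p\<^sup>2 * v\<^sup>2 + 128 * p ^ 3 * snd z) + q * s" and 3: "snd w = snd z + 2 * y"
    and 4: "fst z' = fst w + k' * (32 * p\<^sup>2 * u\<^sup>2) + q * r'"
    and 5: "snd z' = snd w + k' * (32 * p\<^sup>2 * v\<^sup>2 + 128 * p ^ 3 * snd w) + q * s'"
  have "fst z' = fst z + (k + k') * (32 * p\<^sup>2 * u\<^sup>2) + q * (r + r')" using 1 4 by (simp add: algebra_simps)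
  moreover have "128 * p ^ 3 * (k' * snd w) = 128 * p ^ 3 * (k' * snd z) + q * (k' * y)"
    unfolding 3 by (simp add: algebra_simps)
  then have "snd z' = snd z + (k + k') * (32 * p\<^sup>2 * v\<^sup>2 + 128 * p ^ 3 * snd z) + q * (s + s' + k' * y)"
    using 5 2 by (simp add: algebra_simps)
  ultimately show ?thesis by (rule eqvI)
qed

definition aact :: "int \<Rightarrow> int \<times> int \<Rightarrow> int \<times> int" where
  "aact n z = (fst z + n, snd z)"

lemma eqv_aact: "eqv z w \<Longrightarrow> eqv (aact n z) (aact n w)"
  unfolding eqv_def aact_def by (auto simp: cong_iff_dvd_diff algebra_simps)

text \<open>The parameter k becomes k (1 + 4p), because \<open>gfun_shift\<close> stretches a
  displacement 32 p^2 h by the factor 1 + 4p.\<close>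

lemma eqv_binv: "eqv z w \<Longrightarrow> eqv (binv z) (binv w)"
proof (elim eqvE)
  fix k r s y
  assume 1: "fst w = fst z + k * (32 * p\<^sup>2 * u\<^sup>2) + q * r"
    and 2: "snd w = snd z + k * (32 * p\<^sup>2 * v\<^sup>2 + 128 * p ^ 3 * snd z) + q * s"
  define x j where "x = fst z" and "j = snd z"
  define h where "h = k * u\<^sup>2 + 8 * p * r"
  have w: "fst w = x + 32 * p\<^sup>2 * h" unfolding 1 h_def x_def by (simp add: algebra_simps power2_eq_square power3_eq_cube)
  obtain c where "gfun (x + 32 * p\<^sup>2 * h) - (gfun x + 32 * p\<^sup>2 * h + 128 * p ^ 3 * h) = q * c"
    using gfun_shift[of x h] by (elim dvdE)
  then have g: "gfun (fst w) = gfun x + 32 * p\<^sup>2 * h + 128 * p ^ 3 * h + q * c" unfolding w by simp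
  obtain d where "efun (x + 32 * p\<^sup>2 * h) - efun x = q * d" using efun_shift[of x h] by (elim dvdE)
  then have e: "efun (fst w) = efun x + q * d" unfolding w by simp
  define f where "f = v * x + 8 * p * v\<^sup>2 * P2 x"
  have f: "efun x = 1 + 8 * p * f" unfolding efun_def f_def by (simp add: algebra_simps power2_eq_square)
  have "even (v\<^sup>2 - 1)" using odd_v by simp
  then obtain v' where v': "v\<^sup>2 = 1 + 2 * v'" by (metis add.commute diff_add_cancel dvdE)
  have 3: "gfun (fst w) = gfun x + (k + 4 * p * k) * (32 * p\<^sup>2 * u\<^sup>2) + q * (r + 4 * p * r + c)"
    unfolding g h_def by (simp add: algebra_simps power2_eq_square power3_eq_cube)
  have "128 * p ^ 3 * k * v\<^sup>2 = 128 * p ^ 3 * k + q * (k * v')" unfolding v' by (simp add: algebra_simps)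
  then have v2: "128 * p ^ 3 * k - 128 * p ^ 3 * k * v\<^sup>2 + q * (k * v') = 0" by simp
  have "efun (fst w) * (snd w - 1) = (1 + 8 * p * f) * (j - 1) + k * (32 * p\<^sup>2 * v\<^sup>2 + 128 * p ^ 3 * j)
      + q * (f * k * (v\<^sup>2 + 4 * p * j) + (1 + 8 * p * f) * s + d * (snd w - 1))"
    unfolding e f 2 j_def[symmetric] by (simp add: algebra_simps power2_eq_square power3_eq_cube)
  also have "k * (32 * p\<^sup>2 * v\<^sup>2 + 128 * p ^ 3 * j) = k * (32 * p\<^sup>2 * v\<^sup>2) + 128 * p ^ 3 * k * (j - 1) + 128 * p ^ 3 * k"
    by (simp add: algebra_simps)
  also have "\<dots> = (k + 4 * p * k) * (32 * p\<^sup>2 * v\<^sup>2 + 128 * p ^ 3 * ((1 + 8 * p * f) * (j - 1)))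
      - q * (k * v' + 2 * p * k * (j - 1) + 4 * p * f * (k + 4 * p * k) * (j - 1))
      + (128 * p ^ 3 * k - 128 * p ^ 3 * k * v\<^sup>2 + q * (k * v'))"
    by (simp add: algebra_simps power2_eq_square power3_eq_cube)
  finally have 4: "efun (fst w) * (snd w - 1) = efun x * (j - 1)
      + (k + 4 * p * k) * (32 * p\<^sup>2 * v\<^sup>2 + 128 * p ^ 3 * (efun x * (j - 1)))
      + q * (f * k * (v\<^sup>2 + 4 * p * j) + (1 + 8 * p * f) * s + d * (snd w - 1)
         - (k * v' + 2 * p * k * (j - 1) + 4 * p * f * (k + 4 * p * k) * (j - 1)))"
    unfolding v2 f by (simp add: algebra_simps)
  show ?thesis
    by (rule eqvI[of _ _ "k + 4 * p * k"]) (simp_all only: binv_def fst_conv snd_conv x_def[symmetric] j_def[symmetric] 3 4)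
qed

lemma eqv_binv_funpow: "eqv z w \<Longrightarrow> eqv ((binv ^^ n) z) ((binv ^^ n) w)"
  by (induction n) (simp_all add: eqv_binv)

text \<open>Left multiplication by c: c a^x b^j = a^(x/\<alpha>) b^(\<beta> j) c, with 1 + 8pt in
  place of 1/\<alpha>.\<close>

definition cact :: "int \<times> int \<Rightarrow> int \<times> int" where
  "cact z = ((1 + 8 * p * t) * fst z, int \<beta> * snd z)"

lemma eqv_cact: "eqv z w \<Longrightarrow> eqv (cact z) (cact w)"
proof (elim eqvE)
  fix k r s
  assume 1: "fst w = fst z + k * (32 * p\<^sup>2 * u\<^sup>2) + q * r"
    and 2: "snd w = snd z + k * (32 * p\<^sup>2 * v\<^sup>2 + 128 * p ^ 3 * snd z) + q * s"
  have "(1 + 8 * p * t) * fst w = (1 + 8 * p * t) * fst z + k * (32 * p\<^sup>2 * u\<^sup>2) + q * (t * k * u\<^sup>2 + (1 + 8 * p * t) * r)"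
    unfolding 1 by (simp add: algebra_simps power2_eq_square power3_eq_cube)
  moreover have "int \<beta> * snd w = int \<beta> * snd z + k * (32 * p\<^sup>2 * v\<^sup>2 + 128 * p ^ 3 * (int \<beta> * snd z))
     + q * (v * k * v\<^sup>2 + int \<beta> * s)"
    unfolding 2 beta by (simp add: algebra_simps power2_eq_square power3_eq_cube)
  ultimately show ?thesis by (intro eqvI) (simp_all only: cact_def fst_conv snd_conv)
qed

text \<open>The identity b^-1 a = a c b^-1 on the model; \<open>weval_wC\<close> reads off the
  action of c from it.\<close>

lemma binv_aact: "cgr (binv (aact 1 z)) (aact 1 (cact (binv z)))"
proof -
  have "gfun (fst z + 1) - ((1 + 8 * p * t) * gfun (fst z) + 1) = q * (- 2 * t ^ 3 * P3 (fst z))"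
    unfolding gfun_def P2_Suc P3_Suc by (simp add: algebra_simps power2_eq_square power3_eq_cube)
  then have "[gfun (fst z + 1) = (1 + 8 * p * t) * gfun (fst z) + 1] (mod q)"
    by (simp only: cong_iff_dvd_diff dvd_triv_left)
  moreover have "efun (fst z + 1) - int \<beta> * efun (fst z) = q * (- 2 * v ^ 3 * P2 (fst z))"
    unfolding efun_def P2_Suc beta by (simp add: algebra_simps power2_eq_square power3_eq_cube)
  then have "[efun (fst z + 1) = int \<beta> * efun (fst z)] (mod q)"
    by (simp only: cong_iff_dvd_diff dvd_triv_left)
  from cong_scalar_right[OF this, of "snd z - 1"]
  have "[efun (fst z + 1) * (snd z - 1) = int \<beta> * (efun (fst z) * (snd z - 1))] (mod q)" by (simp add: mult.assoc)
  ultimately show ?thesis unfolding cgr_def binv_def aact_def cact_def by simp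
qed

text \<open>First coordinate of b^-\<beta> = c b^-1 c^-1. The two sides agree only after the shift
  of \<open>eqv\<close> with k = -x.\<close>

lemma binv_beta_fst:
  "[xit (int \<beta>) x + (- x) * (32 * p\<^sup>2 * u\<^sup>2) = (1 + 8 * p * t) * gfun ((1 + 8 * p * u) * x)] (mod q)"
proof -
  define y z where "y = P2 x" and "z = P3 x"
  have xx: "(2 * x - 1) * x = 4 * y + x" using P2[of x] unfolding y_def by (simp add: algebra_simps)
  have "2 * P2 (int \<beta>) = 2 * (4 * p * (v * (1 + 8 * p * v)))" unfolding P2 beta by (simp add: algebra_simps)
  then have b2: "P2 (int \<beta>) = 4 * p * (v * (1 + 8 * p * v))" by simp
  then have "4 * p dvd P3 (int \<beta>)" by (intro dvd_P3) simp
  then obtain c where c: "P3 (int \<beta>) = 4 * p * c" by blast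
  \<comment> \<open>Both terms are odd. This is where the first coordinate uses that \<eta> is
    odd.\<close>
  have "even (t * \<eta> - v * t\<^sup>2 * (2 * x - 1))" using odd_t odd_v odd_eta by simp
  then obtain d where d: "t * \<eta> - v * t\<^sup>2 * (2 * x - 1) = 2 * d" by blast
  have ut: "u + t = 32 * p\<^sup>2 * \<rho> - 8 * p * u * t" using t by simp
  have "(1 + 8 * p * t) * (gfun x + 8 * p * (u * x) + 32 * p\<^sup>2 * t * u * ((2 * x - 1) * x))
      - (xit (int \<beta>) x + (- x) * (32 * p\<^sup>2 * u\<^sup>2))
    = 8 * p * x * (u + t + 8 * p * u * t) + 32 * p\<^sup>2 * u * x * (u + t) + 64 * p\<^sup>2 * t * y * ((u - v) + (u + t))
      - 128 * p ^ 3 * v * t\<^sup>2 * (2 * x - 1) * y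
      + q * (2 * t ^ 3 * z + t\<^sup>2 * u * (4 * y + x) - 2 * v * t\<^sup>2 * z - 4 * p * t\<^sup>2 * v\<^sup>2 * (2 * x - 1) * y - 2 * p * c * y)"
    unfolding xx unfolding xit_def gfun_def b2 c y_def[symmetric] z_def[symmetric] unfolding beta
    by (simp add: algebra_simps power2_eq_square power3_eq_cube)
  also have "\<dots> = 128 * p ^ 3 * y * (t * \<eta> - v * t\<^sup>2 * (2 * x - 1))
      + q * (\<rho> * x + u * x * (4 * p * \<rho> - u * t) + t * y * (8 * p * \<rho> - 2 * u * t) + 2 * t ^ 3 * z + t\<^sup>2 * u * (4 * y + x) - 2 * v * t\<^sup>2 * z
        - 4 * p * t\<^sup>2 * v\<^sup>2 * (2 * x - 1) * y - 2 * p * c * y)"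
    unfolding t uv unfolding ut by (simp add: algebra_simps power2_eq_square power3_eq_cube)
  also have "\<dots> = q * (y * d + (\<rho> * x + u * x * (4 * p * \<rho> - u * t) + t * y * (8 * p * \<rho> - 2 * u * t) + 2 * t ^ 3 * z + t\<^sup>2 * u * (4 * y + x) - 2 * v * t\<^sup>2 * z
        - 4 * p * t\<^sup>2 * v\<^sup>2 * (2 * x - 1) * y - 2 * p * c * y))"
    unfolding d by (simp add: algebra_simps)
  finally have 1: "[(1 + 8 * p * t) * (gfun x + 8 * p * (u * x) + 32 * p\<^sup>2 * t * u * ((2 * x - 1) * x))
      = xit (int \<beta>) x + (- x) * (32 * p\<^sup>2 * u\<^sup>2)] (mod q)"
    by (simp only: cong_iff_dvd_diff dvd_triv_left)
  have "(1 + 8 * p * u) * x = x + 8 * p * (u * x)" by (simp add: algebra_simps)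
  then have "[gfun ((1 + 8 * p * u) * x) = gfun x + 8 * p * (u * x) + 32 * p\<^sup>2 * t * (2 * x - 1) * (u * x)] (mod q)"
    unfolding cong_iff_dvd_diff using gfun_eighth[of x "u * x"] by simp
  then have "[gfun ((1 + 8 * p * u) * x) = gfun x + 8 * p * (u * x) + 32 * p\<^sup>2 * t * u * ((2 * x - 1) * x)] (mod q)"
    by (simp add: mult_ac)
  from cong_scalar_left[OF this, of "1 + 8 * p * t"] 1 show ?thesis using cong_trans cong_sym by blast
qed

lemma binv_beta_snd:
  defines "J \<equiv> \<lambda>x j. efun (sit (int \<beta>) x) * j - kit (int \<beta>) x"
  shows "[J x j + (- x) * (32 * p\<^sup>2 * v\<^sup>2 + 128 * p ^ 3 * J x j) = efun ((1 + 8 * p * u) * x) * (j - int \<beta>)] (mod q)"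
proof -
  define y f where "y = P2 x" and "f = efun x"
  have "2 * P2 (int \<beta>) = 2 * (4 * p * (v * (1 + 8 * p * v)))" unfolding P2 beta by (simp add: algebra_simps)
  then have b2: "P2 (int \<beta>) = 4 * p * (v * (1 + 8 * p * v))" by simp
  then have "4 * p dvd P3 (int \<beta>)" by (intro dvd_P3) simp
  then have "4 * p dvd P3 (int \<beta> + 1)" unfolding P3_Suc b2 by simp
  then obtain c where c: "P3 (int \<beta> + 1) = 4 * p * c" by blast
  have b2': "P2 (int \<beta> + 1) = 1 + 12 * p * v + 32 * p\<^sup>2 * v\<^sup>2"
    unfolding P2_Suc b2 unfolding beta by (simp add: algebra_simps power2_eq_square)
  have f: "f = 1 + 8 * p * v * x + 64 * p\<^sup>2 * v\<^sup>2 * y" unfolding f_def efun_def y_def ..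
  define \<kappa> where "\<kappa> = int \<beta> + 8 * p * v * x + 96 * p\<^sup>2 * v\<^sup>2 * x + 64 * p\<^sup>2 * v\<^sup>2 * y"
  have "kit (int \<beta>) x - \<kappa> = q * (v ^ 3 * x + 2 * v * t * y * c + v\<^sup>2 * x\<^sup>2 * c + y * v\<^sup>2 * (3 * v + 8 * p * v\<^sup>2))"
    unfolding kit_def c b2' \<kappa>_def y_def[symmetric] by (simp add: algebra_simps power2_eq_square power3_eq_cube)
  then have k: "[kit (int \<beta>) x = \<kappa>] (mod q)" by (simp only: cong_iff_dvd_diff dvd_triv_left)
  have "sit (int \<beta>) x = x + 8 * p * (v * x) + 32 * p\<^sup>2 * (t * v * (1 + 8 * p * v) * y)"
    unfolding sit_def b2 y_def[symmetric] unfolding beta by (simp add: algebra_simps power2_eq_square)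
  then have "[efun (sit (int \<beta>) x) = efun (x + 8 * p * (v * x))] (mod q)"
    unfolding cong_iff_dvd_diff using efun_shift by simp
  moreover have "[efun (x + 8 * p * (v * x)) = f + 64 * p\<^sup>2 * v * (v * x)] (mod q)"
    unfolding cong_iff_dvd_diff f_def by (rule efun_eighth)
  ultimately have s: "[efun (sit (int \<beta>) x) = f + 64 * p\<^sup>2 * v * (v * x)] (mod q)" using cong_trans by blast
  define J0 where "J0 = (f + 64 * p\<^sup>2 * v * (v * x)) * j - \<kappa>"
  have J: "[J x j = J0] (mod q)" unfolding J_def J0_def by (rule cong_diff[OF cong_scalar_right[OF s] k])
  have "(1 + 8 * p * u) * x = x + 8 * p * (u * x)" by (simp add: algebra_simps)
  then have e: "[efun ((1 + 8 * p * u) * x) = f + 64 * p\<^sup>2 * v * (u * x)] (mod q)"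
    unfolding cong_iff_dvd_diff f_def using efun_eighth[of x "u * x"] by simp
  \<comment> \<open>J0 has the parity of j - 1, since \<open>f\<close> and \<kappa> are odd, and v
    \<eta> is odd as well.\<close>
  have "even (v * \<eta> * (j - 1) + J0)"
    unfolding J0_def f \<kappa>_def beta using odd_v odd_eta by auto
  then obtain d where d: "v * \<eta> * (j - 1) + J0 = 2 * d" by blast
  have "(f + 64 * p\<^sup>2 * v * (u * x)) * (j - int \<beta>) - (J0 + (- x) * (32 * p\<^sup>2 * v\<^sup>2 + 128 * p ^ 3 * J0))
     = 64 * p\<^sup>2 * v * x * (u - v) * (j - 1) + 128 * p ^ 3 * x * J0 - q * (2 * v ^ 3 * y + 2 * v\<^sup>2 * u * x)"
  proof -
    have "(f + 64 * p\<^sup>2 * v * (u * x)) * (j - int \<beta>) - J0 + x * (32 * p\<^sup>2 * v\<^sup>2)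
      = 64 * p\<^sup>2 * v * x * (u - v) * (j - 1) - q * (2 * v ^ 3 * y + 2 * v\<^sup>2 * u * x)"
      unfolding J0_def f \<kappa>_def beta by (simp add: algebra_simps power2_eq_square power3_eq_cube)
    then show ?thesis by (simp add: algebra_simps)
  qed
  also have "\<dots> = 128 * p ^ 3 * x * (v * \<eta> * (j - 1) + J0) - q * (2 * v ^ 3 * y + 2 * v\<^sup>2 * u * x)"
    unfolding uv by (simp add: algebra_simps power2_eq_square power3_eq_cube)
  also have "\<dots> = q * (x * d - (2 * v ^ 3 * y + 2 * v\<^sup>2 * u * x))"
    unfolding d by (simp add: algebra_simps)
  finally have 1: "[(f + 64 * p\<^sup>2 * v * (u * x)) * (j - int \<beta>) = J0 + (- x) * (32 * p\<^sup>2 * v\<^sup>2 + 128 * p ^ 3 * J0)] (mod q)"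
    by (simp only: cong_iff_dvd_diff dvd_triv_left)
  have 2: "[J x j + (- x) * (32 * p\<^sup>2 * v\<^sup>2 + 128 * p ^ 3 * J x j) = J0 + (- x) * (32 * p\<^sup>2 * v\<^sup>2 + 128 * p ^ 3 * J0)] (mod q)"
    by (intro cong_add cong_mult cong_refl J)
  show ?thesis using cong_trans[OF 2 cong_sym[OF cong_trans[OF cong_scalar_right[OF e] 1]]] .
qed

end

section \<open>The action of words on the model\<close>

context macdonald_model
begin

text \<open>The iterate for B inverts \<open>binv\<close> up to \<open>cgr\<close>, so formulas are
  needed for b^-1 only.\<close>

definition letact :: "letter \<Rightarrow> int \<times> int \<Rightarrow> int \<times> int" where
  "letact l z = (if snd l then (if fst l then binv z else (binv ^^ (period - 1)) z)
     else aact (if fst l then - 1 else 1) z)"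

definition weval :: "word \<Rightarrow> int \<times> int \<Rightarrow> int \<times> int" where
  "weval w z = foldr letact w z"

lemma weval_simps [simp]: "weval [] z = z" "weval (l # w) z = letact l (weval w z)"
  "weval (w @ w') z = weval w (weval w' z)"
  by (simp_all add: weval_def)

lemma eqv_letact: "eqv z w \<Longrightarrow> eqv (letact l z) (letact l w)"
  by (simp add: letact_def eqv_binv eqv_binv_funpow eqv_aact)

lemma eqv_weval: "eqv z w \<Longrightarrow> eqv (weval x z) (weval x w)"
  by (induction x) (simp_all add: eqv_letact)

lemma period_pos: "period > 0"
  using int_period p_pos by (metis of_nat_0_less_iff zero_less_mult_iff zero_less_numeral zero_less_power)

lemma letact_cancel: "eqv (letact (e, g) (letact (\<not> e, g) z)) z"
proof (cases g)
  case True
  have "binv ((binv ^^ (period - 1)) z) = (binv ^^ period) z" "(binv ^^ (period - 1)) (binv z) = (binv ^^ period) z"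
    using period_pos by (metis Suc_diff_1 funpow.simps(2) o_apply, metis Suc_diff_1 funpow_Suc_right o_apply)
  then show ?thesis using True cgr_imp_eqv[OF binv_period[of z]] by (simp add: letact_def)
next
  case False
  then show ?thesis by (simp add: letact_def aact_def)
qed

lemma weval_winv_left: "eqv (weval (winv w) (weval w z)) z"
proof (induction w arbitrary: z)
  case (Cons x w)
  obtain e g where x: "x = (e, g)" by (cases x)
  have "eqv (letact (\<not> e, g) (letact (e, g) (weval w z))) (weval w z)"
    using letact_cancel[of "\<not> e" g] by simp
  from eqv_weval[OF this, of "winv w"] show ?case
    using eqv_trans[OF _ Cons] by (simp add: winv_Cons x)
qed (simp add: winv_def)

lemma weval_wC: "eqv (weval wC z) (cact z)"
proof -
  let ?y = "(binv ^^ (period - 1)) z"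
  have "weval wC z = aact (- 1) (binv (aact 1 ?y))"
    by (simp add: wC_def wcomm_def winv_def wA_def wB_def letact_def)
  moreover have "eqv (aact (- 1) (binv (aact 1 ?y))) (aact (- 1) (aact 1 (cact (binv ?y))))"
    by (intro eqv_aact cgr_imp_eqv binv_aact)
  moreover have "aact (- 1) (aact 1 (cact (binv ?y))) = cact (binv ?y)" by (simp add: aact_def)
  moreover have "eqv (cact (binv ?y)) (cact z)"
    using letact_cancel[of True True z] by (intro eqv_cact) (simp add: letact_def)
  ultimately show ?thesis using eqv_trans by metis
qed

lemma beta_inverse: "\<exists>\<theta>. [int \<beta> * \<theta> = 1] (mod q)"
proof -
  obtain k where k: "p = 2 ^ k" using p by blast
  have "q = 2 ^ (3 * k + 8)" unfolding k by (simp add: power_add power_mult[symmetric] mult.commute)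
  moreover have "odd (int \<beta>)" unfolding beta by simp
  ultimately have "coprime (int \<beta>) q" by simp
  then show ?thesis using cong_solve_coprime_int by blast
qed

definition binverse :: int where "binverse = (SOME \<theta>. [int \<beta> * \<theta> = 1] (mod q))"

lemma binverse: "[int \<beta> * binverse = 1] (mod q)"
  unfolding binverse_def using someI_ex[OF beta_inverse] .

definition ciact :: "int \<times> int \<Rightarrow> int \<times> int" where
  "ciact z = ((1 + 8 * p * u) * fst z, binverse * snd z)"

lemma cact_ciact: "cgr (cact (ciact z)) z" and ciact_cact: "cgr (ciact (cact z)) z"
proof -
  have "(1 + 8 * p * t) * ((1 + 8 * p * u) * x) - x = 8 * p * x * (u + t + 8 * p * u * t)" for x
    by (simp add: algebra_simps power2_eq_square)
  then have "(1 + 8 * p * t) * ((1 + 8 * p * u) * x) - x = q * (\<rho> * x)" for x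
    unfolding t by (simp add: power2_eq_square power3_eq_cube)
  then have 1: "[(1 + 8 * p * t) * ((1 + 8 * p * u) * x) = x] (mod q)" for x
    by (simp only: cong_iff_dvd_diff dvd_triv_left)
  have 2: "[int \<beta> * (binverse * y) = y] (mod q)" for y
    using cong_scalar_right[OF binverse, of y] by (simp add: mult.assoc)
  show "cgr (cact (ciact z)) z" using 1 2 by (simp add: cgr_def cact_def ciact_def)
  show "cgr (ciact (cact z)) z"
    using 1 2 unfolding cgr_def cact_def ciact_def by (simp add: mult.left_commute)
qed

lemma weval_winv_wC: "eqv (weval (winv wC) z) (ciact z)"
proof -
  have "eqv z (cact (ciact z))" using cgr_imp_eqv[OF cact_ciact] eqv_sym by blast
  also have "eqv (cact (ciact z)) (weval wC (ciact z))" using weval_wC eqv_sym by blast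
  finally (eqv_trans) have "eqv (weval (winv wC) z) (weval (winv wC) (weval wC (ciact z)))" by (rule eqv_weval)
  then show ?thesis using weval_winv_left eqv_trans by blast
qed

lemma eqv_ciact: "eqv z w \<Longrightarrow> eqv (ciact z) (ciact w)"
  using eqv_weval[of z w "winv wC"] weval_winv_wC eqv_trans eqv_sym by meson

lemma binv_beta: "eqv ((binv ^^ \<beta>) z) (cact (binv (ciact z)))"
proof -
  obtain x j where z: "z = (x, j)" by (cases z)
  let ?J = "efun (sit (int \<beta>) x) * j - kit (int \<beta>) x"
  have 1: "eqv ((binv ^^ \<beta>) z) (xit (int \<beta>) x, ?J)"
    unfolding z by (rule cgr_imp_eqv[OF binv_funpow])
  have "[int \<beta> * (efun ((1 + 8 * p * u) * x) * (binverse * j - 1)) = efun ((1 + 8 * p * u) * x) * (j - int \<beta>)] (mod q)"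
    using cong_scalar_left[OF cong_diff[OF cong_scalar_right[OF binverse, of j] cong_refl[of "int \<beta>"]], of "efun ((1 + 8 * p * u) * x)"]
    by (simp add: algebra_simps)
  from cong_trans[OF this cong_sym[OF binv_beta_snd[of x j]]] cong_sym[OF binv_beta_fst[of x]]
  have "eqv (xit (int \<beta>) x, ?J) (cact (binv (ciact z)))"
    unfolding eqv_def by (intro exI[of _ "- x"]) (simp only: z cact_def binv_def ciact_def fst_conv snd_conv simp_thms)
  then show ?thesis using 1 eqv_trans by blast
qed

lemma binv_funpow_period: "cgr ((binv ^^ (period * k)) z) z"
proof (induction k)
  case (Suc k)
  have "(binv ^^ (period * Suc k)) z = (binv ^^ period) ((binv ^^ (period * k)) z)"
    by (simp add: funpow_add)
  then show ?case using binv_period[of "(binv ^^ (period * k)) z"] Suc cgr_trans by metis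
qed simp

lemma binv_funpow_mod: "cgr ((binv ^^ n) z) ((binv ^^ (n mod period)) z)"
proof -
  have "(binv ^^ n) z = (binv ^^ (period * (n div period))) ((binv ^^ (n mod period)) z)"
    using funpow_add[of "period * (n div period)" "n mod period" binv] by simp
  then show ?thesis using binv_funpow_period by metis
qed

lemma binv_funpow_cong:
  assumes "[int n = int n'] (mod int period)"
  shows "cgr ((binv ^^ n) z) ((binv ^^ n') z)"
proof -
  have "n mod period = n' mod period"
    using assms cong_int_iff[of n n' period] by (simp add: cong_def)
  then show ?thesis using binv_funpow_mod cgr_trans cgr_sym by metis
qed

text \<open>By periodicity an integer power of B may be replaced by any natural number of steps of
  \<open>binv\<close> in the right residue class.\<close>

lemma weval_wpow_wB:
  assumes "[int n = - k] (mod int period)"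
  shows "eqv (weval (wpow wB k) z) ((binv ^^ n) z)"
proof (cases "0 \<le> k")
  case True
  have "weval (concat (replicate i wB)) z = (binv ^^ ((period - 1) * i)) z" for i
    by (induction i) (simp_all add: wB_def letact_def funpow_add)
  then have "weval (wpow wB k) z = (binv ^^ ((period - 1) * nat k)) z" using True by (simp add: wpow_def)
  moreover have "int ((period - 1) * nat k) - (- k) = int period * k" using True period_pos
    by (simp add: of_nat_diff Suc_leI algebra_simps)
  then have "[int ((period - 1) * nat k) = - k] (mod int period)"
    by (simp only: cong_iff_dvd_diff dvd_triv_left)
  ultimately show ?thesis
    using cgr_imp_eqv[OF binv_funpow_cong[OF cong_trans[OF _ cong_sym[OF assms]]]] by simp
next
  case False
  have "weval (concat (replicate i (winv wB))) z = (binv ^^ i) z" for i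
    by (induction i) (simp_all add: wB_def winv_def letact_def)
  then have "weval (wpow wB k) z = (binv ^^ nat (- k)) z" using False by (simp add: wpow_def)
  moreover have "[int (nat (- k)) = int n] (mod int period)" using False assms cong_sym by simp
  ultimately show ?thesis using cgr_imp_eqv[OF binv_funpow_cong] by simp
qed

lemma weval_wpow_wA: "weval (wpow wA k) z = aact k z"
proof -
  have "weval (concat (replicate i wA)) z = aact (int i) z" for i
    by (induction i) (simp_all add: wA_def letact_def aact_def)
  moreover have "weval (concat (replicate i (winv wA))) z = aact (- int i) z" for i
    by (induction i) (simp_all add: wA_def winv_def letact_def aact_def)
  ultimately show ?thesis by (simp add: wpow_def)
qed

lemma winv_wC: "winv wC = wcomm wB wA"
  by (simp add: wC_def wcomm_def wA_def wB_def winv_def)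

lemma weval_rel1: "eqv (weval (wconj wA (wcomm wA wB)) z) (weval (wpow wA (1 + 8 * p * u)) z)"
proof -
  have "weval (wconj wA (wcomm wA wB)) z = weval (winv wC) (aact 1 (weval wC z))"
    by (simp add: wconj_def wC_def wA_def letact_def)
  moreover have "eqv \<dots> (ciact (aact 1 (cact z)))"
    using weval_winv_wC eqv_ciact[OF eqv_aact[OF weval_wC]] eqv_trans by blast
  moreover have "ciact (aact 1 (cact z)) = aact (1 + 8 * p * u) (ciact (cact z))"
    by (simp add: ciact_def aact_def algebra_simps)
  moreover have "eqv \<dots> (aact (1 + 8 * p * u) z)" by (intro eqv_aact cgr_imp_eqv ciact_cact)
  ultimately show ?thesis unfolding weval_wpow_wA using eqv_trans by metis
qed

lemma weval_rel2:
  assumes "[b = int \<beta>] (mod int period)"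
  shows "eqv (weval (wconj wB (wcomm wB wA)) z) (weval (wpow wB b) z)"
proof -
  let ?B = "\<lambda>z. (binv ^^ (period - 1)) z"
  define y where "y = cact (?B (ciact z))"
  have "weval (wconj wB (wcomm wB wA)) z = weval wC (?B (weval (winv wC) z))"
    unfolding winv_wC[symmetric] by (simp add: wconj_def wB_def letact_def)
  moreover have "eqv \<dots> y"
    unfolding y_def using weval_wC eqv_cact[OF eqv_binv_funpow[OF weval_winv_wC]] eqv_trans by blast
  ultimately have 1: "eqv (weval (wconj wB (wcomm wB wA)) z) y" by simp
  have "eqv (ciact y) (?B (ciact z))" unfolding y_def by (rule cgr_imp_eqv[OF ciact_cact])
  from eqv_binv[OF this] have "eqv (binv (ciact y)) (ciact z)"
    using letact_cancel[of True True "ciact z"] eqv_trans by (simp add: letact_def)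
  from eqv_cact[OF this] have "eqv (cact (binv (ciact y))) z"
    using cgr_imp_eqv[OF cact_ciact] eqv_trans by blast
  with binv_beta[of y] have 2: "eqv ((binv ^^ \<beta>) y) z" using eqv_trans by blast
  define n where "n = (period - 1) * \<beta>"
  have "n + \<beta> = period * \<beta>" using period_pos unfolding n_def by (cases period) simp_all
  then have "(binv ^^ n) ((binv ^^ \<beta>) y) = (binv ^^ (period * \<beta>)) y"
    using funpow_add[of n \<beta> binv] by simp
  then have "eqv ((binv ^^ n) ((binv ^^ \<beta>) y)) y" using cgr_imp_eqv[OF binv_funpow_period] by simp
  with eqv_binv_funpow[OF 2, of n] have 3: "eqv y ((binv ^^ n) z)" using eqv_sym eqv_trans by blast
  have "int n - (- int \<beta>) = int period * int \<beta>" using \<open>n + \<beta> = period * \<beta>\<close> by (metis diff_minus_eq_add of_nat_add of_nat_mult)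
  then have "[int n = - int \<beta>] (mod int period)" by (simp only: cong_iff_dvd_diff dvd_triv_left)
  moreover have "[- int \<beta> = - b] (mod int period)" using assms cong_sym by (simp add: cong_minus_minus_iff)
  ultimately have "[int n = - b] (mod int period)" using cong_trans by blast
  from weval_wpow_wB[OF this] 1 3 show ?thesis using eqv_sym eqv_trans by blast
qed

text \<open>Here b is the integer exponent of the presentation, while the model uses a natural
  number congruent to it modulo the period.\<close>

theorem weq_eqv:
  assumes "[b = int \<beta>] (mod int period)" "weq (1 + 8 * p * u) b w w'"
  shows "eqv (weval w z) (weval w' z)"
  using assms(2)
proof (induction arbitrary: z rule: weq.induct)
  case (sym w w')
  then show ?case using eqv_sym by blast
next
  case (trans w w' w'')
  then show ?case using eqv_trans by blast
next
  case (cancel x e g y)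
  show ?case using eqv_weval[OF letact_cancel[of e g "weval y z"], of x] by simp
next
  case (rel1 x y)
  show ?case using eqv_weval[OF weval_rel1[of "weval y z"], of x] by simp
next
  case (rel2 x y)
  show ?case using eqv_weval[OF weval_rel2[OF assms(1), of "weval y z"], of x] by simp
qed simp

lemma weval_normal_form: "eqv (weval (wpow wA i @ wpow wB j @ wpow wC k) (0, 0)) (i, j)"
proof -
  have c: "cact (0, 0) = (0, 0)" "ciact (0, 0) = (0, 0)" by (simp_all add: cact_def ciact_def)
  have rep: "eqv (weval (concat (replicate n w)) (0, 0)) (0, 0)" if "eqv (weval w (0, 0)) (0, 0)" for n w
  proof (induction n)
    case (Suc n)
    from eqv_weval[OF this, of w] that show ?case using eqv_trans by simp
  qed simp
  have "eqv (weval (wpow wC k) (0, 0)) (0, 0)"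
    using rep[of wC "nat k"] rep[of "winv wC" "nat (- k)"] weval_wC[of "(0, 0)"] weval_winv_wC[of "(0, 0)"]
    by (simp add: wpow_def c)
  from eqv_weval[OF this, of "wpow wB j"]
  have 1: "eqv (weval (wpow wB j) (weval (wpow wC k) (0, 0))) (weval (wpow wB j) (0, 0))" .
  define n where "n = nat ((- j) mod int period)"
  have n: "int n = (- j) mod int period" using period_pos by (simp add: n_def)
  then have "[int n = - j] (mod int period)" by (simp add: cong_def)
  from weval_wpow_wB[OF this] have 2: "eqv (weval (wpow wB j) (0, 0)) ((binv ^^ n) (0, 0))" .
  have "(binv ^^ i) (0, 0) = (0, - int i)" for i
    by (induction i) (simp_all add: binv_def gfun_def efun_def)
  moreover have "[- int n = j] (mod q)"
  proof -
    have "int period dvd int n - (- j)" using \<open>[int n = - j] (mod int period)\<close> by (simp only: cong_iff_dvd_diff)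
    then have "q dvd int n - (- j)" unfolding int_period using dvd_mult_right by blast
    then have "q dvd - (- int n - j)" by (simp add: algebra_simps)
    then show ?thesis unfolding cong_iff_dvd_diff by (simp only: dvd_minus_iff)
  qed
  ultimately have 3: "eqv ((binv ^^ n) (0, 0)) (0, j)" by (intro cgr_imp_eqv) (simp add: cgr_def)
  from eqv_trans[OF eqv_trans[OF 1 2] 3] have "eqv (aact i (weval (wpow wB j) (weval (wpow wC k) (0, 0)))) (aact i (0, j))"
    by (rule eqv_aact)
  then show ?thesis by (simp add: weval_wpow_wA aact_def)
qed

text \<open>Reducing the first coordinate modulo 32 p^2 gives i = i', and then 8p divides k as u is
  odd. So the second shift is a multiple of q.\<close>

lemma eqv_unique:
  assumes "eqv (i, j) (i', j')" "0 \<le> i" "i < 32 * p\<^sup>2" "0 \<le> i'" "i' < 32 * p\<^sup>2" "0 \<le> j" "j < q" "0 \<le> j'" "j' < q"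
  shows "i = i' \<and> j = j'"
proof -
  obtain k r s y where "fst (i', j') = fst (i, j) + k * (32 * p\<^sup>2 * u\<^sup>2) + q * r"
    and "snd (i', j') = snd (i, j) + k * (32 * p\<^sup>2 * v\<^sup>2 + 128 * p ^ 3 * snd (i, j)) + q * s"
    by (rule eqvE[OF assms(1)])
  then have 1: "i' = i + k * (32 * p\<^sup>2 * u\<^sup>2) + q * r"
    and 2: "j' = j + k * (32 * p\<^sup>2 * v\<^sup>2 + 128 * p ^ 3 * j) + q * s" by simp_all
  have "i' - i = 32 * p\<^sup>2 * (k * u\<^sup>2 + 8 * p * r)"
    unfolding 1 by (simp add: algebra_simps power2_eq_square power3_eq_cube)
  then have "[i' = i] (mod 32 * p\<^sup>2)" by (simp only: cong_iff_dvd_diff dvd_triv_left)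
  then have i: "i = i'" using assms(2-5) by (simp add: cong_def)
  then have "32 * p\<^sup>2 * (k * u\<^sup>2 + 8 * p * r) = 0" using \<open>i' - i = _\<close> by simp
  then have "k * u\<^sup>2 + 8 * p * r = 0" using p_pos by simp
  then have "k * u\<^sup>2 = 8 * p * (- r)" by simp
  then have "8 * p dvd k * u\<^sup>2" by (metis dvd_triv_left)
  moreover obtain e where "p = 2 ^ e" using p by blast
  then have "8 * p = 2 ^ (e + 3)" by (simp add: power_add)
  then have "coprime (8 * p) (u\<^sup>2)" using odd_u by simp
  ultimately have "8 * p dvd k" by (simp add: coprime_dvd_mult_left_iff)
  then obtain k' where k: "k = 8 * p * k'" by blast
  have "j' - j = q * (k' * (v\<^sup>2 + 4 * p * j) + s)"
    unfolding 2 k by (simp add: algebra_simps power2_eq_square power3_eq_cube)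
  then have "[j' = j] (mod q)" by (simp only: cong_iff_dvd_diff dvd_triv_left)
  then have "j = j'" using assms(6-9) by (simp add: cong_def)
  then show ?thesis using i by simp
qed

text \<open>Now the second coordinate forces 8p to divide k, as v is odd. This is the lower bound
  for the order of a.\<close>

lemma eqv_zero:
  assumes "eqv (i, 0) (0, 0)"
  shows "q dvd i"
proof -
  obtain k r s y where "fst (0::int, 0::int) = fst (i, 0::int) + k * (32 * p\<^sup>2 * u\<^sup>2) + q * r"
    and "snd (0::int, 0::int) = snd (i, 0::int) + k * (32 * p\<^sup>2 * v\<^sup>2 + 128 * p ^ 3 * snd (i, 0::int)) + q * s"
    by (rule eqvE[OF assms])
  then have 1: "i = - (k * (32 * p\<^sup>2 * u\<^sup>2)) - q * r" and "32 * p\<^sup>2 * (k * v\<^sup>2 + 8 * p * s) = 0"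
    by (simp_all add: algebra_simps power2_eq_square power3_eq_cube)
  then have "k * v\<^sup>2 = 8 * p * (- s)" using p_pos by simp
  then have "8 * p dvd k * v\<^sup>2" by (metis dvd_triv_left)
  moreover obtain e where "p = 2 ^ e" using p by blast
  then have "8 * p = 2 ^ (e + 3)" by (simp add: power_add)
  then have "coprime (8 * p) (v\<^sup>2)" using odd_v by simp
  ultimately have "8 * p dvd k" by (simp add: coprime_dvd_mult_left_iff)
  then obtain k' where k: "k = 8 * p * k'" by blast
  have "i = q * (- (k' * u\<^sup>2) - r)" unfolding 1 k by (simp add: algebra_simps power2_eq_square power3_eq_cube)
  then show ?thesis by (simp only: dvd_triv_left)
qed

end

section \<open>Order and nilpotency class of the 2-part\<close>

context group
begin

lemma gcomm_closed [simp]: "x \<in> carrier G \<Longrightarrow> y \<in> carrier G \<Longrightarrow> gcomm G x y \<in> carrier G"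
  by (simp add: gcomm_def)

text \<open>The preimage of the centre of G/N, so that \<open>ucs\<close> is the upper central
  series.\<close>

definition zc :: "'a set \<Rightarrow> 'a set" where
  "zc N = {x \<in> carrier G. \<forall>y\<in>carrier G. gcomm G x y \<in> N}"

lemma gcomm_swap: "x \<in> carrier G \<Longrightarrow> y \<in> carrier G \<Longrightarrow> gcomm G y x = inv (gcomm G x y)"
  by (simp add: gcomm_def inv_mult_group m_assoc)

lemma gcomm_mult_left:
  "x \<in> carrier G \<Longrightarrow> y \<in> carrier G \<Longrightarrow> z \<in> carrier G \<Longrightarrow> gcomm G (x \<otimes> y) z = inv y \<otimes> gcomm G x z \<otimes> y \<otimes> gcomm G y z"
  by (simp add: gcomm_def inv_mult_group m_assoc)

lemma gcomm_inv_left: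
  "x \<in> carrier G \<Longrightarrow> z \<in> carrier G \<Longrightarrow> gcomm G (inv x) z = x \<otimes> inv (gcomm G x z) \<otimes> inv x"
  by (simp add: gcomm_def inv_mult_group m_assoc)

lemma gcomm_kernel_subgroup:
  assumes "N \<lhd> G" "y \<in> carrier G"
  shows "subgroup {x \<in> carrier G. gcomm G x y \<in> N} G"
proof (rule subgroupI)
  interpret N: normal N G by (rule assms)
  have "gcomm G \<one> y = \<one>" using assms(2) by (simp add: gcomm_def)
  then show "{x \<in> carrier G. gcomm G x y \<in> N} \<noteq> {}" using N.one_closed by (intro ex_in_conv[THEN iffD1] exI[of _ \<one>]) simp
  show "inv x \<in> {x \<in> carrier G. gcomm G x y \<in> N}" if "x \<in> {x \<in> carrier G. gcomm G x y \<in> N}" for x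
    using that assms(2) N.inv_op_closed2[of x "inv (gcomm G x y)"] by (simp add: gcomm_inv_left)
  show "x \<otimes> x' \<in> {x \<in> carrier G. gcomm G x y \<in> N}"
    if "x \<in> {x \<in> carrier G. gcomm G x y \<in> N}" "x' \<in> {x \<in> carrier G. gcomm G x y \<in> N}" for x x'
    using that assms(2) N.inv_op_closed1[of x' "gcomm G x y"] by (simp add: gcomm_mult_left)
qed auto

lemma gcomm_kernel_subgroup':
  assumes "N \<lhd> G" "y \<in> carrier G"
  shows "subgroup {x \<in> carrier G. gcomm G y x \<in> N} G"
proof -
  interpret N: normal N G by (rule assms)
  have "gcomm G y x \<in> N \<longleftrightarrow> gcomm G x y \<in> N" if "x \<in> carrier G" for x
  proof
    show "gcomm G x y \<in> N" if "gcomm G y x \<in> N"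
      using N.m_inv_closed[OF that] assms(2) \<open>x \<in> carrier G\<close> by (simp add: gcomm_swap[of y x])
    show "gcomm G y x \<in> N" if "gcomm G x y \<in> N"
      using N.m_inv_closed[OF that] assms(2) \<open>x \<in> carrier G\<close> by (simp add: gcomm_swap[of x y])
  qed
  then have "{x \<in> carrier G. gcomm G y x \<in> N} = {x \<in> carrier G. gcomm G x y \<in> N}" by auto
  then show ?thesis using gcomm_kernel_subgroup[OF assms] by simp
qed

lemma zc_normal:
  assumes "N \<lhd> G"
  shows "zc N \<lhd> G"
proof (rule normal_invI)
  interpret N: normal N G by (rule assms)
  have "zc N = (\<Inter>y\<in>carrier G. {x \<in> carrier G. gcomm G x y \<in> N})"
    unfolding zc_def by auto
  moreover have "subgroup (\<Inter>y\<in>carrier G. {x \<in> carrier G. gcomm G x y \<in> N}) G"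
    by (rule subgroups_Inter) (auto intro: gcomm_kernel_subgroup[OF assms])
  ultimately show "subgroup (zc N) G" by simp
  show "x \<otimes> h \<otimes> inv x \<in> zc N" if x: "x \<in> carrier G" and h: "h \<in> zc N" for x h
  proof -
    have hc: "h \<in> carrier G" and hN: "\<And>y. y \<in> carrier G \<Longrightarrow> gcomm G h y \<in> N" using h by (auto simp: zc_def)
    have "gcomm G (x \<otimes> h \<otimes> inv x) y \<in> N" if y: "y \<in> carrier G" for y
    proof -
      have "gcomm G (x \<otimes> h \<otimes> inv x) y = x \<otimes> gcomm G h (inv x \<otimes> y \<otimes> x) \<otimes> inv x"
        using x hc y by (simp add: gcomm_def inv_mult_group m_assoc)
      then show ?thesis using N.inv_op_closed2[OF x hN] x y by simp
    qed
    then show ?thesis using x hc by (simp add: zc_def)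
  qed
qed

primrec ucs :: "nat \<Rightarrow> 'a set" where
  "ucs 0 = {\<one>}"
| "ucs (Suc n) = zc (ucs n)"

lemma ucs_normal: "ucs n \<lhd> G"
  by (induction n) (simp_all add: one_is_normal zc_normal)

lemma ucs_subgroup: "subgroup (ucs n) G"
  using ucs_normal normal_imp_subgroup by blast

text \<open>Modulo a normal subgroup the elements commuting with x form a subgroup, so two
  generators decide.\<close>

lemma ucs_memI:
  assumes "carrier G = generate G {a, b}" "a \<in> carrier G" "b \<in> carrier G" "x \<in> carrier G"
    and "gcomm G x a \<in> ucs n" "gcomm G x b \<in> ucs n"
  shows "x \<in> ucs (Suc n)"
proof -
  have "generate G {a, b} \<subseteq> {y \<in> carrier G. gcomm G x y \<in> ucs n}"
    using assms by (intro generate_subgroup_incl gcomm_kernel_subgroup' ucs_normal) auto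
  then show ?thesis using assms(1,4) by (auto simp: zc_def)
qed

lemma lcs_eq_trivial:
  assumes "ucs n = carrier G"
  shows "lcs G n = {\<one>}"
proof -
  have "lcs G i \<subseteq> ucs (n - i)" if "i \<le> n" for i
    using that
  proof (induction i)
    case (Suc i)
    then have IH: "lcs G i \<subseteq> ucs (Suc (n - Suc i))" by (simp add: Suc_diff_Suc)
    have "{gcomm G x y |x y. x \<in> lcs G i \<and> y \<in> carrier G} \<subseteq> ucs (n - Suc i)"
      using IH by (auto simp: zc_def)
    then show ?case using generate_subgroup_incl[OF _ ucs_subgroup] by simp
  qed (simp add: assms)
  from this[of n] have "lcs G n \<subseteq> {\<one>}" by simp
  moreover have "\<one> \<in> lcs G n" by (cases n) (auto intro: generate.one)
  ultimately show ?thesis by blast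
qed

lemma lcs_mem_carrier: "lcs G n \<subseteq> carrier G"
proof (induction n)
  case (Suc n)
  then have "{gcomm G x y |x y. x \<in> lcs G n \<and> y \<in> carrier G} \<subseteq> carrier G" by auto
  then show ?case using generate_incl by simp
qed simp

lemma lcs_gcomm: "x \<in> lcs G n \<Longrightarrow> y \<in> carrier G \<Longrightarrow> gcomm G x y \<in> lcs G (Suc n)"
  by (auto intro: generate.incl)

lemma lcs_inv: "x \<in> lcs G n \<Longrightarrow> inv x \<in> lcs G n"
proof (cases n)
  case (Suc k)
  assume "x \<in> lcs G n"
  moreover have "{gcomm G x y |x y. x \<in> lcs G k \<and> y \<in> carrier G} \<subseteq> carrier G" using lcs_mem_carrier[of k] by auto
  ultimately show ?thesis using generate_m_inv_closed by (simp add: Suc)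
qed simp

lemma lcs_trivial_Suc:
  assumes "lcs G n = {\<one>}"
  shows "lcs G (n + k) = {\<one>}"
proof (induction k)
  case (Suc k)
  have "{gcomm G x y |x y. x \<in> lcs G (n + k) \<and> y \<in> carrier G} \<subseteq> {\<one>}"
    unfolding Suc by (auto simp: gcomm_def)
  then have "generate G {gcomm G x y |x y. x \<in> lcs G (n + k) \<and> y \<in> carrier G} \<subseteq> {\<one>}"
    by (rule generate_subgroup_incl[OF _ triv_subgroup])
  then show ?case using generate.one by auto
qed (simp add: assms)

end

section \<open>Upper central series of the 2-part\<close>

locale macdonald_two_gen = macdonald_two +
  assumes gen: "carrier G = generate G {A, B}"
begin

lemma macdonald_two_gen_swap: "macdonald_two_gen G B A (inv C) \<beta> \<alpha> m L v u (- \<eta>)"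
proof (intro macdonald_two_gen.intro macdonald_two_gen_axioms.intro macdonald_two_swap)
  show "carrier G = generate G {B, A}" using gen by (simp add: insert_commute)
qed

lemma ucs_gen:
  "gcomm G x A \<in> ucs n \<Longrightarrow> gcomm G x B \<in> ucs n \<Longrightarrow> x \<in> carrier G \<Longrightarrow> k = Suc n \<Longrightarrow> x \<in> ucs k"
  using ucs_memI[OF gen A B] by blast

lemma gcomm_C_pow_A: "gcomm G (C [^] (n::nat)) A = A [^] (1 - int \<alpha> ^ n)"
  using conj_C_pow_A[of n] by (simp add: gcomm_def m_assoc)

lemma gcomm_C_pow_B: "gcomm G (C [^] (n::nat)) B = inv (C [^] n) \<otimes> B [^] (int \<beta> ^ n - 1) \<otimes> C [^] n"
  using conj_C_pow_B[of n] by (simp add: gcomm_def m_assoc)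

lemma gcomm_A_pow_A: "gcomm G (A [^] (n::nat)) A = \<one>"
  using nat_pow_comm[of A n 1] by (simp add: gcomm_def m_assoc)

lemma gcomm_A_pow_B: "gcomm G (A [^] (n::nat)) B = inv (A [^] n) \<otimes> C [^] n \<otimes> A [^] n \<otimes> A [^] tsum (int \<alpha>) n"
  using conj_A_pow_B[of n] by (simp add: gcomm_def m_assoc tsum_def int_pow_int[symmetric] int_pow_add)

lemma ucs_conj: "x \<in> ucs n \<Longrightarrow> g \<in> carrier G \<Longrightarrow> inv g \<otimes> x \<otimes> g \<in> ucs n"
  using normal.inv_op_closed1[OF ucs_normal] by blast

lemma ucs_mult: "x \<in> ucs n \<Longrightarrow> y \<in> ucs n \<Longrightarrow> x \<otimes> y \<in> ucs n"
  using subgroup.m_closed[OF ucs_subgroup] by blast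

lemma ucs_int_pow: "x [^] ((2::nat) ^ e) \<in> ucs n \<Longrightarrow> x \<in> carrier G \<Longrightarrow> 2 ^ e dvd (j::int) \<Longrightarrow> x [^] j \<in> ucs n"
proof -
  assume x: "x [^] ((2::nat) ^ e) \<in> ucs n" "x \<in> carrier G" and "2 ^ e dvd j"
  then obtain k where "j = 2 ^ e * k" by blast
  then have "x [^] j = (x [^] ((2::nat) ^ e)) [^] k" using x(2)
    by (simp add: int_pow_int[symmetric] int_pow_pow)
  then show ?thesis using subgroup_int_pow_closed[OF ucs_subgroup x(1)] by simp
qed

lemma ucs_one: "\<one> \<in> ucs n"
  using subgroup.one_closed[OF ucs_subgroup] .

lemma alpha_dvd: "2 ^ m dvd int \<alpha> - 1"
  by (simp add: alpha)

lemma A_in_ucs1: "A [^] ((2::nat) ^ (2 * m)) \<in> ucs 1"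
proof -
  have "gcomm G (A [^] ((2::nat) ^ (2 * m))) B = \<one>"
  proof -
    have "A [^] ((2::nat) ^ (2 * m)) \<otimes> B = B \<otimes> A [^] ((2::nat) ^ (2 * m))"
      using A_2m_commutes_B[OF dvd_refl] int_pow_int[of G A "2 ^ (2 * m)"] by simp
    then show ?thesis by (simp add: gcomm_def m_assoc)
  qed
  then have B0: "gcomm G (A [^] ((2::nat) ^ (2 * m))) B \<in> ucs 0" by simp
  have "gcomm G (A [^] ((2::nat) ^ (2 * m))) A \<in> ucs 0" by (simp add: gcomm_A_pow_A)
  from this B0 show ?thesis by (rule ucs_gen) simp_all
qed

text \<open>[A^n, B] is a conjugate of C^n times A^(\<open>tsum\<close>). At n = 2^(2m-1) the power
  of C is trivial and the sum is divisible by 2^(2m). At n = 2^m the same formula gives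
  \<open>A_in_ucs3\<close>.\<close>

lemma A_in_ucs2: "A [^] ((2::nat) ^ (2 * m - 1)) \<in> ucs 2"
proof -
  have C1: "C [^] ((2::nat) ^ (2 * m - 1)) = \<one>"
    using C_pow_order[OF dvd_refl] int_pow_int[of G C "2 ^ (2 * m - 1)"] by simp
  have "2 ^ (m + (2 * m - 1) - 1) dvd tsum (int \<alpha>) (2 ^ (2 * m - 1) * 1)"
    by (rule pow2_dvd_tsum[OF alpha_dvd]) (use m in simp)
  then have "2 ^ (2 * m) dvd tsum (int \<alpha>) (2 ^ (2 * m - 1))"
    using pow2_dvd_mono[of "2 * m" "m + (2 * m - 1) - 1"] m by simp
  then have "A [^] tsum (int \<alpha>) (2 ^ (2 * m - 1)) \<in> ucs 1" by (rule ucs_int_pow[OF A_in_ucs1 A])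
  then have B1: "gcomm G (A [^] ((2::nat) ^ (2 * m - 1))) B \<in> ucs 1" unfolding gcomm_A_pow_B C1 by simp
  have "gcomm G (A [^] ((2::nat) ^ (2 * m - 1))) A \<in> ucs 1" by (simp only: gcomm_A_pow_A ucs_one)
  from this B1 show ?thesis by (rule ucs_gen) simp_all
qed

lemma B_in_ucs: "B [^] ((2::nat) ^ (2 * m)) \<in> ucs 1" "B [^] ((2::nat) ^ (2 * m - 1)) \<in> ucs 2"
proof -
  interpret swap: macdonald_two_gen G B A "inv C" \<beta> \<alpha> m L v u "- \<eta>" by (rule macdonald_two_gen_swap)
  show "B [^] ((2::nat) ^ (2 * m)) \<in> ucs 1" "B [^] ((2::nat) ^ (2 * m - 1)) \<in> ucs 2"
    by (fact swap.A_in_ucs1 swap.A_in_ucs2)+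
qed

lemma C_in_ucs2: "C [^] ((2::nat) ^ m) \<in> ucs 2"
proof -
  have "2 ^ (m + m) dvd int \<alpha> ^ (2 ^ m) - 1" using pow2_dvd_power_minus_one[OF alpha_dvd] m by simp
  then have "2 ^ (2 * m) dvd 1 - int \<alpha> ^ (2 ^ m)" by (simp only: mult_2 dvd_diff_commute)
  then have 1: "gcomm G (C [^] ((2::nat) ^ m)) A \<in> ucs 1"
    unfolding gcomm_C_pow_A by (rule ucs_int_pow[OF A_in_ucs1 A])
  have "2 ^ m dvd int \<beta> - 1" by (simp add: beta)
  then have "2 ^ (m + m) dvd int \<beta> ^ (2 ^ m) - 1" using pow2_dvd_power_minus_one m by simp
  then have "2 ^ (2 * m) dvd int \<beta> ^ (2 ^ m) - 1" by (simp only: mult_2)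
  then have "B [^] (int \<beta> ^ (2 ^ m) - 1) \<in> ucs 1" by (rule ucs_int_pow[OF B_in_ucs(1) B])
  then have "gcomm G (C [^] ((2::nat) ^ m)) B \<in> ucs 1"
    unfolding gcomm_C_pow_B by (rule ucs_conj) simp
  with 1 show ?thesis by (rule ucs_gen) simp_all
qed

lemma A_in_ucs3: "A [^] ((2::nat) ^ m) \<in> ucs 3"
proof -
  have "2 ^ (m + m - 1) dvd tsum (int \<alpha>) (2 ^ m * 1)"
    by (rule pow2_dvd_tsum[OF alpha_dvd]) (use m in simp)
  then have "2 ^ (2 * m - 1) dvd tsum (int \<alpha>) (2 ^ m)" by (simp add: mult_2)
  then have "A [^] tsum (int \<alpha>) (2 ^ m) \<in> ucs 2" by (rule ucs_int_pow[OF A_in_ucs2 A])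
  moreover have "inv (A [^] ((2::nat) ^ m)) \<otimes> C [^] ((2::nat) ^ m) \<otimes> A [^] ((2::nat) ^ m) \<in> ucs 2"
    by (rule ucs_conj[OF C_in_ucs2]) simp
  ultimately have B2: "gcomm G (A [^] ((2::nat) ^ m)) B \<in> ucs 2" unfolding gcomm_A_pow_B by (rule ucs_mult[rotated])
  have "gcomm G (A [^] ((2::nat) ^ m)) A \<in> ucs 2" by (simp only: gcomm_A_pow_A ucs_one)
  from this B2 show ?thesis by (rule ucs_gen) simp_all
qed

lemma B_in_ucs3: "B [^] ((2::nat) ^ m) \<in> ucs 3"
proof -
  interpret swap: macdonald_two_gen G B A "inv C" \<beta> \<alpha> m L v u "- \<eta>" by (rule macdonald_two_gen_swap)
  show ?thesis by (fact swap.A_in_ucs3)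
qed

lemma C_in_ucs4: "C \<in> ucs 4"
proof -
  have "2 ^ m dvd 1 - int \<alpha>" using alpha_dvd by (simp only: dvd_diff_commute)
  then have "A [^] (1 - int \<alpha>) \<in> ucs 3" by (rule ucs_int_pow[OF A_in_ucs3 A])
  then have 1: "gcomm G C A \<in> ucs 3" using gcomm_C_pow_A[of 1] by simp
  have "2 ^ m dvd int \<beta> - 1" by (simp add: beta)
  then have "B [^] (int \<beta> - 1) \<in> ucs 3" by (rule ucs_int_pow[OF B_in_ucs3 B])
  then have "gcomm G C B \<in> ucs 3" using gcomm_C_pow_B[of 1] ucs_conj[of _ 3 C] by simp
  with 1 show ?thesis by (rule ucs_gen) simp_all
qed

lemma gcomm_A_B: "gcomm G A B = C"
  unfolding gcomm_def by (simp add: m_assoc AB)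

lemma ucs5: "ucs 5 = carrier G"
proof -
  have "gcomm G A A = \<one>" "gcomm G B B = \<one>" by (simp_all add: gcomm_def m_assoc)
  moreover have "gcomm G B A = inv C" using gcomm_swap[of A B] gcomm_A_B by simp
  ultimately have "A \<in> ucs 5" "B \<in> ucs 5"
    using ucs_gen[of A 4 5] ucs_gen[of B 4 5] C_in_ucs4 subgroup.m_inv_closed[OF ucs_subgroup C_in_ucs4] gcomm_A_B ucs_one
    by simp_all
  then have "{A, B} \<subseteq> ucs 5" by simp
  then have "generate G {A, B} \<subseteq> ucs 5" by (rule generate_subgroup_incl[OF _ ucs_subgroup])
  then show ?thesis using gen subgroup.subset[OF ucs_subgroup] by blast
qed

lemma lcs5: "lcs G 5 = {\<one>}"
  by (rule lcs_eq_trivial[OF ucs5])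

end

text \<open>The added assumptions are the lower bounds supplied by the model; the ranges of i and j
  are those of \<open>eqv_unique\<close>.\<close>

locale macdonald_two_full = macdonald_two_gen +
  assumes order_A: "\<And>i::int. A [^] i = \<one> \<Longrightarrow> 2 ^ (3 * m - 1) dvd i"
    and normal_form_inj: "\<And>(i::int) (i'::int) (j::int) (j'::int) (k::int) (k'::int). A [^] i \<otimes> B [^] j \<otimes> C [^] k = A [^] i' \<otimes> B [^] j' \<otimes> C [^] k'
       \<Longrightarrow> 0 \<le> i \<Longrightarrow> i < 2 ^ (2 * m - 1) \<Longrightarrow> 0 \<le> i' \<Longrightarrow> i' < 2 ^ (2 * m - 1)
       \<Longrightarrow> 0 \<le> j \<Longrightarrow> j < 2 ^ (3 * m - 1) \<Longrightarrow> 0 \<le> j' \<Longrightarrow> j' < 2 ^ (3 * m - 1) \<Longrightarrow> i = i' \<and> j = j'"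
begin

lemma C_representative: "\<exists>n::nat. C [^] (k::int) = C [^] n"
  using nat_representative[of k] int_pow_cong[OF C torsC] by (metis int_pow_int)

lemma C_int_pow_B_pow: "\<exists>w::int. \<forall>j::int. C [^] (k::int) \<otimes> B [^] j = B [^] (j * w) \<otimes> C [^] k"
  using C_representative[of k] C_pow_B_pow by metis

definition nf :: "'a set" where
  "nf = {A [^] i \<otimes> B [^] j \<otimes> C [^] k | (i::int) (j::int) (k::int). True}"

lemma nfI: "x = A [^] (i::int) \<otimes> B [^] (j::int) \<otimes> C [^] (k::int) \<Longrightarrow> x \<in> nf"
  by (auto simp: nf_def)

lemma nfE: "x \<in> nf \<Longrightarrow> \<exists>(i::int) (j::int) (k::int). x = A [^] i \<otimes> B [^] j \<otimes> C [^] k"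
  by (auto simp: nf_def)

lemma nf_mult_A: "x \<in> nf \<Longrightarrow> A [^] (l::int) \<otimes> x \<in> nf"
proof -
  assume "x \<in> nf"
  then obtain i j k :: int where "x = A [^] i \<otimes> B [^] j \<otimes> C [^] k" using nfE by blast
  then have "A [^] l \<otimes> x = A [^] (l + i) \<otimes> B [^] j \<otimes> C [^] k" by (simp add: m_assoc int_pow_add_assoc)
  then show ?thesis by (rule nfI)
qed

text \<open>The identity \<open>b\<^sup>-\<^sup>1 a\<^sup>n = a\<^sup>* c\<^sup>n b\<^sup>-\<^sup>1\<close> makes the set of normal forms invariant under \<open>b\<^sup>-\<^sup>1\<close>.\<close>
lemma nf_mult_inv_B: "x \<in> nf \<Longrightarrow> inv B \<otimes> x \<in> nf"
proof -
  assume "x \<in> nf"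
  then obtain i j k :: int where x: "x = A [^] i \<otimes> B [^] j \<otimes> C [^] k" using nfE by blast
  obtain n :: nat where n: "2 ^ L dvd int n - i" using nat_representative by blast
  have An: "A [^] i = A [^] n" using int_pow_cong[OF A torsA n] by (simp add: int_pow_int)
  obtain w where w: "\<And>j::int. C [^] n \<otimes> A [^] j = A [^] (j * w) \<otimes> C [^] n" using C_pow_A_pow[of n] by blast
  obtain l :: int where l: "C [^] n \<otimes> A [^] (int \<alpha> * gsum (int \<alpha>) n) = A [^] l \<otimes> C [^] n" using w by blast
  have "inv B \<otimes> A [^] n = inv B \<otimes> A [^] n \<otimes> B \<otimes> inv B" by (simp add: m_assoc)
  also have "\<dots> = A [^] l \<otimes> C [^] n \<otimes> B [^] (- 1 :: int)"
    unfolding conj_A_pow_B l by (simp add: int_pow_neg)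
  finally have *: "inv B \<otimes> A [^] n = A [^] l \<otimes> C [^] n \<otimes> B [^] (- 1 :: int)" .
  have "inv B \<otimes> x = (inv B \<otimes> A [^] n) \<otimes> B [^] j \<otimes> C [^] k" unfolding x An by (simp add: m_assoc)
  also have "\<dots> = A [^] l \<otimes> (C [^] n \<otimes> B [^] (- 1 + j)) \<otimes> C [^] k"
    unfolding * by (simp add: m_assoc int_pow_add_assoc)
  also have "\<dots> = A [^] l \<otimes> B [^] ((- 1 + j) * int \<beta> ^ n) \<otimes> C [^] (int n + k)"
    unfolding C_pow_B_pow by (simp add: m_assoc int_pow_mult int_pow_int)
  finally show ?thesis by (rule nfI)
qed

lemma carrier_eq_nf: "carrier G = nf"
proof
  show "nf \<subseteq> carrier G" by (auto simp: nf_def)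
  define S where "S = {g \<in> carrier G. \<forall>x\<in>nf. g \<otimes> x \<in> nf}"
  have nfc: "x \<in> carrier G" if "x \<in> nf" for x using that by (auto simp: nf_def)
  have SI: "g \<otimes> h \<in> S" if "g \<in> S" "h \<in> S" for g h
    using that nfc by (auto simp: S_def m_assoc)
  have A': "A \<in> S" "inv A \<in> S"
    using nf_mult_A[of _ 1] nf_mult_A[of _ "- 1"] by (simp_all add: S_def int_pow_neg)
  have B': "inv B \<in> S" using nf_mult_inv_B by (simp add: S_def)
  have one: "\<one> \<in> S" using nfc by (simp add: S_def)
  have pow: "(inv B) [^] n \<in> S" for n :: nat by (induction n) (simp_all add: one SI B')
  \<comment> \<open>B is a positive power of B^-1, so stability under B^-1 suffices.\<close>
  have "B = (inv B) [^] (2 ^ L - 1 :: nat)"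
  proof -
    have "B [^] (2 ^ L :: nat) = \<one>" using torsB int_pow_int[of G B "2 ^ L"] by simp
    then have "(inv B) [^] (2 ^ L :: nat) = \<one>" by (simp add: nat_pow_inv)
    moreover have "(2 ^ L :: nat) = Suc (2 ^ L - 1)" by simp
    ultimately have "(inv B) [^] (2 ^ L - 1 :: nat) \<otimes> inv B = \<one>" by (metis nat_pow_Suc)
    then have "(inv B) [^] (2 ^ L - 1 :: nat) \<otimes> inv B \<otimes> B = \<one> \<otimes> B" by simp
    then show ?thesis by (simp add: m_assoc)
  qed
  then have "B \<in> S" using pow[of "2 ^ L - 1"] by simp
  have "g \<in> S" if "g \<in> generate G {A, B}" for g
    using that by (induction rule: generate.induct) (use one A' B' \<open>B \<in> S\<close> SI in auto)
  moreover have "\<one> \<in> nf" by (rule nfI[of _ 0 0 0]) simp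
  ultimately show "carrier G \<subseteq> nf" unfolding gen[symmetric] S_def by fastforce
qed

text \<open>A^i is a power of A^fA, which \<open>A_pow_fA\<close> rewrites without A. This cuts the
  range of i down to 2^(2m-1).\<close>

lemma A_half_reduce: "2 ^ (2 * m - 1) dvd i \<Longrightarrow> \<exists>(j::int) (k::int). A [^] (i::int) = B [^] j \<otimes> C [^] k"
proof -
  assume "2 ^ (2 * m - 1) dvd i"
  then obtain z where z: "i = 2 ^ (2 * m - 1) * z" by blast
  obtain g y where g: "A [^] fA = C [^] (int \<alpha> - int \<beta>) \<otimes> B [^] (g::int)" "odd y" "g = 2 ^ (2 * m - 1) * y"
    by (rule A_pow_fA)
  obtain y' where y': "odd y'" "fA = 2 ^ (2 * m - 1) * y'" by (rule fA_factor)
  obtain w where w: "2 ^ L dvd y' * w - 1" using two_adic_inverse[OF y'(1)] by blast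
  have "fA * (w * z) - i = i * (y' * w - 1)" unfolding z y' by (simp add: algebra_simps)
  then have "A [^] i = A [^] (fA * (w * z))"
    using int_pow_cong[OF A torsA, of "fA * (w * z)" i] w by simp
  also have "\<dots> = (C [^] (int \<alpha> - int \<beta>) \<otimes> B [^] g) [^] (w * z)" by (simp only: int_pow_pow[symmetric] A g(1))
  also have "\<dots> = (C [^] (int \<alpha> - int \<beta>)) [^] (w * z) \<otimes> (B [^] g) [^] (w * z)"
    by (rule int_pow_mult_distrib) (simp_all add: C_N_commutes_B g)
  also have "\<dots> = C [^] ((int \<alpha> - int \<beta>) * (w * z)) \<otimes> B [^] (g * (w * z))" by (simp only: int_pow_pow B C)
  finally show ?thesis using C_int_pow_B_pow[of "(int \<alpha> - int \<beta>) * (w * z)"] by metis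
qed

text \<open>If C^n is trivial then A^(\<alpha>^n - 1) is trivial. By \<open>gsum_two_adic\<close>
  this exponent has valuation m + v_2(n), which must reach 3m-1.\<close>

lemma order_C: "C [^] (i::int) = \<one> \<Longrightarrow> 2 ^ (2 * m - 1) dvd i"
proof -
  assume C1: "C [^] i = \<one>"
  have C2: "C [^] nat \<bar>i\<bar> = \<one>"
    using int_pow_eq_one_mult[OF C C1, of "\<bar>i\<bar>"] by (simp add: int_pow_int[symmetric])
  define n where "n = nat \<bar>i\<bar>"
  have "C [^] n = \<one>" using C2 by (simp add: n_def)
  then have "A [^] (int \<alpha> ^ n) = A" using A_pow_C_pow[of 1 n] by simp
  then have "A [^] (int \<alpha> ^ n - 1) = \<one>" using int_pow_diff[of A "int \<alpha> ^ n" 1] by simp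
  then have d: "2 ^ (3 * m - 1) dvd int \<alpha> ^ n - 1" by (rule order_A)
  show ?thesis
  proof (cases "n = 0")
    case False
    then obtain x where x: "n = 2 ^ multiplicity 2 n * x" "odd x"
      using multiplicity_decompose'[of n 2] by auto
    have "4 dvd int \<alpha> - 1" using pow2_dvd_mono[of 2 m "int \<alpha> - 1"] alpha m by simp
    then obtain y where y: "odd y" "gsum (int \<alpha>) n = 2 ^ multiplicity 2 n * y"
      using gsum_two_adic[of "int \<alpha>" x "multiplicity 2 n"] x by auto
    have "int \<alpha> ^ n - 1 = 2 ^ (m + multiplicity 2 n) * (u * y)"
      unfolding gsum_geometric[symmetric] y by (simp add: alpha power_add)
    then have "2 ^ (3 * m - 1) dvd (2::int) ^ (m + multiplicity 2 n) * (u * y)" using d by simp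
    moreover have "coprime ((2::int) ^ (3 * m - 1)) (u * y)" using u y by simp
    ultimately have "(2::int) ^ (3 * m - 1) dvd 2 ^ (m + multiplicity 2 n)" by (simp add: coprime_dvd_mult_left_iff)
    then have "int (2 ^ (3 * m - 1)) dvd int (2 ^ (m + multiplicity 2 n))" by simp
    then have "(2::nat) ^ (3 * m - 1) dvd 2 ^ (m + multiplicity 2 n)" by (simp only: int_dvd_int_iff)
    then have "3 * m - 1 \<le> m + multiplicity 2 n" by (rule power_dvd_imp_le) simp
    then have "2 * m - 1 \<le> multiplicity 2 n" by simp
    then have "2 ^ (2 * m - 1) dvd n" using multiplicity_dvd' by blast
    then have "int (2 ^ (2 * m - 1)) dvd int n" by (simp only: int_dvd_int_iff)
    then show ?thesis by (simp add: n_def)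
  qed (simp add: n_def)
qed

text \<open>The ranges contribute (2m-1) + (3m-1) + (2m-1) to the exponent. Uniqueness of i and j
  comes from the model, that of k from \<open>order_C\<close>.\<close>

lemma card_carrier: "card (carrier G) = 2 ^ (7 * m - 3)"
proof -
  define T :: "(int \<times> int \<times> int) set" where "T = {0..<2 ^ (2 * m - 1)} \<times> {0..<2 ^ (3 * m - 1)} \<times> {0..<2 ^ (2 * m - 1)}"
  define \<phi> where "\<phi> = (\<lambda>(i, j, k). A [^] (i::int) \<otimes> B [^] (j::int) \<otimes> C [^] (k::int))"
  have "inj_on \<phi> T"
  proof (rule inj_onI)
    fix s t assume st: "s \<in> T" "t \<in> T" "\<phi> s = \<phi> t"
    obtain i j k where s: "s = (i, j, k)" by (cases s)
    obtain i' j' k' where t: "t = (i', j', k')" by (cases t)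
    have eq: "A [^] i \<otimes> B [^] j \<otimes> C [^] k = A [^] i' \<otimes> B [^] j' \<otimes> C [^] k'" using st(3) by (simp add: s t \<phi>_def)
    then have ij: "i = i'" "j = j'" using normal_form_inj[OF eq] st by (auto simp: s t T_def)
    then have "C [^] k = C [^] k'" using eq by simp
    then have "C [^] (k - k') = \<one>" by (simp add: int_pow_diff)
    then have "2 ^ (2 * m - 1) dvd k - k'" by (rule order_C)
    moreover have "\<bar>k - k'\<bar> < 2 ^ (2 * m - 1)" using st by (auto simp: s t T_def)
    ultimately have "k = k'" using dvd_imp_le_int[of "k - k'" "2 ^ (2 * m - 1)"] by fastforce
    then show "s = t" using ij s t by simp
  qed
  moreover have "\<phi> ` T = carrier G"
  proof
    show "\<phi> ` T \<subseteq> carrier G" by (auto simp: \<phi>_def)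
    show "carrier G \<subseteq> \<phi> ` T"
    proof
      fix x assume "x \<in> carrier G"
      then obtain i j k :: int where x: "x = A [^] i \<otimes> B [^] j \<otimes> C [^] k" using carrier_eq_nf nfE by blast
      define i0 where "i0 = i mod 2 ^ (2 * m - 1)"
      have "2 ^ (2 * m - 1) dvd i - i0" by (simp add: i0_def)
      then obtain j1 k1 :: int where 1: "A [^] (i - i0) = B [^] j1 \<otimes> C [^] k1" using A_half_reduce by blast
      obtain w :: int where w: "C [^] k1 \<otimes> B [^] j = B [^] (j * w) \<otimes> C [^] k1" using C_int_pow_B_pow by blast
      define j2 k2 where "j2 = j1 + j * w" and "k2 = k1 + k"
      have "A [^] i = A [^] i0 \<otimes> (B [^] j1 \<otimes> C [^] k1)" unfolding 1[symmetric] by (simp add: int_pow_add)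
      then have "x = A [^] i0 \<otimes> (B [^] j1 \<otimes> (C [^] k1 \<otimes> B [^] j) \<otimes> C [^] k)" unfolding x by (simp add: m_assoc)
      also have "\<dots> = A [^] i0 \<otimes> B [^] j2 \<otimes> C [^] k2" unfolding w j2_def k2_def
        by (simp add: m_assoc int_pow_add int_pow_add_assoc)
      also have "B [^] j2 = B [^] (j2 mod 2 ^ (3 * m - 1))"
        by (rule int_pow_cong[OF B B_pow_order[OF dvd_refl]]) simp
      also have "C [^] k2 = C [^] (k2 mod 2 ^ (2 * m - 1))"
        by (rule int_pow_cong[OF C C_pow_order[OF dvd_refl]]) simp
      finally have "x = \<phi> (i0, j2 mod 2 ^ (3 * m - 1), k2 mod 2 ^ (2 * m - 1))" by (simp add: \<phi>_def)
      moreover have "(i0, j2 mod 2 ^ (3 * m - 1), k2 mod 2 ^ (2 * m - 1)) \<in> T" by (simp add: T_def i0_def)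
      ultimately show "x \<in> \<phi> ` T" by blast
    qed
  qed
  ultimately have "card (carrier G) = card T" using card_image by metis
  also have "\<dots> = 2 ^ (2 * m - 1) * (2 ^ (3 * m - 1) * 2 ^ (2 * m - 1))"
    unfolding T_def card_cartesian_product by (simp add: nat_power_eq)
  also have "\<dots> = 2 ^ (7 * m - 3)" using m by (simp add: power_add[symmetric])
  finally show ?thesis .
qed

text \<open>With n = \<alpha>-1, the elements C, A^-n, [A^n, B] and [[A^n, B], A] = A^(1 -
  \<alpha>^n) lie one term deeper each time. The last exponent has valuation 2m < 3m-1.\<close>

lemma lcs4: "lcs G 4 \<noteq> {\<one>}"
proof
  assume triv: "lcs G 4 = {\<one>}"
  have "C \<in> lcs G 1" using lcs_gcomm[of A 0 B] gcomm_A_B by simp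
  then have "gcomm G C A \<in> lcs G (Suc 1)" by (rule lcs_gcomm) simp
  then have "A [^] (1 - int \<alpha>) \<in> lcs G 2" using gcomm_C_pow_A[of 1] by (simp add: numeral_2_eq_2)
  then have "inv (A [^] (1 - int \<alpha>)) \<in> lcs G 2" by (rule lcs_inv)
  moreover define n where "n = \<alpha> - 1"
  have "int \<alpha> > 0" using odd_alpha by (cases \<alpha>) auto
  then have n: "int n = int \<alpha> - 1" by (simp add: n_def)
  ultimately have "A [^] n \<in> lcs G 2" by (simp add: int_pow_neg[symmetric] int_pow_int[symmetric] n)
  then have y: "gcomm G (A [^] n) B \<in> lcs G 3" using lcs_gcomm[of "A [^] n" 2 B] by (simp add: numeral_3_eq_3 numeral_2_eq_2)
  \<comment> \<open>T collects the powers of A to the right of C^n; they commute with A and leave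
    the next commutator unchanged.\<close>
  define T where "T = A [^] n \<otimes> A [^] tsum (int \<alpha>) n"
  have T: "T \<in> carrier G" by (simp add: T_def)
  have TA: "T = A [^] (int n + tsum (int \<alpha>) n)" by (simp add: T_def int_pow_mult int_pow_int)
  have "gcomm G (A [^] n) B = inv (A [^] n) \<otimes> (C [^] n \<otimes> T)" unfolding gcomm_A_pow_B T_def by (simp add: m_assoc)
  moreover have "gcomm G (inv (A [^] n) \<otimes> (C [^] n \<otimes> T)) A = A [^] (1 - int \<alpha> ^ n)"
  proof -
    have cA: "A [^] (k::int) \<otimes> A = A \<otimes> A [^] k" for k by (rule int_pow_twist) simp_all
    have "C [^] n \<otimes> A = A \<otimes> (inv A \<otimes> C [^] n \<otimes> A)" by (simp add: m_assoc)
    then have CA: "C [^] n \<otimes> A = A \<otimes> (C [^] n \<otimes> A [^] (1 - int \<alpha> ^ n))" unfolding conj_C_pow_A .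
    let ?y = "inv (A [^] n) \<otimes> (C [^] n \<otimes> T)"
    have "?y \<otimes> A = A [^] (- int n) \<otimes> (C [^] n \<otimes> (T \<otimes> A))"
      using T by (simp add: m_assoc int_pow_neg int_pow_int)
    also have "\<dots> = A [^] (- int n) \<otimes> ((C [^] n \<otimes> A) \<otimes> T)" using T cA by (simp add: TA m_assoc)
    also have "\<dots> = (A [^] (- int n) \<otimes> A) \<otimes> (C [^] n \<otimes> (A [^] (1 - int \<alpha> ^ n) \<otimes> T))"
      unfolding CA using T by (simp add: m_assoc)
    also have "\<dots> = A \<otimes> (A [^] (- int n) \<otimes> (C [^] n \<otimes> (T \<otimes> A [^] (1 - int \<alpha> ^ n))))"
      unfolding cA by (simp add: TA m_assoc int_pow_add add.commute)
    also have "\<dots> = A \<otimes> (?y \<otimes> A [^] (1 - int \<alpha> ^ n))"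
      using T by (simp add: m_assoc int_pow_neg int_pow_int)
    finally have "?y \<otimes> A = A \<otimes> (?y \<otimes> A [^] (1 - int \<alpha> ^ n))" .
    moreover define Y where "Y = ?y"
    ultimately have "Y \<otimes> A = A \<otimes> (Y \<otimes> A [^] (1 - int \<alpha> ^ n))" "Y \<in> carrier G" using T by simp_all
    then show ?thesis unfolding Y_def[symmetric] gcomm_def by (simp add: m_assoc)
  qed
  moreover have "gcomm G (gcomm G (A [^] n) B) A \<in> lcs G (Suc 3)" using y by (rule lcs_gcomm) simp
  ultimately have "A [^] (1 - int \<alpha> ^ n) = \<one>" using triv by (simp add: numeral_eq_Suc)
  then have "2 ^ (3 * m - 1) dvd 1 - int \<alpha> ^ n" by (rule order_A)
  then have d: "2 ^ (3 * m - 1) dvd int \<alpha> ^ n - 1" by (simp only: dvd_diff_commute)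
  have "int n = int (2 ^ m) * u" using n alpha by simp
  then have "0 \<le> int (2 ^ m) * u" by (metis of_nat_0_le_iff)
  then have "u = int (nat u)" by (simp add: zero_le_mult_iff)
  then have nu: "n = 2 ^ m * nat u" using \<open>int n = int (2 ^ m) * u\<close> by (metis of_nat_eq_iff of_nat_mult)
  have "odd (nat u)" using u \<open>u = int (nat u)\<close> by (metis even_of_nat_iff)
  moreover have "4 dvd int \<alpha> - 1" using pow2_dvd_mono[of 2 m "int \<alpha> - 1"] alpha m by simp
  ultimately obtain y where y: "odd y" "gsum (int \<alpha>) n = 2 ^ m * y"
    using gsum_two_adic[of "int \<alpha>" "nat u" m] nu by auto
  have "int \<alpha> ^ n - 1 = 2 ^ (2 * m) * (u * y)"
    unfolding gsum_geometric[symmetric] y by (simp add: alpha power_add mult_2)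
  then have "2 ^ (3 * m - 1) dvd (2::int) ^ (2 * m) * (u * y)" using d by simp
  moreover have "coprime ((2::int) ^ (3 * m - 1)) (u * y)" using u y by simp
  ultimately have "(2::int) ^ (3 * m - 1) dvd 2 ^ (2 * m)" by (simp add: coprime_dvd_mult_left_iff)
  then have "int (2 ^ (3 * m - 1)) dvd int (2 ^ (2 * m))" by simp
  then have "(2::nat) ^ (3 * m - 1) dvd 2 ^ (2 * m)" by (simp only: int_dvd_int_iff)
  then have "3 * m - 1 \<le> 2 * m" by (rule power_dvd_imp_le) simp
  then show False using m by simp
qed

lemma nilpotency_class_5: "nilpotent_group G" "nilpotency_class G = 5"
proof -
  show "nilpotent_group G" unfolding nilpotent_group_def using lcs5 is_group by blast
  have "\<not> lcs G n = {\<one>}" if "n < 5" for n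
    using lcs_trivial_Suc[of n "4 - n"] lcs4 that by auto
  then show "nilpotency_class G = 5" unfolding nilpotency_class_def using lcs5
    by (intro Least_equality) (auto simp: not_less[symmetric])
qed

end

section \<open>The Sylow 2-subgroup of the presented group\<close>

text \<open>An internal direct product of a 2-torsion and an odd-torsion normal subgroup, which
  makes the description in \<open>two_part\<close> unique.\<close>

locale two_odd_split = group G for G (structure) +
  fixes N2 No :: "'a set"
  assumes N2: "N2 \<lhd> G" and No: "No \<lhd> G"
    and tors2: "\<And>x. x \<in> N2 \<Longrightarrow> \<exists>j. x [^] ((2::nat) ^ j) = \<one>"
    and torso: "\<And>x. x \<in> No \<Longrightarrow> \<exists>k::nat. odd k \<and> x [^] k = \<one>"
    and split: "\<And>g. g \<in> carrier G \<Longrightarrow> \<exists>x\<in>N2. \<exists>y\<in>No. g = x \<otimes> y"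
begin

lemma N2_closed [simp]: "x \<in> N2 \<Longrightarrow> x \<in> carrier G" and No_closed [simp]: "x \<in> No \<Longrightarrow> x \<in> carrier G"
  using subgroup.mem_carrier[OF normal_imp_subgroup[OF N2]] subgroup.mem_carrier[OF normal_imp_subgroup[OF No]] by simp_all

sublocale N2: normal N2 G by (rule N2)
sublocale No: normal No G by (rule No)

lemma two_odd_trivial:
  assumes "x \<in> carrier G" "x [^] ((2::nat) ^ j) = \<one>" "x [^] (k::nat) = \<one>" "odd k"
  shows "x = \<one>"
proof -
  have "ord x dvd 2 ^ j" "ord x dvd k" using assms pow_eq_id by auto
  moreover have "coprime ((2::nat) ^ j) k" using assms(4) by simp
  ultimately have "ord x = 1" by (meson coprime_common_divisor nat_dvd_1_iff_1)
  then show ?thesis using assms(1) ord_eq_1 by blast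
qed

lemma inter_trivial: "x \<in> N2 \<Longrightarrow> x \<in> No \<Longrightarrow> x = \<one>"
  using tors2 torso two_odd_trivial N2_closed by metis

lemma commute: "x \<in> N2 \<Longrightarrow> y \<in> No \<Longrightarrow> x \<otimes> y = y \<otimes> x"
proof -
  assume x: "x \<in> N2" and y: "y \<in> No"
  let ?c = "x \<otimes> y \<otimes> inv x \<otimes> inv y"
  have "x \<otimes> (y \<otimes> inv x \<otimes> inv y) \<in> N2" using x y by (intro N2.m_closed N2.inv_op_closed2) simp_all
  moreover have "(x \<otimes> y \<otimes> inv x) \<otimes> inv y \<in> No" using x y by (intro No.m_closed No.inv_op_closed2) simp_all
  ultimately have "?c = \<one>" using inter_trivial[of ?c] x y by (simp add: m_assoc)
  then have "?c \<otimes> y \<otimes> x = \<one> \<otimes> y \<otimes> x" by simp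
  then show ?thesis using x y by (simp add: m_assoc)
qed

lemma split_unique:
  assumes "x \<in> N2" "x' \<in> N2" "y \<in> No" "y' \<in> No" "x \<otimes> y = x' \<otimes> y'"
  shows "x = x'" "y = y'"
proof -
  have "inv x' \<otimes> (x \<otimes> y) \<otimes> inv y = inv x' \<otimes> (x' \<otimes> y') \<otimes> inv y" by (simp add: assms(5))
  then have eq: "inv x' \<otimes> x = y' \<otimes> inv y" using assms(1-4) by (simp add: m_assoc)
  have "inv x' \<otimes> x \<in> N2" using assms by simp
  moreover have "inv x' \<otimes> x \<in> No" unfolding eq using assms by simp
  ultimately have 1: "inv x' \<otimes> x = \<one>" by (rule inter_trivial)
  then have "x' \<otimes> (inv x' \<otimes> x) = x' \<otimes> \<one>" by simp
  then show x: "x = x'" using assms(1,2) by simp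
  show "y = y'" using assms(5) unfolding x using assms by simp
qed

lemma pow_split: "x \<in> N2 \<Longrightarrow> y \<in> No \<Longrightarrow> (x \<otimes> y) [^] (k::int) = x [^] k \<otimes> y [^] k"
  using int_pow_mult_distrib[OF commute] by simp

lemma two_elements_eq: "two_elements G = N2"
proof
  show "N2 \<subseteq> two_elements G"
  proof
    fix x assume x: "x \<in> N2"
    then obtain j where "x [^] ((2::nat) ^ j) = \<one>" using tors2 by blast
    then have "ord x dvd 2 ^ j" using x pow_eq_id by simp
    then obtain k where "ord x = 2 ^ k" using divides_primepow_nat[of 2 "ord x" j] by auto
    then show "x \<in> two_elements G" using x by (auto simp: two_elements_def)
  qed
  show "two_elements G \<subseteq> N2"
  proof
    fix g assume "g \<in> two_elements G"
    then obtain k where g: "g \<in> carrier G" "ord g = 2 ^ k" by (auto simp: two_elements_def)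
    then obtain x y where xy: "x \<in> N2" "y \<in> No" "g = x \<otimes> y" using split by blast
    have "g [^] ((2::nat) ^ k) = \<one>" using g pow_ord_eq_1 by metis
    then have "g [^] int (2 ^ k) = \<one>" by (simp only: int_pow_int)
    then have "x [^] int (2 ^ k) \<otimes> y [^] int (2 ^ k) = \<one> \<otimes> \<one>"
      unfolding pow_split[OF xy(1,2), symmetric] xy(3)[symmetric] by simp
    moreover have "x [^] int (2 ^ k) \<in> N2" "y [^] int (2 ^ k) \<in> No"
      using xy subgroup_int_pow_closed N2.subgroup_axioms No.subgroup_axioms by auto
    ultimately have "y [^] int (2 ^ k) = \<one>" using split_unique(2) N2.one_closed No.one_closed by blast
    then have "y [^] ((2::nat) ^ k) = \<one>" by (simp only: int_pow_int)
    then have "y = \<one>" using torso[OF xy(2)] two_odd_trivial xy(2) by (metis No_closed)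
    then show "g \<in> N2" using xy by simp
  qed
qed

lemma odd_order_mem: "y \<in> carrier G \<Longrightarrow> odd (ord y) \<Longrightarrow> y \<in> No"
proof -
  assume y: "y \<in> carrier G" "odd (ord y)"
  then obtain x z where xz: "x \<in> N2" "z \<in> No" "y = x \<otimes> z" using split by blast
  have "y [^] int (ord y) = \<one>" using y by (simp add: int_pow_int)
  then have "x [^] int (ord y) \<otimes> z [^] int (ord y) = \<one> \<otimes> \<one>"
    using pow_split[OF xz(1,2)] xz(3) by simp
  moreover have "x [^] int (ord y) \<in> N2" "z [^] int (ord y) \<in> No"
    using xz subgroup_int_pow_closed N2.subgroup_axioms No.subgroup_axioms by auto
  ultimately have "x [^] int (ord y) = \<one>" using split_unique(1) N2.one_closed No.one_closed by blast
  then have "x [^] ord y = \<one>" by (simp only: int_pow_int)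
  then have "x = \<one>" using tors2[OF xz(1)] two_odd_trivial xz(1) y(2) by (metis N2_closed)
  then show ?thesis using xz by simp
qed

lemma two_part_eq:
  assumes "x \<in> N2" "y \<in> No"
  shows "two_part G (x \<otimes> y) = x"
  unfolding two_part_def
proof (rule the_equality)
  obtain k where "odd k" "y [^] (k::nat) = \<one>" using torso assms(2) by blast
  then have "odd (ord y)" using pow_eq_id[of y k] assms(2) by (metis No_closed dvd_trans)
  then show "x \<in> two_elements G \<and> (\<exists>z\<in>carrier G. odd (ord z) \<and> x \<otimes> z = x \<otimes> y \<and> x \<otimes> z = z \<otimes> x)"
    using assms commute two_elements_eq by (intro conjI bexI[of _ y]) simp_all
  show "x' = x" if "x' \<in> two_elements G \<and> (\<exists>z\<in>carrier G. odd (ord z) \<and> x' \<otimes> z = x \<otimes> y \<and> x' \<otimes> z = z \<otimes> x')" for x'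
  proof -
    from that obtain z where "x' \<in> N2" "z \<in> carrier G" "odd (ord z)" "x' \<otimes> z = x \<otimes> y" using two_elements_eq by blast
    then show ?thesis using split_unique(1)[of x' x z y] odd_order_mem assms by blast
  qed
qed

lemma carrier_Sylow2: "carrier (Sylow2 G) = N2" and Sylow2_eq: "Sylow2 G = G\<lparr>carrier := N2\<rparr>"
  by (simp_all add: Sylow2_def two_elements_eq)

lemma two_part_hom: "group_hom G (Sylow2 G) (two_part G)"
proof (rule group_hom.intro)
  show "group (Sylow2 G)" unfolding Sylow2_eq by (rule N2.subgroup_is_group[OF is_group])
  have "two_part G g \<in> N2" if "g \<in> carrier G" for g
    using split[OF that] two_part_eq by auto
  moreover have "two_part G (g \<otimes> h) = two_part G g \<otimes> two_part G h" if gh: "g \<in> carrier G" "h \<in> carrier G" for g h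
  proof -
    obtain x y x' y' where x: "x \<in> N2" "y \<in> No" "g = x \<otimes> y" and x': "x' \<in> N2" "y' \<in> No" "h = x' \<otimes> y'"
      using split gh by meson
    have "g \<otimes> h = x \<otimes> (y \<otimes> x') \<otimes> y'" using x x' by (simp add: m_assoc)
    also have "y \<otimes> x' = x' \<otimes> y" using commute[OF x'(1) x(2)] by simp
    also have "x \<otimes> (x' \<otimes> y) \<otimes> y' = (x \<otimes> x') \<otimes> (y \<otimes> y')" using x x' by (simp add: m_assoc)
    finally show ?thesis using x x' two_part_eq[of "x \<otimes> x'" "y \<otimes> y'"] two_part_eq[of x y] two_part_eq[of x' y'] by simp
  qed
  ultimately show "group_hom_axioms G (Sylow2 G) (two_part G)"
    by unfold_locales (auto simp: hom_def Sylow2_eq)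
qed (rule is_group)

lemma two_part_image: "two_part G ` carrier G = N2"
proof
  show "two_part G ` carrier G \<subseteq> N2" using split two_part_eq by fastforce
  show "N2 \<subseteq> two_part G ` carrier G"
  proof
    fix x assume "x \<in> N2"
    then show "x \<in> two_part G ` carrier G" using two_part_eq[of x \<one>] No.one_closed by (intro image_eqI[of _ _ x]) simp_all
  qed
qed

end

lemma (in group) normal_product_split:
  assumes "M \<lhd> G" "N \<lhd> G" "carrier G = generate G S" "\<And>g. g \<in> S \<Longrightarrow> \<exists>x\<in>M. \<exists>y\<in>N. g = x \<otimes> y" "g \<in> carrier G"
  shows "\<exists>x\<in>M. \<exists>y\<in>N. g = x \<otimes> y"
proof -
  have "subgroup (M <#> N) G" using mult_norm_subgroup[OF assms(1) normal_imp_subgroup[OF assms(2)]] .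
  moreover have "S \<subseteq> M <#> N" using assms(4) by (fastforce simp: set_mult_def)
  ultimately have "generate G S \<subseteq> M <#> N" by (intro generate_subgroup_incl)
  then have "g \<in> M <#> N" using assms(3,5) by blast
  then show ?thesis by (fastforce simp: set_mult_def)
qed

section \<open>The presentation as an instance of the relations\<close>

lemma macdonald_Gpres: "macdonald (Gpres \<alpha> \<beta>) (gA \<alpha> \<beta>) (gB \<alpha> \<beta>) (gC \<alpha> \<beta>) \<alpha> \<beta>"
proof -
  interpret group "Gpres \<alpha> \<beta>" by (rule group_Gpres)
  let ?G = "Gpres \<alpha> \<beta>" and ?c = "wcls \<alpha> \<beta>"
  have ABC: "gA \<alpha> \<beta> = ?c wA" "gB \<alpha> \<beta> = ?c wB" "gC \<alpha> \<beta> = ?c wC"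
    by (auto simp: gA_def gB_def gC_def wcls_def)
  have car: "?c w \<in> carrier ?G" for w by (simp add: carrier_Gpres)
  have C: "?c wC = inv\<^bsub>?G\<^esub> ?c wA \<otimes>\<^bsub>?G\<^esub> (inv\<^bsub>?G\<^esub> ?c wB \<otimes>\<^bsub>?G\<^esub> (?c wA \<otimes>\<^bsub>?G\<^esub> ?c wB))"
    by (simp add: wC_def wcomm_def wcls_mult wcls_inv)
  have "?c (wconj wA wC) = ?c (wpow wA \<alpha>)"
    using weq.rel1[of \<alpha> \<beta> "[]" "[]"] by (simp add: wcls_eq_iff wC_def)
  then have rel1: "inv\<^bsub>?G\<^esub> ?c wC \<otimes>\<^bsub>?G\<^esub> (?c wA \<otimes>\<^bsub>?G\<^esub> ?c wC) = ?c wA [^]\<^bsub>?G\<^esub> \<alpha>"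
    by (simp add: wconj_def wcls_mult wcls_inv wcls_wpow)
  have "?c (wconj wB (winv wC)) = ?c (wpow wB \<beta>)"
    using weq.rel2[of \<alpha> \<beta> "[]" "[]"] by (simp add: wcls_eq_iff wC_def wcomm_def winv_append)
  then have rel2: "?c wC \<otimes>\<^bsub>?G\<^esub> (?c wB \<otimes>\<^bsub>?G\<^esub> inv\<^bsub>?G\<^esub> ?c wC) = ?c wB [^]\<^bsub>?G\<^esub> \<beta>"
    by (simp add: wconj_def wcls_mult wcls_inv wcls_wpow)
  show ?thesis unfolding ABC
  proof
    show "?c wA \<otimes>\<^bsub>?G\<^esub> ?c wB = ?c wB \<otimes>\<^bsub>?G\<^esub> (?c wA \<otimes>\<^bsub>?G\<^esub> ?c wC)"
      unfolding C using car by simp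
    have "?c wC \<otimes>\<^bsub>?G\<^esub> ?c wA [^]\<^bsub>?G\<^esub> \<alpha> = ?c wA \<otimes>\<^bsub>?G\<^esub> ?c wC"
      unfolding rel1[symmetric] using car by simp
    then show "?c wA \<otimes>\<^bsub>?G\<^esub> ?c wC = ?c wC \<otimes>\<^bsub>?G\<^esub> ?c wA [^]\<^bsub>?G\<^esub> \<alpha>" by simp
    show "?c wC \<otimes>\<^bsub>?G\<^esub> ?c wB = ?c wB [^]\<^bsub>?G\<^esub> \<beta> \<otimes>\<^bsub>?G\<^esub> ?c wC"
      unfolding rel2[symmetric] using car by (simp add: m_assoc)
  qed (rule car)+
qed

lemma (in macdonald) macdonald_hom_image:
  assumes "group_hom G H h"
  shows "macdonald H (h A) (h B) (h C) \<alpha> \<beta>"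
proof -
  interpret h: group_hom G H h by (rule assms)
  have pow: "h (x [^] k) = h x [^]\<^bsub>H\<^esub> k" if "x \<in> carrier G" for x and k :: int
    using h.hom_int_pow that by simp
  show ?thesis
  proof
    show "h A \<otimes>\<^bsub>H\<^esub> h B = h B \<otimes>\<^bsub>H\<^esub> (h A \<otimes>\<^bsub>H\<^esub> h C)" using arg_cong[OF AB, of h] by simp
    show "h A \<otimes>\<^bsub>H\<^esub> h C = h C \<otimes>\<^bsub>H\<^esub> h A [^]\<^bsub>H\<^esub> \<alpha>" using arg_cong[OF AC, of h] by (simp add: pow)
    show "h C \<otimes>\<^bsub>H\<^esub> h B = h B [^]\<^bsub>H\<^esub> \<beta> \<otimes>\<^bsub>H\<^esub> h C" using arg_cong[OF CB, of h] by (simp add: pow)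
  qed simp_all
qed

lemma (in macdonald) macdonald_cong:
  assumes "A [^] (n::int) = \<one>" "B [^] n = \<one>" "n dvd \<alpha> - \<alpha>'" "n dvd \<beta> - \<beta>'"
  shows "macdonald G A B C \<alpha>' \<beta>'"
  using AB AC CB int_pow_cong[OF A assms(1,3)] int_pow_cong[OF B assms(2,4)] by unfold_locales simp_all

text \<open>F = 2^L r, r odd, is a common exponent of A, B, C, enlarged by 2^l to make L as large as
  wanted. The number e is 0 modulo r and 1 modulo 2^L, so x = x^e x^(1-e) separates the two
  parts.\<close>

lemma (in macdonald_finite) two_odd_split_exists:
  assumes "R > 0" "C [^] (R::nat) = \<one>"
  obtains N2 No L e where "two_odd_split G N2 No" "L \<ge> l" "2 ^ L dvd e - (1::int)"
    "\<And>x. x \<in> {A, B, C} \<Longrightarrow> x [^] e \<in> N2 \<and> x [^] (1 - e) \<in> No \<and> (x [^] e) [^] ((2::int) ^ L) = \<one>"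
proof -
  define F where "F = P * Q * R * 2 ^ l"
  have "F \<noteq> 0" using P Q assms by (simp add: F_def)
  then obtain r where r: "F = 2 ^ multiplicity 2 F * r" "odd r"
    using multiplicity_decompose'[of F 2] by auto
  define L where "L = multiplicity 2 F"
  note r = r[folded L_def]
  have "2 ^ l dvd F" by (simp add: F_def)
  then have L: "l \<le> L" unfolding L_def using \<open>F \<noteq> 0\<close> by (intro multiplicity_geI) simp_all
  have tors: "x [^] F = \<one>" if "x \<in> {A, B, C}" for x
  proof -
    have "A [^] F = \<one>" using pow_eq_id[OF A] P dvd_trans[of "ord A" P F] by (simp add: F_def)
    moreover have "B [^] F = \<one>" using pow_eq_id[OF B] Q dvd_trans[of "ord B" Q F] by (simp add: F_def)
    moreover have "C [^] F = \<one>" using pow_eq_id[OF C] assms dvd_trans[of "ord C" R F] by (simp add: F_def)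
    ultimately show ?thesis using that by blast
  qed
  have F: "F = r * 2 ^ L" using r(1) by (simp add: mult.commute)
  have car: "x \<in> carrier G" if "x \<in> {A, B, C}" for x using that by auto
  have tors1: "A [^] (r * 2 ^ L) = \<one>" "B [^] (r * 2 ^ L) = \<one>" "C [^] (r * 2 ^ L) = \<one>"
    unfolding F[symmetric] by (simp_all add: tors)
  have tors2: "A [^] (2 ^ L * r) = \<one>" "B [^] (2 ^ L * r) = \<one>" "C [^] (2 ^ L * r) = \<one>"
    unfolding r(1)[symmetric] by (simp_all add: tors)
  have r0: "r \<noteq> 0" using r(2) by (metis even_zero)
  obtain N2 where N2: "N2 \<lhd> G" "\<And>x. x \<in> {A, B, C} \<Longrightarrow> x [^] r \<in> N2" "\<And>x. x \<in> N2 \<Longrightarrow> \<exists>j. x [^] ((2 ^ L) ^ j :: nat) = \<one>"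
    using chain[OF _ tors1] by auto
  obtain No where No: "No \<lhd> G" "\<And>x. x \<in> {A, B, C} \<Longrightarrow> x [^] ((2::nat) ^ L) \<in> No" "\<And>x. x \<in> No \<Longrightarrow> \<exists>j. x [^] (r ^ j) = \<one>"
    using chain[OF r0 tors2] by auto
  interpret N2: normal N2 G by (rule N2)
  interpret No: normal No G by (rule No)
  obtain w where w: "odd w" "2 ^ L dvd int r * w - 1" using two_adic_inverse[of "int r" L] r(2) by auto
  define e where "e = int r * w"
  have e: "2 ^ L dvd e - 1" using w(2) by (simp add: e_def)
  have mem: "x [^] e \<in> N2 \<and> x [^] (1 - e) \<in> No \<and> (x [^] e) [^] ((2::int) ^ L) = \<one>" if x: "x \<in> {A, B, C}" for x
  proof (intro conjI)
    have "x [^] e = (x [^] r) [^] w" using car[OF x] by (simp add: e_def int_pow_pow[symmetric] int_pow_int)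
    then show "x [^] e \<in> N2" using subgroup_int_pow_closed[OF N2.subgroup_axioms N2(2)[OF x]] by simp
    have "2 ^ L dvd 1 - e" using e by (simp only: dvd_diff_commute)
    then obtain y where "1 - e = int (2 ^ L) * y" by (auto simp: dvd_def)
    then have "x [^] (1 - e) = (x [^] ((2::nat) ^ L)) [^] y"
      using car[OF x] by (simp only: int_pow_pow[symmetric] int_pow_int)
    then show "x [^] (1 - e) \<in> No" using subgroup_int_pow_closed[OF No.subgroup_axioms No(2)[OF x]] by simp
    have "e * 2 ^ L = int F * w" by (simp add: e_def F)
    then have "(x [^] e) [^] ((2::int) ^ L) = (x [^] F) [^] w"
      using car[OF x] by (simp only: int_pow_pow int_pow_int[symmetric] int_pow_closed)
    then show "(x [^] e) [^] ((2::int) ^ L) = \<one>" by (simp add: tors[OF x])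
  qed
  have "two_odd_split G N2 No"
  proof
    show "\<exists>j. x [^] ((2::nat) ^ j) = \<one>" if "x \<in> N2" for x
      using N2(3)[OF that] by (auto simp: power_mult[symmetric])
    show "\<exists>k::nat. odd k \<and> x [^] k = \<one>" if "x \<in> No" for x
    proof -
      from No(3)[OF that] obtain j where "x [^] (r ^ j) = \<one>" by blast
      then show ?thesis using r(2) by (intro exI[of _ "r ^ j"]) simp
    qed
    show "\<exists>x\<in>N2. \<exists>y\<in>No. g = x \<otimes> y" if "g \<in> carrier G" for g
    proof (rule normal_product_split[OF N2(1) No(1) gen _ that])
      fix x assume x: "x \<in> {A, B}"
      then have "x = x [^] e \<otimes> x [^] (1 - e)" by (auto simp: int_pow_add)
      then show "\<exists>y\<in>N2. \<exists>z\<in>No. x = y \<otimes> z" using mem[of x] x by blast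
    qed
  qed
  then show thesis using that L e mem by blast
qed

text \<open>Replacing \<beta> by its residue modulo the period changes v by 192 p^2 z and \<eta> by
  96 p z, hence no parity. The value of t is -u w with w an inverse of \<alpha> modulo
  2^(2m-1).\<close>

lemma macdonald_model_exists:
  fixes \<alpha> \<beta> u v \<eta> :: int
  assumes m: "m \<ge> 3" and alpha: "\<alpha> = 1 + 2 ^ m * u" and beta: "\<beta> = 1 + 2 ^ m * v"
    and u: "odd u" and v: "odd v" and N: "\<alpha> - \<beta> = 2 ^ (2 * m - 2) * \<eta>" and eta: "odd \<eta>"
  obtains p v' t \<eta>' \<rho> \<beta>' where "macdonald_model p u v' t \<eta>' \<rho> \<beta>'" "p = 2 ^ (m - 3)"
    "[\<beta> = int \<beta>'] (mod 6 * (256 * p ^ 3))"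
proof -
  obtain n where n: "m = n + 3" using m by (metis add.commute le_Suc_ex)
  define p :: int where "p = 2 ^ n"
  have p: "p > 0" by (simp add: p_def)
  have pm: "2 ^ m = 8 * p" "2 ^ (2 * m - 2) = 16 * p\<^sup>2" "2 ^ (2 * m - 1) = 32 * p\<^sup>2"
  proof -
    have "2 * m - 2 = 2 * n + 4" "2 * m - 1 = 2 * n + 5" using n by simp_all
    then show "2 ^ m = 8 * p" "2 ^ (2 * m - 2) = 16 * p\<^sup>2" "2 ^ (2 * m - 1) = 32 * p\<^sup>2"
      by (simp_all add: n p_def power_add power_mult power2_eq_square power_mult_distrib flip: power_mult_distrib)
  qed
  define z where "z = \<beta> div (6 * (256 * p ^ 3))"
  define \<beta>' where "\<beta>' = nat (\<beta> mod (6 * (256 * p ^ 3)))"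
  have b': "int \<beta>' = \<beta> mod (6 * (256 * p ^ 3))" using p by (simp add: \<beta>'_def)
  also have "\<dots> = \<beta> - 6 * (256 * p ^ 3) * z" by (simp add: z_def minus_mult_div_eq_mod)
  also have "\<dots> = 1 + 8 * p * (v - 192 * p\<^sup>2 * z)"
    by (simp add: beta pm algebra_simps power2_eq_square power3_eq_cube)
  finally have b: "int \<beta>' = 1 + 8 * p * (v - 192 * p\<^sup>2 * z)" .
  have "8 * p * (u - v) = 8 * p * (2 * p * \<eta>)"
    using N unfolding alpha beta pm by (simp add: algebra_simps power2_eq_square)
  then have uv: "u - v = 2 * p * \<eta>" using p by simp
  obtain w where w: "odd w" "2 ^ (2 * m - 1) dvd (1 + 8 * p * u) * w - 1" using two_adic_inverse[of "1 + 8 * p * u"] by auto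
  then obtain \<rho> where "(1 + 8 * p * u) * w - 1 = 32 * p\<^sup>2 * \<rho>" unfolding pm by blast
  then have "u * ((1 + 8 * p * u) * w - 1) = u * (32 * p\<^sup>2 * \<rho>)" by simp
  then have t: "u + (- u * w) + 8 * p * u * (- u * w) = 32 * p\<^sup>2 * (- u * \<rho>)"
    by (simp add: algebra_simps)
  have "macdonald_model p u (v - 192 * p\<^sup>2 * z) (- u * w) (\<eta> + 96 * p * z) (- u * \<rho>) \<beta>'"
  proof
    show "\<exists>k. p = 2 ^ k" using p_def by blast
    show "u - (v - 192 * p\<^sup>2 * z) = 2 * p * (\<eta> + 96 * p * z)" using uv by (simp add: algebra_simps power2_eq_square)
  qed (use u v eta w t b in simp_all)
  moreover have "[\<beta> = int \<beta>'] (mod 6 * (256 * p ^ 3))" unfolding b' by (simp add: cong_def)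
  ultimately show thesis using that[of p] n by (simp add: p_def)
qed

text \<open>Exponents are given up to congruence because it is applied to the e-multiples that occur
  in a = A^e, b = B^e, c = C^e, with e = 1 modulo 2^(3m-1).\<close>

lemma Gpres_normal_form:
  fixes \<alpha> \<beta> u v \<eta> :: int
  assumes m: "m \<ge> 3" and alpha: "\<alpha> = 1 + 2 ^ m * u" and beta: "\<beta> = 1 + 2 ^ m * v"
    and u: "odd u" and v: "odd v" and N: "\<alpha> - \<beta> = 2 ^ (2 * m - 2) * \<eta>" and eta: "odd \<eta>"
  shows Gpres_normal_form_inj: "\<And>(i::int) (j::int) (k::int) (i'::int) (j'::int) (k'::int) x y x' y'.
      gA \<alpha> \<beta> [^]\<^bsub>Gpres \<alpha> \<beta>\<^esub> i \<otimes>\<^bsub>Gpres \<alpha> \<beta>\<^esub> gB \<alpha> \<beta> [^]\<^bsub>Gpres \<alpha> \<beta>\<^esub> j \<otimes>\<^bsub>Gpres \<alpha> \<beta>\<^esub> gC \<alpha> \<beta> [^]\<^bsub>Gpres \<alpha> \<beta>\<^esub> k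
      = gA \<alpha> \<beta> [^]\<^bsub>Gpres \<alpha> \<beta>\<^esub> i' \<otimes>\<^bsub>Gpres \<alpha> \<beta>\<^esub> gB \<alpha> \<beta> [^]\<^bsub>Gpres \<alpha> \<beta>\<^esub> j' \<otimes>\<^bsub>Gpres \<alpha> \<beta>\<^esub> gC \<alpha> \<beta> [^]\<^bsub>Gpres \<alpha> \<beta>\<^esub> k'
    \<Longrightarrow> [i = x] (mod 2 ^ (3 * m - 1)) \<Longrightarrow> [j = y] (mod 2 ^ (3 * m - 1))
    \<Longrightarrow> [i' = x'] (mod 2 ^ (3 * m - 1)) \<Longrightarrow> [j' = y'] (mod 2 ^ (3 * m - 1))
    \<Longrightarrow> x \<in> {0..<2 ^ (2 * m - 1)} \<Longrightarrow> x' \<in> {0..<2 ^ (2 * m - 1)}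
    \<Longrightarrow> y \<in> {0..<2 ^ (3 * m - 1)} \<Longrightarrow> y' \<in> {0..<2 ^ (3 * m - 1)} \<Longrightarrow> x = x' \<and> y = y'"
    and Gpres_order_A: "\<And>i::int. gA \<alpha> \<beta> [^]\<^bsub>Gpres \<alpha> \<beta>\<^esub> i = \<one>\<^bsub>Gpres \<alpha> \<beta>\<^esub> \<Longrightarrow> 2 ^ (3 * m - 1) dvd i"
proof -
  obtain p v' t \<eta>' \<rho> \<beta>' where model: "macdonald_model p u v' t \<eta>' \<rho> \<beta>'" and p_def: "p = 2 ^ (m - 3)"
    and b: "[\<beta> = int \<beta>'] (mod 6 * (256 * p ^ 3))"
    by (rule macdonald_model_exists[OF assms])
  interpret macdonald_model p u v' t \<eta>' \<rho> \<beta>' by (rule model)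
  interpret G: group "Gpres \<alpha> \<beta>" by (rule group_Gpres)
  obtain n where n: "m = n + 3" using m by (metis add.commute le_Suc_ex)
  have pn: "p = 2 ^ n" using p_def n by simp
  have pm: "2 ^ m = 8 * p" "2 ^ (2 * m - 1) = 32 * p\<^sup>2" "2 ^ (3 * m - 1) = q"
  proof -
    have "2 * m - 1 = n * 2 + 5" "3 * m - 1 = n * 3 + 8" using n by simp_all
    then show "2 ^ m = 8 * p" "2 ^ (2 * m - 1) = 32 * p\<^sup>2" "2 ^ (3 * m - 1) = q"
      by (simp_all only: n pn power_add power_mult) simp_all
  qed
  have bp: "[\<beta> = int \<beta>'] (mod int period)" using b by (simp add: int_period)
  have a: "\<alpha> = 1 + 8 * p * u" by (simp add: alpha pm)
  let ?w = "\<lambda>i j k. wpow wA i @ wpow wB j @ wpow wC k"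
  have cls: "gA \<alpha> \<beta> [^]\<^bsub>Gpres \<alpha> \<beta>\<^esub> i \<otimes>\<^bsub>Gpres \<alpha> \<beta>\<^esub> gB \<alpha> \<beta> [^]\<^bsub>Gpres \<alpha> \<beta>\<^esub> j \<otimes>\<^bsub>Gpres \<alpha> \<beta>\<^esub> gC \<alpha> \<beta> [^]\<^bsub>Gpres \<alpha> \<beta>\<^esub> k
      = wcls \<alpha> \<beta> (?w i j k)" for i j k :: int
    by (simp add: gA_def gB_def gC_def wcls_def[symmetric] wcls_wpow[symmetric] wcls_mult)
  have eqv: "eqv (i, j) (i', j')" if "wcls \<alpha> \<beta> (?w i j k) = wcls \<alpha> \<beta> (?w i' j' k')" for i j k i' j' k'
  proof -
    have "weq (1 + 8 * p * u) \<beta> (?w i j k) (?w i' j' k')" using that unfolding a wcls_eq_iff .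
    from weq_eqv[OF bp this] have "eqv (weval (?w i j k) (0, 0)) (weval (?w i' j' k') (0, 0))" .
    from eqv_trans[OF eqv_trans[OF eqv_sym[OF weval_normal_form] this] weval_normal_form] show ?thesis .
  qed
  show "x = x' \<and> y = y'" if "gA \<alpha> \<beta> [^]\<^bsub>Gpres \<alpha> \<beta>\<^esub> i \<otimes>\<^bsub>Gpres \<alpha> \<beta>\<^esub> gB \<alpha> \<beta> [^]\<^bsub>Gpres \<alpha> \<beta>\<^esub> j \<otimes>\<^bsub>Gpres \<alpha> \<beta>\<^esub> gC \<alpha> \<beta> [^]\<^bsub>Gpres \<alpha> \<beta>\<^esub> k
      = gA \<alpha> \<beta> [^]\<^bsub>Gpres \<alpha> \<beta>\<^esub> i' \<otimes>\<^bsub>Gpres \<alpha> \<beta>\<^esub> gB \<alpha> \<beta> [^]\<^bsub>Gpres \<alpha> \<beta>\<^esub> j' \<otimes>\<^bsub>Gpres \<alpha> \<beta>\<^esub> gC \<alpha> \<beta> [^]\<^bsub>Gpres \<alpha> \<beta>\<^esub> k'"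
    and c: "[i = x] (mod 2 ^ (3 * m - 1))" "[j = y] (mod 2 ^ (3 * m - 1))"
      "[i' = x'] (mod 2 ^ (3 * m - 1))" "[j' = y'] (mod 2 ^ (3 * m - 1))"
    and "x \<in> {0..<2 ^ (2 * m - 1)}" "x' \<in> {0..<2 ^ (2 * m - 1)}"
      "y \<in> {0..<2 ^ (3 * m - 1)}" "y' \<in> {0..<2 ^ (3 * m - 1)}"
    for i j k i' j' k' x y x' y' :: int
  proof -
    have "eqv (i, j) (i', j')" using that(1) unfolding cls by (rule eqv)
    moreover have "eqv (x, y) (i, j)" "eqv (i', j') (x', y')"
      using c unfolding pm by (auto intro!: cgr_imp_eqv simp: cgr_def cong_sym)
    ultimately have "eqv (x, y) (x', y')" using eqv_trans by blast
    then show ?thesis by (rule eqv_unique) (use that(6-9)[unfolded pm] in simp_all)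
  qed
  show "2 ^ (3 * m - 1) dvd i" if "gA \<alpha> \<beta> [^]\<^bsub>Gpres \<alpha> \<beta>\<^esub> i = \<one>\<^bsub>Gpres \<alpha> \<beta>\<^esub>" for i :: int
  proof -
    have "gA \<alpha> \<beta> \<in> carrier (Gpres \<alpha> \<beta>)" "gB \<alpha> \<beta> \<in> carrier (Gpres \<alpha> \<beta>)" "gC \<alpha> \<beta> \<in> carrier (Gpres \<alpha> \<beta>)"
      by (simp_all add: carrier_Gpres gA_def gB_def gC_def wcls_def[symmetric])
    then have "wcls \<alpha> \<beta> (?w i 0 0) = wcls \<alpha> \<beta> (?w 0 0 0)" using that by (simp add: cls[symmetric])
    then have "eqv (i, 0) (0, 0)" by (rule eqv)
    then show ?thesis unfolding pm by (rule eqv_zero)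
  qed
qed


section \<open>Exact orders of the generators of the 2-part\<close>

lemma (in group) ord_eqI:
  assumes "x \<in> carrier G" "x [^] int n = \<one>" "\<And>i::int. x [^] i = \<one> \<Longrightarrow> int n dvd i"
  shows "ord x = n"
proof (rule dvd_antisym)
  show "ord x dvd n" using assms(1,2) by (simp add: int_pow_int pow_eq_id)
  have "x [^] int (ord x) = \<one>" using assms(1) by (simp add: int_pow_int)
  then have "int n dvd int (ord x)" by (rule assms(3))
  then show "n dvd ord x" by simp
qed

lemma (in macdonald_two_full) ord_A: "ord A = 2 ^ (3 * m - 1)"
  using ord_eqI[OF A, of "2 ^ (3 * m - 1)"] A_pow_order order_A by simp

lemma (in macdonald_two_full) ord_C: "ord C = 2 ^ (2 * m - 1)"
  using ord_eqI[OF C, of "2 ^ (2 * m - 1)"] C_pow_order order_C by simp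

text \<open>A smaller order would make B^(2^(3m-2)) trivial, which by \<open>A_B_top_power\<close>
  equals A^(2^(3m-2)).\<close>

lemma (in macdonald_two_full) ord_B: "ord B = 2 ^ (3 * m - 1)"
proof -
  have "B [^] int (2 ^ (3 * m - 1)) = \<one>" by (simp add: B_pow_order)
  then have "ord B dvd 2 ^ (3 * m - 1)" by (simp only: int_pow_int pow_eq_id B)
  then obtain k where k: "k \<le> 3 * m - 1" "ord B = 2 ^ k" using divides_primepow_nat[of 2 "ord B" "3 * m - 1"] by auto
  have "k = 3 * m - 1"
  proof (rule ccontr)
    assume "k \<noteq> 3 * m - 1"
    then have "(2::int) ^ k dvd 2 ^ (3 * m - 2)" using k(1) by (intro le_imp_power_dvd) simp
    then have "int (ord B) dvd 2 ^ (3 * m - 2)" using k(2) by simp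
    then have "A [^] (2 ^ (3 * m - 2) :: int) = \<one>" unfolding A_B_top_power by (simp only: int_pow_eq_id B)
    then have "(2::int) ^ (3 * m - 1) dvd 2 ^ (3 * m - 2)" by (rule order_A)
    then have "(2::int) ^ (3 * m - 1) \<le> 2 ^ (3 * m - 2)" by (rule zdvd_imp_le) simp
    then show False using m by simp
  qed
  then show ?thesis using k(2) by simp
qed

lemma ord_subgroup: "subgroup N G \<Longrightarrow> x \<in> N \<Longrightarrow> group G \<Longrightarrow> group.ord (G\<lparr>carrier := N\<rparr>) x = group.ord G x"
proof -
  assume N: "subgroup N G" "x \<in> N" and G: "group G"
  interpret group G by (rule G)
  interpret N: group "G\<lparr>carrier := N\<rparr>" by (rule subgroup.subgroup_is_group[OF N(1) G])
  have pow: "x [^]\<^bsub>G\<lparr>carrier := N\<rparr>\<^esub> n = x [^]\<^bsub>G\<^esub> n" for n :: int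
    using int_pow_consistent[OF N] by simp
  have x: "x \<in> carrier G" using N subgroup.mem_carrier by metis
  show ?thesis
  proof (rule N.ord_eqI)
    show "int (ord x) dvd i" if "x [^]\<^bsub>G\<lparr>carrier := N\<rparr>\<^esub> i = \<one>\<^bsub>G\<lparr>carrier := N\<rparr>\<^esub>" for i :: int
      using that x int_pow_eq_id unfolding pow by simp
    show "x [^]\<^bsub>G\<lparr>carrier := N\<rparr>\<^esub> int (ord x) = \<one>\<^bsub>G\<lparr>carrier := N\<rparr>\<^esub>"
      unfolding pow using x int_pow_eq_id by simp
  qed (use N in simp)
qed

text \<open>Only residues modulo 2^L matter for elements of exponent 2^L. Natural residues fit
  \<open>macdonald_two\<close>, and L >= 4m keeps the valuations.\<close>

lemma reduce_parameters:
  fixes \<alpha> \<beta> u v \<eta> :: int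
  assumes m: "m \<ge> 3" and alpha: "\<alpha> = 1 + 2 ^ m * u" and beta: "\<beta> = 1 + 2 ^ m * v"
    and u: "odd u" and v: "odd v" and N: "\<alpha> - \<beta> = 2 ^ (2 * m - 2) * \<eta>" and eta: "odd \<eta>"
    and L: "L \<ge> 4 * m"
  obtains \<alpha>' \<beta>' :: nat and u' v' \<eta>' where "2 ^ L dvd \<alpha> - int \<alpha>'" "2 ^ L dvd \<beta> - int \<beta>'"
    "int \<alpha>' = 1 + 2 ^ m * u'" "int \<beta>' = 1 + 2 ^ m * v'" "odd u'" "odd v'"
    "int \<alpha>' - int \<beta>' = 2 ^ (2 * m - 2) * \<eta>'" "odd \<eta>'"
proof -
  define d d' where "d = \<alpha> div 2 ^ L" and "d' = \<beta> div 2 ^ L"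
  have a: "int (nat (\<alpha> mod 2 ^ L)) = \<alpha> - 2 ^ L * d" and b: "int (nat (\<beta> mod 2 ^ L)) = \<beta> - 2 ^ L * d'"
    by (simp_all add: d_def d'_def minus_mult_div_eq_mod)
  have L1: "(2::int) ^ L = 2 ^ m * 2 ^ (L - m)" and L2: "(2::int) ^ L = 2 ^ (2 * m - 2) * 2 ^ (L - (2 * m - 2))"
    using L by (simp_all flip: power_add)
  show thesis
  proof (rule that)
    show "2 ^ L dvd \<alpha> - int (nat (\<alpha> mod 2 ^ L))" "2 ^ L dvd \<beta> - int (nat (\<beta> mod 2 ^ L))"
      unfolding a b by simp_all
    show "int (nat (\<alpha> mod 2 ^ L)) = 1 + 2 ^ m * (u - 2 ^ (L - m) * d)"
      unfolding a unfolding alpha L1 by (simp only: algebra_simps)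
    show "int (nat (\<beta> mod 2 ^ L)) = 1 + 2 ^ m * (v - 2 ^ (L - m) * d')"
      unfolding b unfolding beta L1 by (simp only: algebra_simps)
    show "odd (u - 2 ^ (L - m) * d)" "odd (v - 2 ^ (L - m) * d')" using u v L m by simp_all
    have "int (nat (\<alpha> mod 2 ^ L)) - int (nat (\<beta> mod 2 ^ L)) = (\<alpha> - \<beta>) - 2 ^ L * (d - d')"
      unfolding a b by (simp add: algebra_simps)
    also have "\<dots> = 2 ^ (2 * m - 2) * (\<eta> - 2 ^ (L - (2 * m - 2)) * (d - d'))"
      unfolding N L2 by (simp add: algebra_simps)
    finally show "int (nat (\<alpha> mod 2 ^ L)) - int (nat (\<beta> mod 2 ^ L))
        = 2 ^ (2 * m - 2) * (\<eta> - 2 ^ (L - (2 * m - 2)) * (d - d'))" .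
    show "odd (\<eta> - 2 ^ (L - (2 * m - 2)) * (d - d'))" using eta L m by simp
  qed
qed

theorem theorem16p2:
  fixes \<alpha> \<beta> :: int and m :: nat
  assumes "\<alpha> \<noteq> 1" and "\<beta> \<noteq> 1"
    and "multiplicity 2 (\<alpha> - 1) = m" and "multiplicity 2 (\<beta> - 1) = m" and "m \<ge> 3"
    and "multiplicity 2 (\<alpha> - \<beta>) = 2 * m - 2"
  shows "order (Sylow2 (Gpres \<alpha> \<beta>)) = 2 ^ (7 * m - 3)
    \<and> nilpotent_group (Sylow2 (Gpres \<alpha> \<beta>))
    \<and> nilpotency_class (Sylow2 (Gpres \<alpha> \<beta>)) = 5
    \<and> group.ord (Gpres \<alpha> \<beta>) (two_part (Gpres \<alpha> \<beta>) (gA \<alpha> \<beta>)) = 2 ^ (3 * m - 1)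
    \<and> group.ord (Gpres \<alpha> \<beta>) (two_part (Gpres \<alpha> \<beta>) (gB \<alpha> \<beta>)) = 2 ^ (3 * m - 1)
    \<and> group.ord (Gpres \<alpha> \<beta>) (two_part (Gpres \<alpha> \<beta>) (gC \<alpha> \<beta>)) = 2 ^ (2 * m - 1)"
proof -
  define G A B C where defs: "G = Gpres \<alpha> \<beta>" "A = gA \<alpha> \<beta>" "B = gB \<alpha> \<beta>" "C = gC \<alpha> \<beta>"
  interpret macdonald G A B C \<alpha> \<beta> unfolding defs by (rule macdonald_Gpres)
  interpret swap: macdonald G B A "inv\<^bsub>G\<^esub> C" \<beta> \<alpha> by (rule macdonald_swap)
  have m: "m \<ge> 3" by fact
  have ne: "\<alpha> \<noteq> \<beta>"
  proof
    assume "\<alpha> = \<beta>"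
    then show False using assms(5,6) by simp
  qed
  obtain u where u: "\<alpha> - 1 = 2 ^ m * u" "odd u"
    using multiplicity_decompose'[of "\<alpha> - 1" 2] assms(1,3) by auto
  obtain v where v: "\<beta> - 1 = 2 ^ m * v" "odd v"
    using multiplicity_decompose'[of "\<beta> - 1" 2] assms(2,4) by auto
  obtain \<eta> where \<eta>: "\<alpha> - \<beta> = 2 ^ (2 * m - 2) * \<eta>" "odd \<eta>"
    using multiplicity_decompose'[of "\<alpha> - \<beta>" 2] assms(6) ne by auto
  have alpha: "\<alpha> = 1 + 2 ^ m * u" and beta: "\<beta> = 1 + 2 ^ m * v" using u v by simp_all
  \<comment> \<open>An integer that is 1 modulo 8 and different from 1 is neither 0 nor -1.\<close>
  have big: "\<bar>x\<bar> \<ge> 2" if "x - 1 = 2 ^ m * y" "x \<noteq> 1" for x y :: int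
  proof -
    have "(2::int) ^ 3 dvd 2 ^ m" using m by (rule le_imp_power_dvd)
    then have "2 ^ 3 dvd x - 1" unfolding that(1) by (rule dvd_mult2)
    then have "8 dvd x - 1" by simp
    then show ?thesis using that(2) by presburger
  qed
  have bigA: "\<bar>\<alpha>\<bar> \<ge> 2" and bigB: "\<bar>\<beta>\<bar> \<ge> 2" using big u(1) v(1) assms(1,2) by blast+
  have P: "ord A > 0" using finite_order_A[OF assms(1,2) ne bigA] pow_eq_id[OF A] by (metis dvd_pos_nat)
  have Q: "ord B > 0" using swap.finite_order_A[OF assms(2,1) _ bigB] ne pow_eq_id[OF B] by (metis dvd_pos_nat)
  obtain R :: nat where R: "R > 0" "C [^]\<^bsub>G\<^esub> R = \<one>\<^bsub>G\<^esub>" using finite_order_C[OF assms(1,2) ne bigA] .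
  interpret macdonald_finite G A B C \<alpha> \<beta> "ord A" "ord B"
  proof
    show "carrier G = generate G {A, B}" unfolding defs by (rule generate_Gpres)
  qed (use P Q prime_dvd_order_A[OF P assms(1)] swap.prime_dvd_order_A[OF Q assms(2)] in simp_all)
  obtain N2 No L e where split: "two_odd_split G N2 No" and L: "L \<ge> 4 * m" and e: "2 ^ L dvd e - (1::int)"
    and mem: "\<And>x. x \<in> {A, B, C} \<Longrightarrow> x [^]\<^bsub>G\<^esub> e \<in> N2 \<and> x [^]\<^bsub>G\<^esub> (1 - e) \<in> No \<and> (x [^]\<^bsub>G\<^esub> e) [^]\<^bsub>G\<^esub> ((2::int) ^ L) = \<one>\<^bsub>G\<^esub>"
    by (rule two_odd_split_exists[OF R, of "4 * m"]) blast
  interpret two_odd_split G N2 No by (rule split)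
  interpret h: group_hom G "Sylow2 G" "two_part G" by (rule two_part_hom)
  have tp: "two_part G x = x [^]\<^bsub>G\<^esub> e" if "x \<in> {A, B, C}" for x
  proof -
    have "x = x [^]\<^bsub>G\<^esub> e \<otimes>\<^bsub>G\<^esub> x [^]\<^bsub>G\<^esub> (1 - e)" using that by (auto simp: int_pow_add)
    then show ?thesis using two_part_eq mem[OF that] by metis
  qed
  define a b c where abc: "a = two_part G A" "b = two_part G B" "c = two_part G C"
  have abc_e: "a = A [^]\<^bsub>G\<^esub> e" "b = B [^]\<^bsub>G\<^esub> e" "c = C [^]\<^bsub>G\<^esub> e" by (simp_all add: abc tp)
  have abc_N2: "a \<in> N2" "b \<in> N2" "c \<in> N2" using mem by (simp_all add: abc_e)
  have powH: "x [^]\<^bsub>Sylow2 G\<^esub> k = x [^]\<^bsub>G\<^esub> k" if "x \<in> N2" for x and k :: int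
    using int_pow_consistent[OF N2.subgroup_axioms that] by (simp add: Sylow2_eq)
  have oneH: "\<one>\<^bsub>Sylow2 G\<^esub> = \<one>\<^bsub>G\<^esub>" and multH: "(\<otimes>\<^bsub>Sylow2 G\<^esub>) = (\<otimes>\<^bsub>G\<^esub>)" by (simp_all add: Sylow2_def)
  have torsG: "a [^]\<^bsub>G\<^esub> ((2::int) ^ L) = \<one>\<^bsub>G\<^esub>" "b [^]\<^bsub>G\<^esub> ((2::int) ^ L) = \<one>\<^bsub>G\<^esub>" "c [^]\<^bsub>G\<^esub> ((2::int) ^ L) = \<one>\<^bsub>G\<^esub>"
    unfolding abc_e using mem by blast+
  have torsH: "x [^]\<^bsub>Sylow2 G\<^esub> ((2::int) ^ L) = \<one>\<^bsub>Sylow2 G\<^esub>" if "x \<in> {a, b, c}" for x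
    using that torsG abc_N2 powH oneH by auto
  have genH: "carrier (Sylow2 G) = generate (Sylow2 G) {a, b}"
  proof -
    have "two_part G ` generate G {A, B} = generate (Sylow2 G) {a, b}"
      using h.generate_img[of "{A, B}"] by (simp add: abc)
    then show ?thesis using two_part_image gen carrier_Sylow2 by simp
  qed
  have pow_e: "a [^]\<^bsub>Sylow2 G\<^esub> i = A [^]\<^bsub>G\<^esub> (e * i)" "b [^]\<^bsub>Sylow2 G\<^esub> i = B [^]\<^bsub>G\<^esub> (e * i)"
    "c [^]\<^bsub>Sylow2 G\<^esub> i = C [^]\<^bsub>G\<^esub> (e * i)" for i :: int
    unfolding powH[OF abc_N2(1)] powH[OF abc_N2(2)] powH[OF abc_N2(3)] unfolding abc_e by (simp_all add: int_pow_pow)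
  obtain \<alpha>0 \<beta>0 u0 v0 \<eta>0 where ab0: "2 ^ L dvd \<alpha> - int \<alpha>0" "2 ^ L dvd \<beta> - int \<beta>0"
    "int \<alpha>0 = 1 + 2 ^ m * u0" "int \<beta>0 = 1 + 2 ^ m * v0" "odd u0" "odd v0"
    "int \<alpha>0 - int \<beta>0 = 2 ^ (2 * m - 2) * \<eta>0" "odd \<eta>0"
    using reduce_parameters[OF m alpha beta u(2) v(2) \<eta> L] .
  interpret H: macdonald_two_full "Sylow2 G" a b c \<alpha>0 \<beta>0 m L u0 v0 \<eta>0
  proof (intro macdonald_two_full.intro macdonald_two_gen.intro macdonald_two.intro
      macdonald_two_axioms.intro macdonald_two_gen_axioms.intro macdonald_two_full_axioms.intro)
    \<comment> \<open>The relations descend to the 2-part with the original exponents and are then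
      reduced modulo 2^L.\<close>
    interpret Hm: macdonald "Sylow2 G" a b c \<alpha> \<beta> unfolding abc by (rule macdonald_hom_image[OF two_part_hom])
    show "macdonald (Sylow2 G) a b c (int \<alpha>0) (int \<beta>0)"
      by (rule Hm.macdonald_cong[OF _ _ ab0(1,2)]) (simp_all add: torsH)
    have "(2::int) ^ (3 * m - 1) dvd 2 ^ L" using L by (intro le_imp_power_dvd) simp
    then have e': "2 ^ (3 * m - 1) dvd e - 1" using e by (rule dvd_trans)
    have e_cong: "[e * i = i] (mod 2 ^ (3 * m - 1))" for i
    proof -
      have "2 ^ (3 * m - 1) dvd (e - 1) * i" using e' by (rule dvd_mult2)
      then show ?thesis by (simp add: cong_iff_dvd_diff algebra_simps)
    qed
    show "2 ^ (3 * m - 1) dvd i" if "a [^]\<^bsub>Sylow2 G\<^esub> i = \<one>\<^bsub>Sylow2 G\<^esub>" for i :: int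
    proof -
      have "A [^]\<^bsub>G\<^esub> (e * i) = \<one>\<^bsub>G\<^esub>" using that unfolding pow_e oneH .
      then have "2 ^ (3 * m - 1) dvd e * i"
        unfolding defs by (rule Gpres_order_A[OF m alpha beta u(2) v(2) \<eta>])
      then show ?thesis using cong_dvd_iff[OF e_cong] by simp
    qed
    show "i = i' \<and> j = j'"
      if eq: "a [^]\<^bsub>Sylow2 G\<^esub> i \<otimes>\<^bsub>Sylow2 G\<^esub> b [^]\<^bsub>Sylow2 G\<^esub> j \<otimes>\<^bsub>Sylow2 G\<^esub> c [^]\<^bsub>Sylow2 G\<^esub> k
          = a [^]\<^bsub>Sylow2 G\<^esub> i' \<otimes>\<^bsub>Sylow2 G\<^esub> b [^]\<^bsub>Sylow2 G\<^esub> j' \<otimes>\<^bsub>Sylow2 G\<^esub> c [^]\<^bsub>Sylow2 G\<^esub> k'"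
        and bounds: "0 \<le> i" "i < 2 ^ (2 * m - 1)" "0 \<le> i'" "i' < 2 ^ (2 * m - 1)"
          "0 \<le> j" "j < 2 ^ (3 * m - 1)" "0 \<le> j'" "j' < 2 ^ (3 * m - 1)"
      for i i' j j' k k' :: int
    proof -
      have "A [^]\<^bsub>G\<^esub> (e * i) \<otimes>\<^bsub>G\<^esub> B [^]\<^bsub>G\<^esub> (e * j) \<otimes>\<^bsub>G\<^esub> C [^]\<^bsub>G\<^esub> (e * k)
          = A [^]\<^bsub>G\<^esub> (e * i') \<otimes>\<^bsub>G\<^esub> B [^]\<^bsub>G\<^esub> (e * j') \<otimes>\<^bsub>G\<^esub> C [^]\<^bsub>G\<^esub> (e * k')"
        using eq unfolding pow_e multH .
      from Gpres_normal_form_inj[OF m alpha beta u(2) v(2) \<eta> this[unfolded defs] e_cong e_cong e_cong e_cong]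
      show ?thesis using bounds by simp
    qed
  qed (use m ab0 L torsH genH in simp_all)
  have ordH: "group.ord (Sylow2 G) x = group.ord G x" if "x \<in> N2" for x
    using ord_subgroup[OF N2.subgroup_axioms that is_group] by (simp add: Sylow2_eq)
  show ?thesis unfolding defs[symmetric] abc[symmetric]
    using H.card_carrier H.nilpotency_class_5 H.ord_A H.ord_B H.ord_C abc_N2 by (simp add: order_def ordH)
qed

end
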